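(* Let $S$ be a compact metric space, $\mu_0$ a finite nonnegative measure on $S$, and $a,b$ continuous functions on $S$ with $a>0$ and $b>0$. Let $Z_t$ be the $M(S)$-valued diffusion process with generator $$\tilde{\mathcal{L}}F(\mu)=\int_S\mu(ds)\,a(s)\frac{\delta^2F(\mu)}{\delta\mu(s)^2}+\int_S\big(\mu_0(ds)-\mu(ds)b(s)\big)\frac{\delta F(\mu)}{\delta\mu(s)},$$ and let $\Gamma_{a^{-1}b,\,a^{-1}\mu_0}$ be the probability measure on $M(S)$ (the unique invariant distribution of $Z_t$) characterized by $$E^{\Gamma_{a^{-1}b,a^{-1}\mu_0}}\big[e^{-\langle\mu,h\rangle}\big]=\exp\left(-\left\langle\mu_0,a^{-1}\log\left(1+\tfrac{a}{b}h\right)\right\rangle\right),\quad h\in B_+(S).$$ The law $\Gamma_{a^{-1}b,a^{-1}\mu_0}$ is $\Lambda$-quasi-invariant (with respect to $\{S_f:f\in B(S)\}$) and therefore the process $Z_t$ is reversible with respect to $\Gamma_{a^{-1}b,a^{-1}\mu_0}$.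
   Context: $M(S)$ is the space of finite nonnegative measures on $S$ with the weak topology; $B(S)$ is the set of bounded measurable functions on $S$; $B_+(S)$ is the collection of positive Borel measurable functions on $S$ with strictly positive lower bound; $\langle\mu,g\rangle=\int g\,d\mu$; $\frac{\delta F(\mu)}{\delta\mu(s)}=\lim_{\epsilon\to0}\frac{F(\mu+\epsilon\delta_s)-F(\mu)}{\epsilon}$. The domain is $\mathcal{D}(\tilde{\mathcal{L}})=\{\phi(\langle\mu,f_1\rangle,\ldots,\langle\mu,f_n\rangle):\ \mu\in M(S),\ n\ge1,\ f_i\in B(S),\ \phi\in C^2(\mathbb{R}^n)\}$. $Z_t$ is the unique solution of the (well-posed) martingale problem associated with $\tilde{\mathcal{L}}$. Reversibility with respect to a probability $\Xi$ on $M(S)$ means that the generator $\tilde{\mathcal{L}}$ is reversible with respect to $\Xi$: $\int F\,\tilde{\mathcal{L}}G\,\Xi(d\mu)=\int G\,\tilde{\mathcal{L}}F\,\Xi(d\mu)$ for all $F,G\in\mathcal{D}(\tilde{\mathcal{L}})$. For $f\in B(S)$ and $\mu\in M(S)$: $S_f(\mu)(ds)=e^{f(s)}\mu(ds)$ and $\Lambda(\mu,f)=\langle\mu_0,f/a\rangle-\langle\mu,(e^f-1)b/a\rangle$. A probability $\Xi$ on $M(S)$ is $\Lambda$-quasi-invariant with respect to $\{S_f:f\in B(S)\}$ if, for every $f\in B(S)$, $\Xi$ and the image law $S_f(\Xi)$ of $\Xi$ under $S_f$ are mutually absolutely continuous with density $\frac{d\,S_f(\Xi)}{d\,\Xi}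(\mu)=e^{\Lambda(\mu,-f)}$.
   Formalization: Reversibility (symmetry of the generator) is asserted for those F, G in the domain for which F, G and their images under the generator are square integrable under Γ; for arbitrary C² functions φ without growth condition the identity can be undefined or false. *)

theory Defs
  imports "HOL-Probability.Probability"
begin

text \<open>
  The compact metric space S is a type \<open>'a::metric_space\<close> whose universe is compact (assumed in
  the theorem), with Borel sigma-algebra \<open>borel\<close>.
\<close>

definition finite_measures :: "'a::metric_space measure set" where
  "finite_measures = {\<mu>. sets \<mu> = sets borel \<and> finite_measure \<mu>}"

definition weak_topology :: "'a::metric_space measure topology" where
  "weak_topology = topology_generated_by
     {{\<mu> \<in> finite_measures. (\<integral>s. f s \<partial>\<mu>) \<in> U} | f U.
        continuous_on UNIV f \<and> bounded (range f) \<and> open (U :: real set)}"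

definition MS :: "'a::metric_space measure measure" where
  "MS = sigma finite_measures {W. openin weak_topology W}"

definition bounded_measurable :: "('a::metric_space \<Rightarrow> real) set" where
  "bounded_measurable = {f \<in> borel_measurable borel. bounded (range f)}"

definition positive_measurable :: "('a::metric_space \<Rightarrow> real) set" where
  "positive_measurable = {h \<in> borel_measurable borel. \<exists>c>0. \<forall>s. c \<le> h s}"

text \<open>Variational derivatives. Functionals live on nonnegative measures only, so the increment
  \<open>\<epsilon>\<close> tends to 0 from the right.\<close>

definition add_dirac :: "'a::metric_space measure \<Rightarrow> real \<Rightarrow> 'a \<Rightarrow> 'a measure" where
  "add_dirac \<mu> \<epsilon> s =
     measure_of UNIV (sets borel) (\<lambda>A. emeasure \<mu> A + ennreal \<epsilon> * indicator A s)"

definition vderiv :: "('a::metric_space measure \<Rightarrow> real) \<Rightarrow> 'a measure \<Rightarrow> 'a \<Rightarrow> real" where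
  "vderiv F \<mu> s = Lim (at_right 0) (\<lambda>\<epsilon>. (F (add_dirac \<mu> \<epsilon> s) - F \<mu>) / \<epsilon>)"

definition vderiv2 :: "('a::metric_space measure \<Rightarrow> real) \<Rightarrow> 'a measure \<Rightarrow> 'a \<Rightarrow> real" where
  "vderiv2 F \<mu> s = vderiv (\<lambda>\<nu>. vderiv F \<nu> s) \<mu> s"

definition generator ::
  "('a::metric_space \<Rightarrow> real) \<Rightarrow> ('a \<Rightarrow> real) \<Rightarrow> 'a measure \<Rightarrow>
   ('a measure \<Rightarrow> real) \<Rightarrow> 'a measure \<Rightarrow> real" where
  "generator a b \<mu>\<^sub>0 F \<mu> =
     (\<integral>s. a s * vderiv2 F \<mu> s \<partial>\<mu>) +
     ((\<integral>s. vderiv F \<mu> s \<partial>\<mu>\<^sub>0) - (\<integral>s. b s * vderiv F \<mu> s \<partial>\<mu>))"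

text \<open>The class \<open>C\<^sup>2\<close> on n-dimensional space: all partial derivatives up to order two exist and
  are continuous. Points of \<open>Euclidean_space n\<close> are sequences vanishing from index n on.\<close>

definition C2 :: "nat \<Rightarrow> ((nat \<Rightarrow> real) \<Rightarrow> real) \<Rightarrow> bool" where
  "C2 n \<phi> \<longleftrightarrow>
     continuous_map (Euclidean_space n) euclideanreal \<phi> \<and>
     (\<exists>D1 D2. \<forall>i<n.
        continuous_map (Euclidean_space n) euclideanreal (D1 i) \<and>
        (\<forall>x \<in> topspace (Euclidean_space n).
           ((\<lambda>t. \<phi> (x(i := t))) has_real_derivative D1 i x) (at (x i))) \<and>
        (\<forall>j<n.
           continuous_map (Euclidean_space n) euclideanreal (D2 i j) \<and>
           (\<forall>x \<in> topspace (Euclidean_space n).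
              ((\<lambda>t. D1 i (x(j := t))) has_real_derivative D2 i j x) (at (x j)))))"

definition gen_domain :: "('a::metric_space measure \<Rightarrow> real) set" where
  "gen_domain = {F. \<exists>n\<ge>1. \<exists>f \<phi>. (\<forall>i<n. f i \<in> bounded_measurable) \<and> C2 n \<phi> \<and>
     (\<forall>\<mu> \<in> finite_measures. F \<mu> = \<phi> (\<lambda>i. if i < n then (\<integral>s. f i s \<partial>\<mu>) else 0))}"

text \<open>Symmetry of the generator, as an operator in \<open>L\<^sup>2(\<Xi>)\<close>. Since \<open>\<phi>\<close> in the domain is an
  arbitrary \<open>C\<^sup>2\<close> function, without any growth condition, F and its image under the generator
  need not be integrable, so square integrability is required of both. Mere integrability
  of the two products would not do: if S is a point and \<open>\<Xi>\<close> is a Gamma law with density p on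
  \<open>(0, \<infinity>)\<close>, take F = 1 and G with \<open>G = 0\<close> near 0 and \<open>a x p(x) G'(x) = 1\<close> for large x; the
  integral of the image of G is then the boundary term 1 instead of 0.\<close>

definition square_integrable :: "'b measure \<Rightarrow> ('b \<Rightarrow> real) \<Rightarrow> bool" where
  "square_integrable M F \<longleftrightarrow> F \<in> borel_measurable M \<and> integrable M (\<lambda>x. (F x)\<^sup>2)"

definition reversible ::
  "('a::metric_space \<Rightarrow> real) \<Rightarrow> ('a \<Rightarrow> real) \<Rightarrow> 'a measure \<Rightarrow> 'a measure measure \<Rightarrow> bool" where
  "reversible a b \<mu>\<^sub>0 \<Xi> \<longleftrightarrow>
     (\<forall>F \<in> gen_domain. \<forall>G \<in> gen_domain.
        square_integrable \<Xi> F \<longrightarrow> square_integrable \<Xi> (generator a b \<mu>\<^sub>0 F) \<longrightarrow>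
        square_integrable \<Xi> G \<longrightarrow> square_integrable \<Xi> (generator a b \<mu>\<^sub>0 G) \<longrightarrow>
        (\<integral>\<mu>. F \<mu> * generator a b \<mu>\<^sub>0 G \<mu> \<partial>\<Xi>) = (\<integral>\<mu>. G \<mu> * generator a b \<mu>\<^sub>0 F \<mu> \<partial>\<Xi>))"

definition tilt :: "('a::metric_space \<Rightarrow> real) \<Rightarrow> 'a measure \<Rightarrow> 'a measure" where
  "tilt f \<mu> = density \<mu> (\<lambda>s. ennreal (exp (f s)))"

definition Lambda ::
  "('a::metric_space \<Rightarrow> real) \<Rightarrow> ('a \<Rightarrow> real) \<Rightarrow> 'a measure \<Rightarrow> 'a measure \<Rightarrow> ('a \<Rightarrow> real) \<Rightarrow> real" where
  "Lambda a b \<mu>\<^sub>0 \<mu> f = (\<integral>s. f s / a s \<partial>\<mu>\<^sub>0) - (\<integral>s. (exp (f s) - 1) * b s / a s \<partial>\<mu>)"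

definition Lambda_quasi_invariant ::
  "('a::metric_space \<Rightarrow> real) \<Rightarrow> ('a \<Rightarrow> real) \<Rightarrow> 'a measure \<Rightarrow> 'a measure measure \<Rightarrow> bool" where
  "Lambda_quasi_invariant a b \<mu>\<^sub>0 \<Xi> \<longleftrightarrow>
     (\<forall>f \<in> bounded_measurable.
        tilt f \<in> measurable \<Xi> MS \<and>
        absolutely_continuous \<Xi> (distr \<Xi> MS (tilt f)) \<and>
        absolutely_continuous (distr \<Xi> MS (tilt f)) \<Xi> \<and>
        (\<lambda>\<mu>. Lambda a b \<mu>\<^sub>0 \<mu> (\<lambda>s. - f s)) \<in> borel_measurable \<Xi> \<and>
        distr \<Xi> MS (tilt f) = density \<Xi> (\<lambda>\<mu>. ennreal (exp (Lambda a b \<mu>\<^sub>0 \<mu> (\<lambda>s. - f s)))))"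

text \<open>\<open>exp(-x)\<close> with \<open>exp(-\<infinity>) = 0\<close>: test functions h in the Laplace transform may be unbounded
  above, so both \<open>\<langle>\<mu>, h\<rangle>\<close> and the integral on the right-hand side may be infinite.\<close>

definition exp_neg :: "ennreal \<Rightarrow> real" where
  "exp_neg x = (if x = \<infinity> then 0 else exp (- enn2real x))"

definition is_Gamma_law ::
  "('a::metric_space \<Rightarrow> real) \<Rightarrow> ('a \<Rightarrow> real) \<Rightarrow> 'a measure \<Rightarrow> 'a measure measure \<Rightarrow> bool" where
  "is_Gamma_law a b \<mu>\<^sub>0 \<Gamma> \<longleftrightarrow>
     prob_space \<Gamma> \<and> sets \<Gamma> = sets MS \<and>
     (\<forall>h \<in> positive_measurable.
        (\<integral>\<mu>. exp_neg (\<integral>\<^sup>+ s. ennreal (h s) \<partial>\<mu>) \<partial>\<Gamma>) =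
        exp_neg (\<integral>\<^sup>+ s. ennreal (ln (1 + a s / b s * h s) / a s) \<partial>\<mu>\<^sub>0))"

end

theory Submission
  imports Defs
begin

text \<open>
  The Laplace functional gives quasi-invariance directly for \<open>f \<le> 0\<close>, because then every test function
  that occurs is positive and no exponential moments are needed; nonnegative f follow by inverting
  \<open>S\<^sub>f\<close>, and general f by the cocycle property of \<open>\<Lambda>\<close> applied to the positive and negative parts.
  Differentiating the quasi-invariance identity along \<open>t \<mapsto> t a g\<close> at \<open>t = 0\<close> is an integration by parts
  formula, which yields symmetry of the generator up to terms that involve a cutoff of the total
  mass. The squared gradient of the cutoff at scale R is of order \<open>1 / R\<close>, so these terms disappear
  as R tends to infinity, for all functions that are square integrable together with their images.
\<close>

section \<open>Evaluations and the Borel sets of the weak topology\<close>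

text \<open>The Gamma law is given only through Laplace transforms at test functions with a positive
  lower bound. To identify a law on M(S) from these, the Borel sets of the weak topology must be
  generated by evaluations, which rests on the separability of C(S) for compact S. The direction a g
  is forced by the weight 1 / a in \<open>Lambda\<close>: the exponent at - t a g has derivative
  \<open><mu, b g> - <mu_0, g>\<close> at t = 0, which is the drift of the generator with the sign
  reversed. This g is a fixed function, while the variational derivative of a cylinder function
  varies with the measure. Hence each f_j serves as a direction of its own, and its coefficient is
  moved into the functional that is differentiated; the derivative of the coefficient then yields
  the second order term of the generator. The quadratic form of the generator integrates a DF DG
  against the measure itself and so is linear in the mass: a cutoff with slope of order 1 / R,
  living on masses up to R, has squared gradient of order R / R^2. This decay replaces the growth
  conditions that the domain does not impose.\<close>

lemma finite_measuresD:
  assumes "\<mu> \<in> finite_measures"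
  shows "sets \<mu> = sets borel" "finite_measure \<mu>" "space \<mu> = UNIV"
  using assms sets_eq_imp_space_eq[of \<mu> borel] by (auto simp: finite_measures_def)

lemma measurable_finite_measures:
  "\<mu> \<in> finite_measures \<Longrightarrow> measurable \<mu> M = measurable borel M"
  by (rule measurable_cong_sets) (auto simp: finite_measuresD)

lemma bounded_measurableI:
  assumes "f \<in> borel_measurable borel" "\<And>s. \<bar>f s\<bar> \<le> B"
  shows "f \<in> bounded_measurable"
  using assms by (auto simp: bounded_measurable_def bounded_iff intro!: exI[of _ B])

lemma bounded_measurableD:
  assumes "f \<in> bounded_measurable"
  shows "f \<in> borel_measurable borel" "\<exists>B>0. \<forall>s. \<bar>f s\<bar> \<le> B"
proof -
  show "f \<in> borel_measurable borel"
    using assms by (simp add: bounded_measurable_def)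
  obtain B where B: "\<And>s. \<bar>f s\<bar> \<le> B"
    using assms by (auto simp: bounded_measurable_def bounded_iff)
  show "\<exists>B>0. \<forall>s. \<bar>f s\<bar> \<le> B"
    by (rule exI[of _ "\<bar>B\<bar> + 1"]) (use B in \<open>auto intro: order_trans[OF B]\<close>)
qed

lemma bounded_measurable_const [intro, simp]: "(\<lambda>s. c) \<in> bounded_measurable"
  by (rule bounded_measurableI[of _ "\<bar>c\<bar>"]) auto

lemma bounded_measurable_add [intro]:
  assumes "f \<in> bounded_measurable" "g \<in> bounded_measurable"
  shows "(\<lambda>s. f s + g s) \<in> bounded_measurable"
  using assms bounded_plus_comp[of f UNIV g]
  by (auto simp: bounded_measurable_def)

lemma bounded_measurable_minus [intro]:
  assumes "f \<in> bounded_measurable"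
  shows "(\<lambda>s. - f s) \<in> bounded_measurable"
  using assms bounded_uminus[of "range f"]
  by (auto simp: bounded_measurable_def image_image)

lemma bounded_measurable_mult [intro]:
  assumes "f \<in> bounded_measurable" "g \<in> bounded_measurable"
  shows "(\<lambda>s. f s * g s) \<in> bounded_measurable"
proof -
  obtain A where A: "A > 0" "\<And>s. \<bar>f s\<bar> \<le> A" using bounded_measurableD[OF assms(1)] by auto
  obtain B where B: "B > 0" "\<And>s. \<bar>g s\<bar> \<le> B" using bounded_measurableD[OF assms(2)] by auto
  show ?thesis
    by (rule bounded_measurableI[of _ "A * B"])
      (use bounded_measurableD(1)[OF assms(1)] bounded_measurableD(1)[OF assms(2)] A B
        in \<open>auto simp: abs_mult intro!: mult_mono\<close>)
qed

lemma bounded_measurable_diff [intro]: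
  assumes "f \<in> bounded_measurable" "g \<in> bounded_measurable"
  shows "(\<lambda>s. f s - g s) \<in> bounded_measurable"
  using bounded_measurable_add[OF assms(1) bounded_measurable_minus[OF assms(2)]] by simp

lemma bounded_measurable_exp [intro]:
  assumes "f \<in> bounded_measurable"
  shows "(\<lambda>s. exp (f s)) \<in> bounded_measurable"
proof -
  obtain A where A: "A > 0" "\<And>s. \<bar>f s\<bar> \<le> A" using bounded_measurableD[OF assms(1)] by auto
  show ?thesis
    by (rule bounded_measurableI[of _ "exp A"])
      (use assms A(2) in \<open>auto dest: bounded_measurableD(1) simp: abs_le_iff\<close>)
qed

lemma bounded_measurable_sum [intro]:
  assumes "\<And>i. i \<in> I \<Longrightarrow> f i \<in> bounded_measurable"
  shows "(\<lambda>s. \<Sum>i\<in>I. f i s) \<in> bounded_measurable"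
  using assms by (induction I rule: infinite_finite_induct) auto

lemma bounded_measurable_continuous:
  assumes "compact (UNIV :: 'a::metric_space set)" "continuous_on UNIV (f :: 'a \<Rightarrow> real)"
  shows "f \<in> bounded_measurable"
  using assms compact_continuous_image[OF assms(2,1)]
  by (auto simp: bounded_measurable_def compact_imp_bounded intro: borel_measurable_continuous_onI)

lemma integrable_bounded_measurable:
  assumes "f \<in> bounded_measurable" "\<mu> \<in> finite_measures"
  shows "integrable \<mu> f"
proof -
  interpret finite_measure \<mu> using assms finite_measuresD by auto
  obtain B where "\<And>s. \<bar>f s\<bar> \<le> B" using bounded_measurableD[OF assms(1)] by auto
  then show ?thesis
    using assms finite_measuresD[OF assms(2)] bounded_measurableD(1)[OF assms(1)]
    by (intro integrable_const_bound[of _ B]) (auto cong: measurable_cong_sets)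
qed

lemma integral_abs_le:
  assumes "f \<in> bounded_measurable" "\<mu> \<in> finite_measures" "\<And>s. \<bar>f s\<bar> \<le> B"
  shows "\<bar>\<integral>s. f s \<partial>\<mu>\<bar> \<le> B * measure \<mu> UNIV"
proof -
  interpret finite_measure \<mu> using assms finite_measuresD by auto
  have "\<bar>\<integral>s. f s \<partial>\<mu>\<bar> \<le> (\<integral>s. \<bar>f s\<bar> \<partial>\<mu>)"
    using integral_norm_bound[of \<mu> f] by simp
  also have "\<dots> \<le> (\<integral>s. B \<partial>\<mu>)"
    using assms by (intro integral_mono integrable_abs integrable_bounded_measurable) auto
  finally show ?thesis
    using finite_measuresD(3)[OF assms(2)] by (simp add: mult.commute)
qed

section \<open>Measurability of evaluations\<close>

lemma openin_weak_subset: "openin weak_topology W \<Longrightarrow> W \<subseteq> finite_measures"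
  using openin_subset[of weak_topology W]
  by (auto simp: weak_topology_def topology_generated_by_topspace)

lemma space_MS [simp]: "space MS = finite_measures"
  unfolding MS_def by (rule space_measure_of) (use openin_weak_subset in auto)

lemma sets_MS: "sets MS = sigma_sets finite_measures {W. openin weak_topology W}"
  unfolding MS_def by (rule sets_measure_of) (use openin_weak_subset in auto)

lemma measurable_integral_continuous:
  assumes "continuous_on UNIV (f :: 'a::metric_space \<Rightarrow> real)" "bounded (range f)"
  shows "(\<lambda>\<mu>. \<integral>s. f s \<partial>\<mu>) \<in> borel_measurable MS"
proof (rule borel_measurableI)
  fix U :: "real set" assume "open U"
  then have "openin weak_topology {\<mu> \<in> finite_measures. (\<integral>s. f s \<partial>\<mu>) \<in> U}"
    unfolding weak_topology_def using assms by (intro topology_generated_by_Basis) auto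
  then show "(\<lambda>\<mu>. \<integral>s. f s \<partial>\<mu>) -` U \<inter> space MS \<in> sets MS"
    by (auto simp: sets_MS vimage_def Int_def conj_commute intro!: sigma_sets.Basic)
qed

text \<open>The indicator of a closed set is the pointwise limit of bounded continuous functions of
  the distance to the set, so by dominated convergence the mass of the set is a limit of evaluations
  that are measurable by construction of the topology.\<close>

lemma measurable_emeasure_closed:
  assumes "closed (C :: 'a::metric_space set)"
  shows "(\<lambda>\<mu>. emeasure \<mu> C) \<in> borel_measurable MS"
\<comment> \<open>\<open>infdist x {}\<close> is 0 by convention, so for the empty set the
  approximating functions would be constantly 1.\<close>
proof (cases "C = {}")
  case False
  define f where "f n x = max 0 (1 - real n * infdist x C)" for n x
  have cont: "continuous_on UNIV (f n)" for n
    unfolding f_def by (intro continuous_intros)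
  have bnd: "\<bar>f n x\<bar> \<le> 1" for n x
    by (auto simp: f_def infdist_nonneg)
  have lim: "(\<lambda>n. f n x) \<longlonglongrightarrow> indicator C x" for x
  proof (cases "x \<in> C")
    case True
    then show ?thesis by (simp add: f_def)
  next
    case 2: False
    then have pos: "infdist x C > 0"
      using assms False infdist_pos_not_in_closed by blast
    obtain N where N: "1 < real N * infdist x C"
      using reals_Archimedean3[OF pos] by blast
    have "f n x = 0" if "n \<ge> N" for n
    proof -
      have "real N * infdist x C \<le> real n * infdist x C"
        using that pos by (intro mult_right_mono) auto
      then show ?thesis using N by (simp add: f_def)
    qed
    then show ?thesis
      using 2 by (auto intro!: tendsto_eventually eventually_sequentiallyI)
  qed
  have "(\<lambda>\<mu>. measure \<mu> C) \<in> borel_measurable MS"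
  proof (rule borel_measurable_LIMSEQ_real)
    show "(\<lambda>\<mu>. \<integral>s. f n s \<partial>\<mu>) \<in> borel_measurable MS" for n
      by (rule measurable_integral_continuous)
        (use cont bnd in \<open>auto simp: bounded_iff intro!: exI[of _ 1]\<close>)
    fix \<mu> :: "'a measure" assume "\<mu> \<in> space MS"
    then have \<mu>: "\<mu> \<in> finite_measures" by simp
    then interpret finite_measure \<mu> using finite_measuresD by auto
    have fm: "f n \<in> borel_measurable \<mu>" "indicat_real C \<in> borel_measurable \<mu>" for n
      using borel_measurable_continuous_onI[OF cont] assms finite_measuresD(1)[OF \<mu>]
      by (auto cong: measurable_cong_sets)
    have "(\<lambda>n. \<integral>s. f n s \<partial>\<mu>) \<longlonglongrightarrow> (\<integral>s. indicator C s \<partial>\<mu>)"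
      by (rule integral_dominated_convergence[where w = "\<lambda>_. 1"])
        (use lim bnd fm in auto)
    then show "(\<lambda>n. \<integral>s. f n s \<partial>\<mu>) \<longlonglongrightarrow> measure \<mu> C"
      using finite_measuresD[OF \<mu>] by simp
  qed
  then have "(\<lambda>\<mu>. ennreal (measure \<mu> C)) \<in> borel_measurable MS" by simp
  also have "?this \<longleftrightarrow> ?thesis"
    by (rule measurable_cong) (use finite_measuresD(2) finite_measure.emeasure_eq_measure in force)
  finally show ?thesis .
qed simp

text \<open>Closed sets form an intersection-stable generator, so Dynkin's argument applies. The
  complement step subtracts masses, which is legitimate because the measures are finite.\<close>

lemma measurable_emeasure_borel:
  assumes "A \<in> sets borel"
  shows "(\<lambda>\<mu>. emeasure \<mu> A) \<in> borel_measurable (MS :: 'a::metric_space measure measure)"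
proof -
  have "Int_stable (Collect closed :: 'a set set)" "(Collect closed :: 'a set set) \<subseteq> Pow UNIV"
    "A \<in> sigma_sets UNIV (Collect closed)"
    using assms by (auto simp: borel_eq_closed Int_stable_def)
  then show ?thesis
  proof (induction rule: sigma_sets_induct_disjoint)
    case (compl A)
    have A: "A \<in> sets borel" using compl by (simp add: borel_eq_closed)
    have "(\<lambda>\<mu>. emeasure \<mu> UNIV - emeasure \<mu> A) \<in> borel_measurable (MS :: 'a measure measure)"
      using compl(2) measurable_emeasure_closed[of "UNIV :: 'a set"] by measurable
    also have "?this \<longleftrightarrow> ?case"
    proof (rule measurable_cong)
      fix \<mu> :: "'a measure" assume "\<mu> \<in> space MS"
      then have \<mu>: "\<mu> \<in> finite_measures" by simp
      interpret finite_measure \<mu> using \<mu> finite_measuresD by auto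
      show "emeasure \<mu> UNIV - emeasure \<mu> A = emeasure \<mu> (UNIV - A)"
        using emeasure_compl[of A \<mu>] A finite_measuresD[OF \<mu>] by simp
    qed
    finally show ?case .
  next
    case (union A)
    have A: "range A \<subseteq> sets borel" using union by (auto simp: borel_eq_closed)
    have "(\<lambda>\<mu>. \<Sum>i. emeasure \<mu> (A i)) \<in> borel_measurable (MS :: 'a measure measure)"
      using union(3) by measurable
    also have "?this \<longleftrightarrow> ?case"
      by (rule measurable_cong)
        (use A union(1) finite_measuresD(1) in \<open>auto intro!: suminf_emeasure\<close>)
    finally show ?case .
  qed (auto intro: measurable_emeasure_closed)
qed

lemma measurable_nn_integral_MS:
  assumes "g \<in> borel_measurable borel"
  shows "(\<lambda>\<mu>. \<integral>\<^sup>+s. g s \<partial>\<mu>) \<in> borel_measurable (MS :: 'a::metric_space measure measure)"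
  using assms
proof (induction rule: borel_measurable_induct)
  case (cong f g)
  then have "f = g" by auto
  then show ?case using cong by simp
next
  case (set A)
  have "(\<lambda>\<mu>. emeasure \<mu> A) \<in> borel_measurable (MS :: 'a measure measure) \<longleftrightarrow> ?case"
    by (rule measurable_cong) (use set finite_measuresD(1) in \<open>auto intro!: nn_integral_indicator[symmetric]\<close>)
  then show ?case using measurable_emeasure_borel set by blast
next
  case (mult u c)
  have "(\<lambda>\<mu>. c * (\<integral>\<^sup>+s. u s \<partial>\<mu>)) \<in> borel_measurable (MS :: 'a measure measure) \<longleftrightarrow> ?case"
    by (rule measurable_cong)
      (use mult in \<open>auto intro!: nn_integral_cmult[symmetric] simp: measurable_finite_measures\<close>)
  then show ?case using mult by (auto intro: borel_measurable_times)
next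
  case (add u v)
  have "(\<lambda>\<mu>. (\<integral>\<^sup>+s. v s \<partial>\<mu>) + (\<integral>\<^sup>+s. u s \<partial>\<mu>)) \<in> borel_measurable (MS :: 'a measure measure) \<longleftrightarrow> ?case"
    by (rule measurable_cong)
      (use add in \<open>auto intro!: nn_integral_add[symmetric] simp: measurable_finite_measures\<close>)
  then show ?case using add by (auto intro: borel_measurable_add)
next
  case (seq U)
  have "(\<lambda>\<mu>. SUP i. (\<integral>\<^sup>+s. U i s \<partial>\<mu>)) \<in> borel_measurable (MS :: 'a measure measure) \<longleftrightarrow> ?case"
  proof (rule measurable_cong)
    fix \<mu> :: "'a measure" assume "\<mu> \<in> space MS"
    then have [measurable_cong]: "sets \<mu> = sets borel" by (simp add: finite_measuresD)
    show "(SUP i. (\<integral>\<^sup>+s. U i s \<partial>\<mu>)) = (\<integral>\<^sup>+s. (SUP i. U i) s \<partial>\<mu>)"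
      using seq by (subst nn_integral_monotone_convergence_SUP[symmetric]) (auto simp: image_comp intro!: nn_integral_cong)
  qed
  then show ?case using seq by (auto intro: borel_measurable_SUP)
qed

lemma measurable_integral_MS:
  assumes "g \<in> bounded_measurable"
  shows "(\<lambda>\<mu>. \<integral>s. g s \<partial>\<mu>) \<in> borel_measurable (MS :: 'a::metric_space measure measure)"
proof -
  have [measurable]: "g \<in> borel_measurable borel" using bounded_measurableD assms by blast
  have "(\<lambda>\<mu>. enn2real (\<integral>\<^sup>+s. ennreal (g s) \<partial>\<mu>) - enn2real (\<integral>\<^sup>+s. ennreal (- g s) \<partial>\<mu>))
      \<in> borel_measurable (MS :: 'a measure measure)"
    by (intro borel_measurable_diff borel_measurable_enn2real measurable_nn_integral_MS) auto
  also have "?this \<longleftrightarrow> ?thesis"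
    by (rule measurable_cong)
      (use assms in \<open>auto intro!: real_lebesgue_integral_def[symmetric] integrable_bounded_measurable\<close>)
  finally show ?thesis .
qed

section \<open>Second countability of the weak topology and generators of its Borel sets\<close>

lemma countable_dense_continuous_functions:
  assumes "compact (UNIV :: 'a::metric_space set)"
  obtains \<F> :: "('a::metric_space \<Rightarrow> real) set" where "countable \<F>" "\<And>g. g \<in> \<F> \<Longrightarrow> continuous_on UNIV g"
    "\<And>f e. continuous_on UNIV f \<Longrightarrow> 0 < e \<Longrightarrow> \<exists>g\<in>\<F>. \<forall>x. \<bar>f x - g x\<bar> \<le> e"
proof -
  define r where "r n = 1 / (real n + 1)" for n
  have r: "r n > 0" for n by (simp add: r_def)
  have "\<exists>D. finite D \<and> (UNIV :: 'a set) \<subseteq> (\<Union>x\<in>D. ball x (r n))" for n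
  proof -
    have cov: "UNIV \<subseteq> (\<Union>x\<in>UNIV. ball x (r n))" using r[of n] by (auto intro: centre_in_ball[THEN iffD2])
    obtain D :: "'a set" where "finite D" "UNIV \<subseteq> (\<Union>x\<in>D. ball x (r n))"
      by (rule compactE_image[OF assms open_ball cov])
    then show ?thesis by (intro exI[of _ D] conjI)
  qed
  then have "\<exists>D. \<forall>n. finite (D n) \<and> (UNIV :: 'a set) \<subseteq> (\<Union>x\<in>D n. ball x (r n))" by (intro choice allI)
  then obtain D :: "nat \<Rightarrow> 'a set" where D: "\<And>n. finite (D n)" "\<And>n. UNIV \<subseteq> (\<Union>x\<in>D n. ball x (r n))" by blast
  \<comment> \<open>Tent functions around the points of a finite \<open>r n\<close>-net. Divided by
    their sum \<open>T n\<close> they form a partition of unity, and \<open>P n q\<close> averages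
    the values \<open>q\<close> at the net points with these weights.\<close>
  define W where "W n x y = max 0 (r n - dist x y)" for n and x y :: 'a
  define T where "T n y = (\<Sum>x\<in>D n. W n x y)" for n y
  define P where "P n q y = (\<Sum>x\<in>D n. q x * W n x y) / T n y" for n q y
  \<comment> \<open>\<open>PiE\<close> fixes the coefficient functions to be
    \<open>undefined\<close> off the finite set \<open>D n\<close>, which leaves only countably many
    of them.\<close>
  define \<F> where "\<F> = (\<Union>n. P n ` (PiE (D n) (\<lambda>_. \<rat>)))"
  have W0: "W n x y \<ge> 0" for n x y by (simp add: W_def)
  have T0: "T n y > 0" for n y
  proof -
    have "y \<in> (\<Union>x\<in>D n. ball x (r n))" using D(2)[of n] by blast
    then obtain x where "x \<in> D n" "dist x y < r n" by auto
    then show ?thesis unfolding T_def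
      using D(1) by (intro sum_pos2[of _ x]) (auto simp: W_def)
  qed
  show thesis
  proof
    show "countable \<F>"
      unfolding \<F>_def using D(1) countable_rat by (auto intro!: countable_PiE)
    show "continuous_on UNIV g" if "g \<in> \<F>" for g
    proof -
      from that obtain n q where "g = P n q" by (auto simp: \<F>_def)
      moreover have "continuous_on UNIV (\<lambda>y. W n x y)" for x
        unfolding W_def by (intro continuous_intros)
      ultimately show ?thesis
        unfolding P_def using T0[of n] unfolding T_def
        by (auto intro!: continuous_intros simp: less_imp_neq[symmetric] dest: less_imp_neq)
    qed
    fix f :: "'a \<Rightarrow> real" and e :: real assume f: "continuous_on UNIV f" and e: "0 < e"
    have "uniformly_continuous_on UNIV f"
      using compact_uniformly_continuous[OF f assms] .
    then obtain d where d: "d > 0" "\<And>x y. dist x y < d \<Longrightarrow> dist (f x) (f y) < e / 2"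
      using e unfolding uniformly_continuous_on_def by (auto dest!: spec[of _ "e / 2"])
    obtain n where n: "r n < d" using d(1) nat_approx_posE[OF d(1)] by (auto simp: r_def add.commute)
    have "\<exists>q\<in>\<rat>. \<bar>f x - q\<bar> < e / 2" for x
    proof -
      obtain q where "q \<in> \<rat>" "f x < q" "q < f x + e / 2"
        using Rats_dense_in_real[of "f x" "f x + e / 2"] e by auto
      then show ?thesis by (intro bexI[of _ q]) auto
    qed
    then obtain q where q: "\<And>x. q x \<in> \<rat>" "\<And>x. \<bar>f x - q x\<bar> < e / 2" by metis
    have "\<bar>f y - P n (restrict q (D n)) y\<bar> \<le> e" for y
    proof -
      \<comment> \<open>The weights sum to one, so the error is a weighted average of the
        differences \<open>f y - q x\<close>. Only net points within \<open>r n < d\<close> of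
        \<open>y\<close> carry weight; uniform continuity and the rounding to rationals contribute
        \<open>e / 2\<close> each.\<close>
      have eq: "f y - P n (restrict q (D n)) y = (\<Sum>x\<in>D n. (f y - q x) * W n x y) / T n y"
        using T0[of n y]
        by (simp add: P_def T_def field_simps sum_subtractf sum_distrib_left)
      have "\<bar>\<Sum>x\<in>D n. (f y - q x) * W n x y\<bar> \<le> (\<Sum>x\<in>D n. \<bar>(f y - q x) * W n x y\<bar>)"
        by (rule sum_abs)
      also have "\<dots> \<le> (\<Sum>x\<in>D n. e * W n x y)"
      proof (rule sum_mono)
        fix x
        show "\<bar>(f y - q x) * W n x y\<bar> \<le> e * W n x y"
        proof (cases "dist x y < r n")
          case True
          then have "dist (f x) (f y) < e / 2" using d n by force
          then have "\<bar>f y - q x\<bar> \<le> e" using q(2)[of x] unfolding dist_real_def by linarith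
          then show ?thesis using W0[of n x y] by (simp add: abs_mult mult_right_mono)
        next
          case False
          then show ?thesis by (simp add: W_def)
        qed
      qed
      also have "\<dots> = e * T n y" by (simp add: T_def sum_distrib_left)
      finally show ?thesis
        using T0[of n y] unfolding eq by (simp add: abs_divide divide_le_eq)
    qed
    moreover have "P n (restrict q (D n)) \<in> \<F>" using q(1) unfolding \<F>_def by (intro UN_I[of n] imageI) auto
    ultimately show "\<exists>g\<in>\<F>. \<forall>x. \<bar>f x - g x\<bar> \<le> e" by blast
  qed
qed

lemma integral_diff_le:
  assumes "f \<in> bounded_measurable" "g \<in> bounded_measurable" "\<mu> \<in> finite_measures"
    and "\<And>s. \<bar>f s - g s\<bar> \<le> e"
  shows "\<bar>(\<integral>s. f s \<partial>\<mu>) - (\<integral>s. g s \<partial>\<mu>)\<bar> \<le> e * measure \<mu> UNIV"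
  using integral_abs_le[of "\<lambda>s. f s - g s" \<mu> e] assms
  by (subst Bochner_Integration.integral_diff[symmetric]) (auto intro: integrable_bounded_measurable)

text \<open>The weak topology is second countable, so its Borel sets are determined by evaluations.\<close>

lemma sets_weak_open:
  fixes N :: "'a::metric_space measure measure"
  assumes "compact (UNIV :: 'a set)" "space N = finite_measures"
    and meas: "\<And>g. g \<in> bounded_measurable \<Longrightarrow> (\<lambda>\<mu>. \<integral>s. g s \<partial>\<mu>) \<in> borel_measurable N"
    and W: "openin weak_topology W"
  shows "W \<in> sets N"
proof -
  obtain \<F> :: "('a \<Rightarrow> real) set" where \<F>: "countable \<F>" "\<And>g. g \<in> \<F> \<Longrightarrow> continuous_on UNIV g"
    "\<And>f e. continuous_on UNIV f \<Longrightarrow> 0 < e \<Longrightarrow> \<exists>g\<in>\<F>. \<forall>x. \<bar>f x - g x\<bar> \<le> e"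
    using countable_dense_continuous_functions[OF assms(1)] by blast
  define B where "B L = {\<mu> \<in> finite_measures. \<forall>x \<in> set L. fst (snd x) < (\<integral>s. fst x s \<partial>\<mu>) \<and> (\<integral>s. fst x s \<partial>\<mu>) < snd (snd x)}"
    for L :: "(('a \<Rightarrow> real) \<times> real \<times> real) list"
  \<comment> \<open>Rational boxes in finitely many evaluations. The constant function 1 joins the
    dense family because uniform closeness of two functions controls the difference of their
    integrals only where the total mass is bounded.\<close>
  define \<L> where "\<L> = lists (insert (\<lambda>_. 1) \<F> \<times> (\<rat> :: real set) \<times> (\<rat> :: real set))"
  have \<L>: "countable \<L>"
    unfolding \<L>_def using \<F>(1) countable_rat by (intro countable_lists countable_SIGMA) auto
  have BM: "f \<in> bounded_measurable" if "f \<in> insert (\<lambda>_. 1) \<F>" for f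
    using that \<F>(2) bounded_measurable_continuous[OF assms(1)] by auto
  have Bsets: "B L \<in> sets N" if "L \<in> \<L>" for L
  proof -
    have "B L = space N \<inter> (\<Inter>x\<in>set L. {\<mu> \<in> space N. fst (snd x) < (\<integral>s. (fst x) s \<partial>\<mu>) \<and> (\<integral>s. (fst x) s \<partial>\<mu>) < snd (snd x)})"
      by (auto simp: B_def assms(2))
    also have "\<dots> \<in> sets N"
    proof (cases "set L = {}")
      case False
      have "{\<mu> \<in> space N. fst (snd x) < (\<integral>s. (fst x) s \<partial>\<mu>) \<and> (\<integral>s. (fst x) s \<partial>\<mu>) < snd (snd x)} \<in> sets N"
        if "x \<in> set L" for x
      proof -
        have [measurable]: "(\<lambda>\<mu>. \<integral>s. (fst x) s \<partial>\<mu>) \<in> borel_measurable N"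
          using that \<open>L \<in> \<L>\<close> by (intro meas BM) (auto simp: \<L>_def)
        show ?thesis by measurable
      qed
      then show ?thesis using False by (intro sets.Int sets.finite_INT) auto
    qed simp
    finally show ?thesis .
  qed
  have base: "\<exists>L\<in>\<L>. \<mu> \<in> B L \<and> B L \<subseteq> W" if "\<mu> \<in> W" for \<mu>
  proof -
    have "generate_topology_on {{\<mu> \<in> finite_measures. (\<integral>s. f s \<partial>\<mu>) \<in> U} | f U.
        continuous_on UNIV f \<and> bounded (range f) \<and> open (U :: real set)} W"
      using W by (simp add: weak_topology_def openin_topology_generated_by_iff)
    then show ?thesis using that
    proof (induction arbitrary: \<mu> rule: generate_topology_on.induct)
      case Empty then show ?case by simp
    next
      case (Int U V)
      then obtain L L' where "L \<in> \<L>" "\<mu> \<in> B L" "B L \<subseteq> U" "L' \<in> \<L>" "\<mu> \<in> B L'" "B L' \<subseteq> V"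
        by (meson IntD1 IntD2)
      moreover have "B (L @ L') = B L \<inter> B L'" by (auto simp: B_def)
      moreover have "L @ L' \<in> \<L>" using \<open>L \<in> \<L>\<close> \<open>L' \<in> \<L>\<close> by (simp add: \<L>_def)
      ultimately show ?case by (intro bexI[of _ "L @ L'"]) auto
    next
      case (UN K)
      then show ?case by (meson UnionE Union_upper order_trans)
    next
      case (Basis A)
      then obtain f :: "'a \<Rightarrow> real" and U :: "real set" where f: "continuous_on UNIV f" "open U" "A = {\<mu> \<in> finite_measures. (\<integral>s. f s \<partial>\<mu>) \<in> U}"
        using Basis.hyps by blast
      with Basis have \<mu>: "\<mu> \<in> finite_measures" "(\<integral>s. f s \<partial>\<mu>) \<in> U" by auto
      obtain e where e: "e > 0" "\<And>x. \<bar>x - (\<integral>s. f s \<partial>\<mu>)\<bar> < e \<Longrightarrow> x \<in> U"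
        using \<mu>(2) f(2) by (auto simp: open_dist dist_real_def)
      obtain M where M: "M \<in> \<rat>" "measure \<mu> UNIV < M"
        using Rats_dense_in_real[of "measure \<mu> UNIV" "measure \<mu> UNIV + 1"] by auto
      have M0: "M > 0" using M(2) measure_nonneg[of \<mu> UNIV] by linarith
      obtain g where g: "g \<in> \<F>" "\<And>x. \<bar>f x - g x\<bar> \<le> e / (3 * M)"
        using \<F>(3)[OF f(1), of "e / (3 * M)"] e(1) M0 by auto
      have fBM: "f \<in> bounded_measurable" using f(1) bounded_measurable_continuous[OF assms(1)] by auto
      have close: "\<bar>(\<integral>s. f s \<partial>\<nu>) - (\<integral>s. g s \<partial>\<nu>)\<bar> \<le> e / 3" if "\<nu> \<in> finite_measures" "measure \<nu> UNIV < M" for \<nu>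
      proof -
        have "\<bar>(\<integral>s. f s \<partial>\<nu>) - (\<integral>s. g s \<partial>\<nu>)\<bar> \<le> e / (3 * M) * measure \<nu> UNIV"
          using g that(1) BM[of g] fBM by (intro integral_diff_le) auto
        also have "\<dots> \<le> e / (3 * M) * M" using that(2) e(1) M0 by (intro mult_left_mono) auto
        finally show ?thesis using M0 by simp
      qed
      define m where "m = (\<integral>s. g s \<partial>\<mu>)"
      \<comment> \<open>Error budget: \<open>e / 3\<close> for replacing \<open>f\<close> by
        \<open>g\<close> at \<open>\<nu>\<close>, the same at \<open>\<mu>\<close>, and less than
        \<open>e / 6\<close> between the two integrals of \<open>g\<close>.\<close>
      obtain p q where pq: "p \<in> \<rat>" "q \<in> \<rat>" "m - e/6 < p" "p < m" "m < q" "q < m + e/6"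
        using Rats_dense_in_real[of "m - e/6" m] Rats_dense_in_real[of m "m + e/6"] e(1) by auto
      \<comment> \<open>The lower bound -1 on the mass is vacuous since masses are nonnegative; the
        entry serves to impose the upper bound \<open>M\<close>.\<close>
      define L where "L = [((\<lambda>_. 1), -1, M), (g, p, q)]"
      have BL: "\<nu> \<in> B L \<longleftrightarrow> \<nu> \<in> finite_measures \<and> measure \<nu> UNIV < M \<and> p < (\<integral>s. g s \<partial>\<nu>) \<and> (\<integral>s. g s \<partial>\<nu>) < q" for \<nu>
        using finite_measuresD(3)[of \<nu>] measure_nonneg[of \<nu> UNIV] 
        by (auto simp: B_def L_def intro: less_le_trans[of _ 0])
      have "\<nu> \<in> A" if "\<nu> \<in> B L" for \<nu>
      proof -
        have "\<bar>(\<integral>s. f s \<partial>\<nu>) - (\<integral>s. f s \<partial>\<mu>)\<bar> < e"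
          using close[of \<nu>] close[OF \<mu>(1) M(2)] that pq e(1) unfolding BL m_def by linarith
        then show ?thesis using that e(2) unfolding BL f(3) by auto
      qed
      moreover have "\<mu> \<in> B L" using \<mu>(1) M(2) pq by (simp add: BL m_def)
      moreover have "L \<in> \<L>" using g(1) M(1) pq by (simp add: \<L>_def L_def)
      ultimately show ?case by blast
    qed
  qed
  have "W = (\<Union>L\<in>{L\<in>\<L>. B L \<subseteq> W}. B L)" using base by blast
  also have "\<dots> \<in> sets N"
    using \<L> Bsets by (intro sets.countable_UN'') auto
  finally show ?thesis .
qed

text \<open>The largest sigma-algebra on \<open>finite_measures\<close> that makes \<open>T\<close>
  measurable contains every weakly open set as soon as the evaluations are measurable for it.
  Measurability into \<open>MS\<close> is thereby reduced to real-valued maps.\<close>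

lemma measurable_into_MS:
  assumes "compact (UNIV :: 'a::metric_space set)"
    and "\<And>x. x \<in> space M \<Longrightarrow> T x \<in> finite_measures"
    and "\<And>g. g \<in> bounded_measurable \<Longrightarrow> (\<lambda>x. \<integral>s. g s \<partial>(T x :: 'a measure)) \<in> borel_measurable M"
  shows "T \<in> measurable M MS"
proof -
  define N where "N = sigma finite_measures {A. A \<subseteq> finite_measures \<and> T -` A \<inter> space M \<in> sets M}"
  have sp: "space N = (finite_measures :: 'a measure set)"
    unfolding N_def by (rule space_measure_of) auto
  have T: "T \<in> measurable M N"
    unfolding N_def by (rule measurable_sigma_sets[of _ "finite_measures" "{A. A \<subseteq> finite_measures \<and> T -` A \<inter> space M \<in> sets M}"])
      (use assms(2) in \<open>auto intro!: sets_measure_of\<close>)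
  have "W \<in> sets N" if "openin weak_topology W" for W
  proof (rule sets_weak_open[OF assms(1) sp _ that])
    fix g :: "'a \<Rightarrow> real" assume g: "g \<in> bounded_measurable"
    show "(\<lambda>\<mu>. \<integral>s. g s \<partial>\<mu>) \<in> borel_measurable N"
    proof (rule borel_measurableI)
      fix U :: "real set" assume "open U"
      then have "(\<lambda>x. \<integral>s. g s \<partial>(T x)) -` U \<inter> space M \<in> sets M"
        using assms(3)[OF g] by (auto intro: measurable_sets)
      moreover have "T -` {\<mu> \<in> finite_measures. (\<integral>s. g s \<partial>\<mu>) \<in> U} \<inter> space M = (\<lambda>x. \<integral>s. g s \<partial>(T x)) -` U \<inter> space M"
        using assms(2) by auto
      ultimately have "{\<mu> \<in> finite_measures. (\<integral>s. g s \<partial>\<mu>) \<in> U} \<in> sets N"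
        unfolding N_def by (subst sets_measure_of) (auto intro!: sigma_sets.Basic)
      then show "(\<lambda>\<mu>. \<integral>s. g s \<partial>\<mu>) -` U \<inter> space N \<in> sets N"
        by (simp add: sp vimage_def Int_def conj_commute)
    qed
  qed
  then show ?thesis
    unfolding MS_def
    by (intro measurable_measure_of) (use assms(2) openin_weak_subset T in \<open>auto intro: measurable_sets\<close>)
qed

text \<open>A generator tailored to Laplace transforms: for nonnegative \<open>g\<close> the
  variable \<open>exp (- <mu, g>)\<close> lies in [0, 1], where moments determine a law, and lists
  of constraints make the family closed under intersection by concatenation.\<close>

definition below_sets :: "('a::metric_space measure) set set" where
  "below_sets = {{\<mu> \<in> finite_measures. \<forall>x \<in> set L. (\<integral>s. fst x s \<partial>\<mu>) \<le> snd x} | L.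
     \<forall>x \<in> set L. fst x \<in> bounded_measurable \<and> (\<forall>s. 0 \<le> fst x s)}"

lemma sets_MS_below:
  assumes "compact (UNIV :: 'a::metric_space set)"
  shows "sets (MS :: 'a measure measure) = sigma_sets finite_measures below_sets"
proof -
  define N where "N = sigma finite_measures (below_sets :: 'a measure set set)"
  have sub: "below_sets \<subseteq> Pow finite_measures" by (auto simp: below_sets_def)
  have sp: "space N = finite_measures" and st: "sets N = sigma_sets finite_measures below_sets"
    unfolding N_def by (rule space_measure_of[OF sub], rule sets_measure_of[OF sub])
  have pos: "(\<lambda>\<mu>. \<integral>s. g s \<partial>\<mu>) \<in> borel_measurable N" if "g \<in> bounded_measurable" "\<And>s. 0 \<le> g s" for g
  proof (rule borel_measurable_iff_le[THEN iffD2], intro allI)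
    fix c
    have "{\<mu> \<in> finite_measures. (\<integral>s. g s \<partial>\<mu>) \<le> c} \<in> below_sets"
      unfolding below_sets_def using that by (intro CollectI exI[of _ "[(g, c)]"]) auto
    then show "{\<mu> \<in> space N. (\<integral>s. g s \<partial>\<mu>) \<le> c} \<in> sets N" by (simp add: sp st)
  qed
  have "W \<in> sets N" if "openin weak_topology W" for W
  proof (rule sets_weak_open[OF assms(1) sp _ that])
    fix g :: "'a \<Rightarrow> real" assume g: "g \<in> bounded_measurable"
    obtain B where B: "B > 0" "\<And>s. \<bar>g s\<bar> \<le> B" using bounded_measurableD[OF g] by auto
    have "0 \<le> g s + B" for s using B(2)[of s] by linarith
    \<comment> \<open>Adding its bound makes a test function nonnegative; the added constant is
      integrated and subtracted again.\<close>
    then have "(\<lambda>\<mu>. (\<integral>s. g s + B \<partial>\<mu>) - (\<integral>s. B \<partial>\<mu>)) \<in> borel_measurable N"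
      using g B by (intro borel_measurable_diff pos) auto
    also have "?this \<longleftrightarrow> (\<lambda>\<mu>. \<integral>s. g s \<partial>\<mu>) \<in> borel_measurable N"
      by (rule measurable_cong)
        (use g in \<open>auto simp: sp Bochner_Integration.integral_add integrable_bounded_measurable\<close>)
    finally show "(\<lambda>\<mu>. \<integral>s. g s \<partial>\<mu>) \<in> borel_measurable N" .
  qed
  then have "sets MS \<subseteq> sets N"
    unfolding sets_MS using sets.sigma_sets_subset[of "{W. openin weak_topology W}" N] sp by auto
  moreover have "A \<in> sets MS" if A: "A \<in> below_sets" for A :: "'a measure set"
  proof -
    obtain L where L: "A = {\<mu> \<in> finite_measures. \<forall>x \<in> set L. (\<integral>s. fst x s \<partial>\<mu>) \<le> snd x}"
      "\<forall>x \<in> set L. fst x \<in> bounded_measurable \<and> (\<forall>s. 0 \<le> fst x s)"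
      using A by (auto simp: below_sets_def)
    have "{\<mu> \<in> space MS. \<forall>x \<in> set L. (\<integral>s. (fst x) s \<partial>\<mu>) \<le> snd x} \<in> sets MS"
    proof (rule sets.sets_Collect_finite_All)
      fix x assume "x \<in> set L"
      then have [measurable]: "(\<lambda>\<mu>. \<integral>s. (fst x) s \<partial>\<mu>) \<in> borel_measurable MS"
        using L(2) by (intro measurable_integral_MS) auto
      show "{\<mu> \<in> space MS. (\<integral>s. (fst x) s \<partial>\<mu>) \<le> snd x} \<in> sets MS" by measurable
    qed simp
    then show ?thesis by (simp add: L(1))
  qed
  then have "sets N \<subseteq> sets MS"
    unfolding st using sets.sigma_sets_subset[of "below_sets" MS] by auto
  ultimately show ?thesis using st by auto
qed

section \<open>Uniqueness of Laplace functionals\<close>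

lemma (in finite_measure) integrable_mult_bounded:
  assumes [measurable]: "f \<in> borel_measurable M" "g \<in> borel_measurable M"
    and "\<And>x. x \<in> space M \<Longrightarrow> \<bar>f x\<bar> \<le> A" "\<And>x. x \<in> space M \<Longrightarrow> \<bar>g x\<bar> \<le> B"
  shows "integrable M (\<lambda>x. f x * g x :: real)"
proof (rule integrable_const_bound[of _ "A * B"])
  show "AE x in M. norm (f x * g x) \<le> A * B"
  proof (rule AE_I2)
    fix x assume "x \<in> space M"
    then have "\<bar>f x\<bar> \<le> A" "\<bar>g x\<bar> \<le> B" using assms by auto
    moreover from this have "0 \<le> A" by linarith
    ultimately show "norm (f x * g x) \<le> A * B"
      by (auto simp: abs_mult intro!: mult_mono)
  qed
qed simp

text \<open>Polynomials are uniformly dense among the continuous functions on [0, 1], and the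
  indicator of a half-line is a limit of continuous functions. The bounded weight \<open>w\<close>
  carries along events that have already been treated, so that joint laws can be reached one
  coordinate at a time.\<close>

lemma moments_determine_tail:
  assumes M: "finite_measure M" and N: "finite_measure N" and MN: "sets M = sets N"
    and u: "u \<in> borel_measurable M" "\<And>x. 0 \<le> u x" "\<And>x. u x \<le> 1"
    and w: "w \<in> borel_measurable M" "\<And>x. \<bar>w x\<bar> \<le> C"
    and mom: "\<And>k. (\<integral>x. w x * u x ^ k \<partial>M) = (\<integral>x. w x * u x ^ k \<partial>N)"
  shows "(\<integral>x. w x * indicator {c..} (u x) \<partial>M) = (\<integral>x. w x * indicator {c..} (u x) \<partial>N :: real)"
proof -
  interpret M: finite_measure M by fact
  interpret N: finite_measure N by fact
  note [measurable] = u(1) w(1)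
  have [measurable]: "u \<in> borel_measurable N" "w \<in> borel_measurable N"
    using u(1) w(1) MN by (auto cong: measurable_cong_sets)
  have C0: "C \<ge> 0" using w(2)[of undefined] by linarith
  have pw: "\<bar>u x ^ k\<bar> \<le> 1" for x k using u power_le_one[of "u x" k] by simp
  have cont: "(\<integral>x. w x * \<phi> (u x) \<partial>M) = (\<integral>x. w x * \<phi> (u x) \<partial>N)" if \<phi>: "continuous_on UNIV \<phi>" for \<phi> :: "real \<Rightarrow> real"
  proof -
    have [measurable]: "\<phi> \<in> borel_measurable borel" using \<phi> by (rule borel_measurable_continuous_onI)
    have "bounded (\<phi> ` {0..1})"
      by (intro compact_imp_bounded compact_continuous_image continuous_on_subset[OF \<phi>]) auto
    then obtain B where B: "\<And>t. t \<in> {0..1} \<Longrightarrow> \<bar>\<phi> t\<bar> \<le> B"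
      by (metis bounded_iff image_eqI real_norm_def)
    define K where "K = C * (measure M (space M) + measure N (space N))"
    have K0: "K \<ge> 0" using C0 by (simp add: K_def)
    have "\<bar>(\<integral>x. w x * \<phi> (u x) \<partial>M) - (\<integral>x. w x * \<phi> (u x) \<partial>N)\<bar> \<le> e * K" if e: "e > 0" for e
    proof -
      obtain p where p: "real_polynomial_function p" "\<And>t. t \<in> {0..1} \<Longrightarrow> \<bar>\<phi> t - p t\<bar> < e"
        using Stone_Weierstrass_real_polynomial_function[of "{0..1::real}" \<phi> e] \<phi> e
        by (auto intro: continuous_on_subset)
      obtain a n where pa: "p = (\<lambda>t. \<Sum>i\<le>n. a i * t ^ i)"
        using p(1) real_polynomial_function_iff_sum by auto
      have [measurable]: "p \<in> borel_measurable borel" unfolding pa by measurable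
      have pB: "\<bar>p (u x)\<bar> \<le> B + e" for x using p(2)[of "u x"] B[of "u x"] u by force
      have close: "\<bar>(\<integral>x. w x * \<phi> (u x) \<partial>L) - (\<integral>x. w x * p (u x) \<partial>L)\<bar> \<le> e * C * measure L (space L)"
        if L: "finite_measure L" "sets L = sets M" for L
      proof -
        interpret L: finite_measure L by fact
        have [measurable]: "u \<in> borel_measurable L" "w \<in> borel_measurable L"
          using u(1) w(1) L by (auto cong: measurable_cong_sets)
        have int: "integrable L (\<lambda>x. w x * \<phi> (u x))" "integrable L (\<lambda>x. w x * p (u x))"
          using w u B pB by (auto intro!: L.integrable_mult_bounded[where A = C])
        have "\<bar>(\<integral>x. w x * \<phi> (u x) \<partial>L) - (\<integral>x. w x * p (u x) \<partial>L)\<bar> \<le> (\<integral>x. \<bar>w x * \<phi> (u x) - w x * p (u x)\<bar> \<partial>L)"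
          using int integral_norm_bound[of L "\<lambda>x. w x * \<phi> (u x) - w x * p (u x)"] by simp
        also have "\<dots> \<le> (\<integral>x. e * C \<partial>L)"
        proof (rule integral_mono)
          fix x
          have "\<bar>w x * \<phi> (u x) - w x * p (u x)\<bar> = \<bar>\<phi> (u x) - p (u x)\<bar> * \<bar>w x\<bar>"
            by (simp add: abs_mult[symmetric] algebra_simps)
          also have "\<dots> \<le> e * C" using p(2)[of "u x"] u w(2)[of x] e by (intro mult_mono) auto
          finally show "\<bar>w x * \<phi> (u x) - w x * p (u x)\<bar> \<le> e * C" .
        qed (use int in auto)
        finally show ?thesis by (simp add: mult_ac)
      qed
      have poly: "(\<integral>x. w x * p (u x) \<partial>L) = (\<Sum>i\<le>n. a i * (\<integral>x. w x * u x ^ i \<partial>L))"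
        if L: "finite_measure L" "sets L = sets M" for L
      proof -
        interpret L: finite_measure L by fact
        have [measurable]: "u \<in> borel_measurable L" "w \<in> borel_measurable L"
          using u(1) w(1) L by (auto cong: measurable_cong_sets)
        have int: "integrable L (\<lambda>x. w x * u x ^ i)" for i
          using w pw by (intro L.integrable_mult_bounded[where A = C and B = 1]) auto
        have "(\<integral>x. w x * p (u x) \<partial>L) = (\<integral>x. (\<Sum>i\<le>n. a i * (w x * u x ^ i)) \<partial>L)"
          by (simp add: pa sum_distrib_left mult_ac)
        then show ?thesis using int by simp
      qed
      have "(\<integral>x. w x * p (u x) \<partial>M) = (\<integral>x. w x * p (u x) \<partial>N)"
        using poly[OF M] poly[OF N] MN mom by simp
      then show ?thesis
        using close[OF M] close[OF N] MN by (simp add: K_def algebra_simps)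
    qed
    \<comment> \<open>The estimate holds for every tolerance and is used with \<open>e / K\<close>;
      for \<open>K = 0\<close> it already gives equality.\<close>
    then have "\<bar>(\<integral>x. w x * \<phi> (u x) \<partial>M) - (\<integral>x. w x * \<phi> (u x) \<partial>N)\<bar> \<le> 0 + e" if "e > 0" for e
      using that K0 by (cases "K = 0") (fastforce dest: spec[of _ "e / K"] simp: less_imp_le)+
    then show ?thesis using field_le_epsilon[of "\<bar>(\<integral>x. w x * \<phi> (u x) \<partial>M) - (\<integral>x. w x * \<phi> (u x) \<partial>N)\<bar>" 0] by auto
  qed
  \<comment> \<open>For positive \<open>n\<close> this is 1 on \<open>{c..}\<close>, 0 below
    \<open>c - 1 / n\<close>, and linear in between.\<close>
  define \<phi> where "\<phi> n t = max 0 (min 1 (1 - real n * (c - t)))" for n t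
  have \<phi>c: "continuous_on UNIV (\<phi> n)" for n unfolding \<phi>_def by (intro continuous_intros)
  have [measurable]: "\<phi> n \<in> borel_measurable borel" for n
    using \<phi>c by (rule borel_measurable_continuous_onI)
  have lim\<phi>: "(\<lambda>n. \<phi> n t) \<longlonglongrightarrow> indicator {c..} t" for t
  proof (cases "c \<le> t")
    case True
    then have "real n * (c - t) \<le> 0" for n by (simp add: mult_nonneg_nonpos)
    then have "\<phi> n t = 1" for n unfolding \<phi>_def by (simp add: max_def min_def)
    then show ?thesis using True by simp
  next
    case False
    then have pos: "c - t > 0" by simp
    obtain m where m: "1 < real m * (c - t)" using reals_Archimedean3[OF pos] by blast
    have "\<phi> n t = 0" if "n \<ge> m" for n
    proof -
      have "real m * (c - t) \<le> real n * (c - t)"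
        using that pos by (intro mult_right_mono) auto
      then show ?thesis using m by (simp add: \<phi>_def)
    qed
    then show ?thesis using False by (auto intro!: tendsto_eventually eventually_sequentiallyI)
  qed
  have lim: "(\<lambda>n. \<integral>x. w x * \<phi> n (u x) \<partial>L) \<longlonglongrightarrow> (\<integral>x. w x * indicator {c..} (u x) \<partial>L)"
    if L: "finite_measure L" "sets L = sets M" for L
  proof (rule integral_dominated_convergence[where w = "\<lambda>_. C"])
    interpret L: finite_measure L by fact
    have [measurable]: "u \<in> borel_measurable L" "w \<in> borel_measurable L"
      using u(1) w(1) L by (auto cong: measurable_cong_sets)
    show "(\<lambda>x. w x * indicator {c..} (u x)) \<in> borel_measurable L" by measurable
    show "(\<lambda>x. w x * \<phi> n (u x)) \<in> borel_measurable L" for n by measurable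
    show "AE x in L. (\<lambda>n. w x * \<phi> n (u x)) \<longlonglongrightarrow> w x * indicator {c..} (u x)"
      by (intro AE_I2 tendsto_mult tendsto_const lim\<phi>)
    show "AE x in L. norm (w x * \<phi> n (u x)) \<le> C" for n
    proof (rule AE_I2)
      fix x
      have "\<bar>w x\<bar> * \<bar>\<phi> n (u x)\<bar> \<le> C * 1" using w(2)[of x] by (intro mult_mono) (auto simp: \<phi>_def C0)
      then show "norm (w x * \<phi> n (u x)) \<le> C" by (simp add: abs_mult)
    qed
  qed (rule finite_measure.integrable_const[OF L(1)])
  have "(\<lambda>n. \<integral>x. w x * \<phi> n (u x) \<partial>N) \<longlonglongrightarrow> (\<integral>x. w x * indicator {c..} (u x) \<partial>M)"
    using lim[OF M] cont[OF \<phi>c] by simp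
  then show ?thesis by (rule LIMSEQ_unique[OF _ lim[OF N MN[symmetric]]])
qed

text \<open>With \<open>u = exp (- <mu, g>)\<close>, a constraint \<open><mu, g> \<le> d\<close>
  says that \<open>u\<close> is at least \<open>exp (- d)\<close>, and multiplication by
  \<open>u ^ k\<close> merely adds \<open>k * g\<close> to the test function in the exponent, which
  stays admissible. Moment determinacy therefore adds the constraints of a box one by one.\<close>

lemma laplace_unique:
  fixes M N :: "'a::metric_space measure measure"
  assumes compact: "compact (UNIV :: 'a set)"
    and M: "finite_measure M" "sets M = sets MS" and N: "finite_measure N" "sets N = sets MS"
    and laplace: "\<And>h c. h \<in> bounded_measurable \<Longrightarrow> 0 < c \<Longrightarrow> (\<And>s. c \<le> h s) \<Longrightarrow>
      (\<integral>\<mu>. exp (- (\<integral>s. h s \<partial>\<mu>)) \<partial>M) = (\<integral>\<mu>. exp (- (\<integral>s. h s \<partial>\<mu>)) \<partial>N)"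
  shows "M = N"
proof -
  interpret M: finite_measure M by fact
  interpret N: finite_measure N by fact
  have space: "space M = finite_measures" "space N = finite_measures"
    using sets_eq_imp_space_eq[OF M(2)] sets_eq_imp_space_eq[OF N(2)] by auto
  define B where "B L = {\<mu> \<in> finite_measures. \<forall>x \<in> set L. (\<integral>s. fst x s \<partial>\<mu>) \<le> snd x}"
    for L :: "(('a \<Rightarrow> real) \<times> real) list"
  define ok where "ok L \<longleftrightarrow> (\<forall>x \<in> set L. fst x \<in> bounded_measurable \<and> (\<forall>s. 0 \<le> fst x s))"
    for L :: "(('a \<Rightarrow> real) \<times> real) list"
  have below: "below_sets = {B L | L. ok L}"
    by (simp add: below_sets_def B_def ok_def)
  have BM: "B L \<in> sets MS" if "ok L" for L
    unfolding sets_MS_below[OF compact] using that by (auto simp: below)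
  have MM[measurable]: "(\<lambda>\<mu>. \<integral>s. h s \<partial>\<mu>) \<in> borel_measurable M" "(\<lambda>\<mu>. \<integral>s. h s \<partial>\<mu>) \<in> borel_measurable N"
    if "h \<in> bounded_measurable" for h
    using measurable_integral_MS[OF that] M(2) N(2) by (auto cong: measurable_cong_sets)
  \<comment> \<open>The exponential factor with \<open>h\<close> is kept throughout, because
    transforms are given only for test functions bounded away from 0. Quantifying over
    \<open>h\<close> lets the induction hypothesis supply all moments of the next variable.\<close>
  have step: "(\<integral>\<mu>. exp (- (\<integral>s. h s \<partial>\<mu>)) * indicator (B L) \<mu> \<partial>M) =
      (\<integral>\<mu>. exp (- (\<integral>s. h s \<partial>\<mu>)) * indicator (B L) \<mu> \<partial>N)"
    if "ok L" "h \<in> bounded_measurable" "0 < c" "\<And>s. c \<le> h s" for L h c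
    using that
  proof (induction L arbitrary: h c)
    case Nil
    have "(\<integral>\<mu>. exp (- (\<integral>s. h s \<partial>\<mu>)) * indicator (B []) \<mu> \<partial>K) = (\<integral>\<mu>. exp (- (\<integral>s. h s \<partial>\<mu>)) \<partial>K)"
      if "space K = finite_measures" for K
      using that by (intro Bochner_Integration.integral_cong) (auto simp: B_def)
    then show ?case using laplace[OF Nil(2-4)] space by simp
  next
    case (Cons x L)
    obtain g d where x: "x = (g, d)" by (cases x)
    have g: "g \<in> bounded_measurable" "\<And>s. 0 \<le> g s" and L: "ok L"
      using Cons(2) by (auto simp: ok_def x)
    define u where "u \<mu> = exp (- (\<integral>s. g s \<partial>\<mu>))" for \<mu> :: "'a measure"
    define w where "w \<mu> = exp (- (\<integral>s. h s \<partial>\<mu>)) * indicator (B L) \<mu>" for \<mu> :: "'a measure"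
    have h0: "0 \<le> h s" for s using Cons(4) Cons(5)[of s] by linarith
    have [measurable]: "B L \<in> sets M" "B L \<in> sets N" using BM[OF L] M N by auto
    note [measurable] = MM[OF g(1)] MM[OF Cons(3)]
    have "(\<integral>\<mu>. w \<mu> * indicator {exp (- d)..} (u \<mu>) \<partial>M) = (\<integral>\<mu>. w \<mu> * indicator {exp (- d)..} (u \<mu>) \<partial>N)"
    proof (rule moments_determine_tail[where C = 1])
      show "finite_measure M" "finite_measure N" "sets M = sets N" using M N by auto
      show "u \<in> borel_measurable M" "w \<in> borel_measurable M" unfolding u_def w_def by measurable
      show "0 \<le> u \<mu>" "u \<mu> \<le> 1" for \<mu> using g by (auto simp: u_def intro!: integral_nonneg)
      show "\<bar>w \<mu>\<bar> \<le> 1" for \<mu> using h0 by (auto simp: w_def indicator_def intro!: integral_nonneg)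
      fix k
      have "w \<mu> * u \<mu> ^ k = exp (- (\<integral>s. h s + real k * g s \<partial>\<mu>)) * indicator (B L) \<mu>" if "\<mu> \<in> finite_measures" for \<mu>
      proof -
        have "(\<integral>s. h s + real k * g s \<partial>\<mu>) = (\<integral>s. h s \<partial>\<mu>) + real k * (\<integral>s. g s \<partial>\<mu>)"
          using that g Cons(3) by (subst Bochner_Integration.integral_add) (auto intro!: integrable_bounded_measurable)
        then show ?thesis
          by (simp add: w_def u_def exp_of_nat_mult[symmetric] exp_add[symmetric])
      qed
      then have "(\<integral>\<mu>. w \<mu> * u \<mu> ^ k \<partial>M) = (\<integral>\<mu>. exp (- (\<integral>s. h s + real k * g s \<partial>\<mu>)) * indicator (B L) \<mu> \<partial>M)"
         "(\<integral>\<mu>. w \<mu> * u \<mu> ^ k \<partial>N) = (\<integral>\<mu>. exp (- (\<integral>s. h s + real k * g s \<partial>\<mu>)) * indicator (B L) \<mu> \<partial>N)"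
        using space by (auto intro!: Bochner_Integration.integral_cong)
      moreover have "(\<lambda>s. h s + real k * g s) \<in> bounded_measurable"
        by (intro bounded_measurable_add bounded_measurable_mult bounded_measurable_const g(1) Cons(3))
      moreover have "c \<le> h s + real k * g s" for s
        using Cons(5)[of s] g(2)[of s] by (simp add: add_increasing2)
      ultimately show "(\<integral>\<mu>. w \<mu> * u \<mu> ^ k \<partial>M) = (\<integral>\<mu>. w \<mu> * u \<mu> ^ k \<partial>N)"
        using Cons.IH[OF L, of "\<lambda>s. h s + real k * g s" c] Cons(4) by metis
    qed
    moreover have "w \<mu> * indicator {exp (- d)..} (u \<mu>) = exp (- (\<integral>s. h s \<partial>\<mu>)) * indicator (B (x # L)) \<mu>" for \<mu>
      by (auto simp: w_def u_def B_def x indicator_def)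
    ultimately show ?case by simp
  qed
  have eq: "measure M (B L) = measure N (B L)" if L: "ok L" for L
  proof -
    \<comment> \<open>The remaining exponential factor disappears when the constant test function
      \<open>1 / Suc n\<close> tends to 0.\<close>
    have lim: "(\<lambda>n. \<integral>\<mu>. exp (- (\<integral>s. 1 / real (Suc n) \<partial>\<mu>)) * indicator (B L) \<mu> \<partial>K) \<longlonglongrightarrow> measure K (B L)"
      if K: "finite_measure K" "sets K = sets MS" for K
    proof -
      interpret K: finite_measure K by fact
      have [measurable]: "B L \<in> sets K" using BM[OF L] K by auto
      have [measurable]: "(\<lambda>\<mu>. \<integral>s. h s \<partial>\<mu>) \<in> borel_measurable K" if "h \<in> bounded_measurable" for h
        using measurable_integral_MS[OF that] K(2) by (auto cong: measurable_cong_sets)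
      have "(\<lambda>n. \<integral>\<mu>. exp (- (\<integral>s. 1 / real (Suc n) \<partial>\<mu>)) * indicator (B L) \<mu> \<partial>K) \<longlonglongrightarrow> (\<integral>\<mu>. indicator (B L) \<mu> \<partial>K)"
      proof (rule integral_dominated_convergence[where w = "\<lambda>_. 1"])
        show "AE \<mu> in K. (\<lambda>n. exp (- (\<integral>s. 1 / real (Suc n) \<partial>\<mu>)) * indicator (B L) \<mu>) \<longlonglongrightarrow> indicator (B L) \<mu>"
        proof (rule AE_I2)
          fix \<mu>
          have "(\<lambda>n. exp (- (measure \<mu> (space \<mu>) * (1 / real (Suc n)))) * indicator (B L) \<mu>) \<longlonglongrightarrow>
              exp (- (measure \<mu> (space \<mu>) * 0)) * indicat_real (B L) \<mu>"
            by (intro tendsto_intros LIMSEQ_Suc lim_1_over_n)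
          then show "(\<lambda>n. exp (- (\<integral>s. 1 / real (Suc n) \<partial>\<mu>)) * indicator (B L) \<mu>) \<longlonglongrightarrow> indicat_real (B L) \<mu>"
            by simp
        qed
        show "AE \<mu> in K. norm (exp (- (\<integral>s. 1 / real (Suc n) \<partial>\<mu>)) * indicat_real (B L) \<mu>) \<le> 1" for n
          by (intro AE_I2) (auto simp: indicator_def)
        have "(\<lambda>\<mu>. \<integral>s. 1 / real (Suc n) \<partial>\<mu>) \<in> borel_measurable K" for n by measurable
        then show "(\<lambda>\<mu>. exp (- (\<integral>s. 1 / real (Suc n) \<partial>\<mu>)) * indicator (B L) \<mu>) \<in> borel_measurable K" for n
          by (intro borel_measurable_times borel_measurable_exp borel_measurable_uminus borel_measurable_indicator) auto
      qed auto
      then show ?thesis using K(2) sets_eq_imp_space_eq[OF K(2)] by (simp add: B_def Int_absorb2 subset_iff)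
    qed
    have "(\<integral>\<mu>. exp (- (\<integral>s. 1 / real (Suc n) \<partial>\<mu>)) * indicator (B L) \<mu> \<partial>M) =
        (\<integral>\<mu>. exp (- (\<integral>s. 1 / real (Suc n) \<partial>\<mu>)) * indicator (B L) \<mu> \<partial>N)" for n
      by (rule step[OF L, of _ "1 / real (Suc n)"]) auto
    then show ?thesis using LIMSEQ_unique[OF lim[OF M]] lim[OF N] by simp
  qed
  show ?thesis
  proof (rule measure_eqI_generator_eq[where A = "\<lambda>_. finite_measures"])
    show "Int_stable (below_sets :: 'a measure set set)"
    proof (rule Int_stableI)
      fix X Y :: "'a measure set" assume "X \<in> below_sets" "Y \<in> below_sets"
      then obtain L L' where "X = B L" "ok L" "Y = B L'" "ok L'" by (auto simp: below)
      then have "X \<inter> Y = B (L @ L')" "ok (L @ L')" by (auto simp: B_def ok_def)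
      then show "X \<inter> Y \<in> below_sets" by (auto simp: below)
    qed
    show "below_sets \<subseteq> Pow (finite_measures :: 'a measure set)" by (auto simp: below B_def)
    show "sets M = sigma_sets finite_measures below_sets" "sets N = sigma_sets finite_measures below_sets"
      using M N sets_MS_below[OF compact] by auto
    show "range (\<lambda>_. finite_measures) \<subseteq> (below_sets :: 'a measure set set)"
      unfolding below by (auto intro!: exI[of _ "[]"] simp: B_def ok_def)
    show "emeasure M X = emeasure N X" if "X \<in> below_sets" for X
      using that eq by (auto simp: below M.emeasure_eq_measure N.emeasure_eq_measure)
  qed auto
qed

section \<open>Quasi-invariance\<close>

lemma tilt_finite_measures [simp]:
  assumes "f \<in> bounded_measurable" "\<mu> \<in> finite_measures"
  shows "tilt f \<mu> \<in> finite_measures"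
proof -
  interpret finite_measure \<mu> using assms finite_measuresD by auto
  have [measurable]: "f \<in> borel_measurable \<mu>"
    using bounded_measurableD(1)[OF assms(1)] assms(2) by (simp add: measurable_finite_measures)
  obtain B where B: "\<And>s. \<bar>f s\<bar> \<le> B" using bounded_measurableD[OF assms(1)] by auto
  have "(\<integral>\<^sup>+s. ennreal (exp (f s)) \<partial>\<mu>) \<le> (\<integral>\<^sup>+s. ennreal (exp B) \<partial>\<mu>)"
    using B by (intro nn_integral_mono ennreal_leI) (auto simp: abs_le_iff)
  also have "\<dots> < \<infinity>"
    using emeasure_finite[of "space \<mu>"] by (simp add: ennreal_mult_eq_top_iff less_top[symmetric] del: emeasure_finite)
  finally have "emeasure (tilt f \<mu>) (space (tilt f \<mu>)) \<noteq> \<infinity>"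
    by (simp add: tilt_def emeasure_density cong: nn_integral_cong)
  then show ?thesis
    using finite_measuresD(1)[OF assms(2)] by (auto simp: finite_measures_def tilt_def intro!: finite_measureI)
qed

lemma integral_tilt:
  assumes "f \<in> bounded_measurable" "g \<in> bounded_measurable" "\<mu> \<in> finite_measures"
  shows "(\<integral>s. g s \<partial>(tilt f \<mu>)) = (\<integral>s. exp (f s) * g s \<partial>\<mu>)"
  unfolding tilt_def
  using bounded_measurableD(1)[OF assms(1)] bounded_measurableD(1)[OF assms(2)] assms(3)
  by (subst integral_density) (auto simp: measurable_finite_measures)

lemma tilt_tilt:
  assumes "f \<in> bounded_measurable" "g \<in> bounded_measurable" "\<mu> \<in> finite_measures"
  shows "tilt f (tilt g \<mu>) = tilt (\<lambda>s. f s + g s) \<mu>"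
  unfolding tilt_def
  using bounded_measurableD(1)[OF assms(1)] bounded_measurableD(1)[OF assms(2)] assms(3)
  by (subst density_density_eq)
    (auto simp: measurable_finite_measures exp_add ennreal_mult mult_ac)

lemma tilt_zero [simp]: "tilt (\<lambda>s. 0) \<mu> = \<mu>"
  by (simp add: tilt_def density_1)

text \<open>Evaluating the tilted measure at \<open>g\<close> amounts to evaluating the original one
  at \<open>exp f * g\<close>, which is again bounded and measurable.\<close>

lemma measurable_tilt:
  assumes "compact (UNIV :: 'a::metric_space set)" "(f :: 'a \<Rightarrow> real) \<in> bounded_measurable"
  shows "tilt f \<in> measurable MS MS"
proof (rule measurable_into_MS[OF assms(1)])
  fix g :: "'a \<Rightarrow> real" assume g: "g \<in> bounded_measurable"
  have "(\<lambda>\<mu>. \<integral>s. exp (f s) * g s \<partial>\<mu>) \<in> borel_measurable MS"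
    using assms g by (intro measurable_integral_MS) auto
  also have "?this \<longleftrightarrow> (\<lambda>\<mu>. \<integral>s. g s \<partial>(tilt f \<mu>)) \<in> borel_measurable MS"
    by (rule measurable_cong) (use g assms in \<open>auto simp: integral_tilt\<close>)
  finally show "(\<lambda>\<mu>. \<integral>s. g s \<partial>(tilt f \<mu>)) \<in> borel_measurable MS" .
qed (use assms in auto)

locale gamma_law =
  fixes a b :: "'a::metric_space \<Rightarrow> real" and \<mu>\<^sub>0 :: "'a measure" and \<Gamma> :: "'a measure measure"
  assumes compact_UNIV: "compact (UNIV :: 'a set)"
    and \<mu>\<^sub>0 [simp]: "\<mu>\<^sub>0 \<in> finite_measures"
    and continuous_a: "continuous_on UNIV a" and a_pos: "a s > 0"
    and continuous_b: "continuous_on UNIV b" and b_pos: "b s > 0"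
    and gamma: "is_Gamma_law a b \<mu>\<^sub>0 \<Gamma>"
begin

lemma a_nz [simp]: "a s \<noteq> 0" and b_nz [simp]: "b s \<noteq> 0"
  using a_pos[of s] b_pos[of s] by auto

lemma sets_\<Gamma> [measurable_cong]: "sets \<Gamma> = sets MS"
  using gamma by (simp add: is_Gamma_law_def)

lemma space_\<Gamma> [simp]: "space \<Gamma> = finite_measures"
  using sets_eq_imp_space_eq[OF sets_\<Gamma>] by simp

sublocale prob_space \<Gamma>
  using gamma by (simp add: is_Gamma_law_def)

lemma bounded_measurable_coefficients [intro, simp]:
  "a \<in> bounded_measurable" "b \<in> bounded_measurable"
  "(\<lambda>s. 1 / a s) \<in> bounded_measurable"
  "(\<lambda>s. b s / a s) \<in> bounded_measurable" "(\<lambda>s. a s / b s) \<in> bounded_measurable"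
  by (auto intro!: bounded_measurable_continuous[OF compact_UNIV] continuous_intros continuous_a continuous_b)

lemma bounded_measurable_divide_a [intro]:
  "f \<in> bounded_measurable \<Longrightarrow> (\<lambda>s. f s / a s) \<in> bounded_measurable"
  using bounded_measurable_mult[OF _ bounded_measurable_coefficients(3), of f] by simp

lemma Lambda_eq:
  "Lambda a b \<mu>\<^sub>0 \<mu> f = (\<integral>s. f s / a s \<partial>\<mu>\<^sub>0) - (\<integral>s. (exp (f s) - 1) * (b s / a s) \<partial>\<mu>)"
  by (simp add: Lambda_def)

lemma bounded_measurable_Lambda [intro]:
  assumes "f \<in> bounded_measurable"
  shows "(\<lambda>s. (exp (f s) - 1) * (b s / a s)) \<in> bounded_measurable"
    and "(\<lambda>s. (exp (f s) - 1) * b s / a s) \<in> bounded_measurable"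
proof -
  show "(\<lambda>s. (exp (f s) - 1) * (b s / a s)) \<in> bounded_measurable"
    by (intro bounded_measurable_mult bounded_measurable_diff bounded_measurable_exp
      bounded_measurable_const bounded_measurable_coefficients assms)
  then show "(\<lambda>s. (exp (f s) - 1) * b s / a s) \<in> bounded_measurable" by simp
qed

lemma measurable_Lambda:
  assumes "f \<in> bounded_measurable"
  shows "(\<lambda>\<mu>. Lambda a b \<mu>\<^sub>0 \<mu> f) \<in> borel_measurable MS"
  unfolding Lambda_eq using assms
  by (intro borel_measurable_diff measurable_integral_MS) auto

text \<open>The identity \<open>exp (f + g) - 1 = exp g * (exp f - 1) + (exp g - 1)\<close> mirrors
  the composition of tilts. This is the consistency required of densities under a group action, and
  it allows quasi-invariance for two directions to be combined.\<close>

lemma Lambda_cocycle: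
  assumes f: "f \<in> bounded_measurable" and g: "g \<in> bounded_measurable" and \<mu>: "\<mu> \<in> finite_measures"
  shows "Lambda a b \<mu>\<^sub>0 \<mu> (\<lambda>s. f s + g s) = Lambda a b \<mu>\<^sub>0 (tilt g \<mu>) f + Lambda a b \<mu>\<^sub>0 \<mu> g"
proof -
  have 1: "(\<integral>s. (f s + g s) / a s \<partial>\<mu>\<^sub>0) = (\<integral>s. f s / a s \<partial>\<mu>\<^sub>0) + (\<integral>s. g s / a s \<partial>\<mu>\<^sub>0)"
    unfolding add_divide_distrib using f g
    by (intro Bochner_Integration.integral_add integrable_bounded_measurable) auto
  have "(\<integral>s. (exp (f s + g s) - 1) * (b s / a s) \<partial>\<mu>) =
      (\<integral>s. exp (g s) * ((exp (f s) - 1) * (b s / a s)) + (exp (g s) - 1) * (b s / a s) \<partial>\<mu>)"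
    by (intro Bochner_Integration.integral_cong) (auto simp: exp_add field_simps)
  also have "\<dots> = (\<integral>s. exp (g s) * ((exp (f s) - 1) * (b s / a s)) \<partial>\<mu>) + (\<integral>s. (exp (g s) - 1) * (b s / a s) \<partial>\<mu>)"
    using f g \<mu>
    by (intro Bochner_Integration.integral_add integrable_bounded_measurable bounded_measurable_mult[of "\<lambda>s. exp (g s)"]) auto
  also have "(\<integral>s. exp (g s) * ((exp (f s) - 1) * (b s / a s)) \<partial>\<mu>) = (\<integral>s. (exp (f s) - 1) * (b s / a s) \<partial>(tilt g \<mu>))"
    using f g \<mu> by (subst integral_tilt) auto
  finally show ?thesis using 1 by (simp add: Lambda_eq)
qed

lemma Lambda_zero: "Lambda a b \<mu>\<^sub>0 \<mu> (\<lambda>s. 0) = 0"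
  by (simp add: Lambda_def)

lemma Lambda_inverse:
  assumes "f \<in> bounded_measurable" "\<mu> \<in> finite_measures"
  shows "Lambda a b \<mu>\<^sub>0 (tilt (\<lambda>s. - f s) \<mu>) f = - Lambda a b \<mu>\<^sub>0 \<mu> (\<lambda>s. - f s)"
  using Lambda_cocycle[OF assms(1) bounded_measurable_minus[OF assms(1)] assms(2)]
  by (simp add: Lambda_zero)

text \<open>For bounded test functions all integrals in the defining formula are finite, so
  \<open>exp_neg\<close> becomes an ordinary exponential. The inequality
  \<open>ln (1 + x) \<le> x\<close> keeps the logarithm bounded.\<close>

lemma laplace_gamma:
  assumes h: "h \<in> bounded_measurable" and c: "0 < c" "\<And>s. c \<le> h s"
  shows "(\<integral>\<mu>. exp (- (\<integral>s. h s \<partial>\<mu>)) \<partial>\<Gamma>) = exp (- (\<integral>s. ln (1 + a s / b s * h s) / a s \<partial>\<mu>\<^sub>0))"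
    and "(\<lambda>s. ln (1 + a s / b s * h s) / a s) \<in> bounded_measurable"
proof -
  have h0: "0 \<le> h s" for s using c(1) c(2)[of s] by linarith
  have exp_neg: "exp_neg (\<integral>\<^sup>+s. ennreal (g s) \<partial>\<mu>) = exp (- (\<integral>s. g s \<partial>\<mu>))"
    if "g \<in> bounded_measurable" "\<And>s. 0 \<le> g s" "\<mu> \<in> finite_measures" for g :: "'a \<Rightarrow> real" and \<mu>
    using that by (subst nn_integral_eq_integral)
      (auto intro: integrable_bounded_measurable simp: exp_neg_def integral_nonneg)
  have nn: "0 \<le> a s / b s * h s" for s using a_pos[of s] b_pos[of s] h0[of s] by auto
  have k: "(\<lambda>s. a s / b s * h s) \<in> bounded_measurable"
    by (intro bounded_measurable_mult bounded_measurable_coefficients h)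
  obtain B where B: "\<And>s. \<bar>a s / b s * h s\<bar> \<le> B" using bounded_measurableD(2)[OF k] by blast
  have "(\<lambda>s. ln (1 + a s / b s * h s)) \<in> bounded_measurable"
  proof (rule bounded_measurableI)
    show "(\<lambda>s. ln (1 + a s / b s * h s)) \<in> borel_measurable borel"
      using bounded_measurableD(1)[OF k] by measurable
    show "\<bar>ln (1 + a s / b s * h s)\<bar> \<le> B" for s
      using ln_add_one_self_le_self[OF nn[of s]] B[of s] nn[of s] ln_ge_zero[of "1 + a s / b s * h s"] by linarith
  qed
  then show bm: "(\<lambda>s. ln (1 + a s / b s * h s) / a s) \<in> bounded_measurable" by auto
  have "h \<in> positive_measurable"
    using bounded_measurableD(1)[OF h] c by (auto simp: positive_measurable_def)
  then have "(\<integral>\<mu>. exp_neg (\<integral>\<^sup>+s. ennreal (h s) \<partial>\<mu>) \<partial>\<Gamma>) =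
      exp_neg (\<integral>\<^sup>+s. ennreal (ln (1 + a s / b s * h s) / a s) \<partial>\<mu>\<^sub>0)"
    using gamma by (simp add: is_Gamma_law_def)
  also have "\<dots> = exp (- (\<integral>s. ln (1 + a s / b s * h s) / a s \<partial>\<mu>\<^sub>0))"
    using bm nn a_pos by (intro exp_neg) (auto intro!: divide_nonneg_pos ln_ge_zero)
  also have "(\<integral>\<mu>. exp_neg (\<integral>\<^sup>+s. ennreal (h s) \<partial>\<mu>) \<partial>\<Gamma>) = (\<integral>\<mu>. exp (- (\<integral>s. h s \<partial>\<mu>)) \<partial>\<Gamma>)"
    using h h0 by (intro Bochner_Integration.integral_cong) (auto simp: exp_neg)
  finally show "(\<integral>\<mu>. exp (- (\<integral>s. h s \<partial>\<mu>)) \<partial>\<Gamma>) = exp (- (\<integral>s. ln (1 + a s / b s * h s) / a s \<partial>\<mu>\<^sub>0))" .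
qed

text \<open>For \<open>f \<le> 0\<close> the test function \<open>h + (exp (- f) - 1) b / a\<close> is positive, so both Laplace
  functionals are given by the defining formula of the Gamma law.\<close>

lemma distr_tilt_nonpos:
  assumes f: "f \<in> bounded_measurable" and f0: "\<And>s. f s \<le> 0"
  shows "distr \<Gamma> MS (tilt f) = density \<Gamma> (\<lambda>\<mu>. ennreal (exp (Lambda a b \<mu>\<^sub>0 \<mu> (\<lambda>s. - f s))))"
proof (rule laplace_unique[OF compact_UNIV])
  \<comment> \<open>The part of the exponent that depends on the measure is
    \<open>- <mu, k>\<close>. Since \<open>k\<close> is nonnegative, the density is at most
    \<open>exp (- A)\<close>, and \<open>h + k\<close> inherits the lower bound of
    \<open>h\<close>.\<close>
  define k where "k s = (exp (- f s) - 1) * (b s / a s)" for s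
  define A where "A = (\<integral>s. f s / a s \<partial>\<mu>\<^sub>0)"
  have k: "k \<in> bounded_measurable" unfolding k_def by (intro bounded_measurable_Lambda bounded_measurable_minus f)
  have k0: "0 \<le> k s" for s using f0[of s] a_pos[of s] b_pos[of s] by (simp add: k_def)
  have \<Lambda>: "Lambda a b \<mu>\<^sub>0 \<mu> (\<lambda>s. - f s) = - A - (\<integral>s. k s \<partial>\<mu>)" for \<mu>
    by (simp add: Lambda_def A_def k_def)
  have [measurable]: "(\<lambda>\<mu>. Lambda a b \<mu>\<^sub>0 \<mu> (\<lambda>s. - f s)) \<in> borel_measurable MS"
    using f by (intro measurable_Lambda) auto
  have [measurable]: "tilt f \<in> measurable MS MS" using measurable_tilt[OF compact_UNIV f] .
  show "finite_measure (distr \<Gamma> MS (tilt f))"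
    by (intro finite_measure_distr) measurable
  have "(\<integral>\<^sup>+\<mu>. ennreal (exp (Lambda a b \<mu>\<^sub>0 \<mu> (\<lambda>s. - f s))) \<partial>\<Gamma>) \<le> (\<integral>\<^sup>+\<mu>. ennreal (exp (- A)) \<partial>\<Gamma>)"
    using k0 by (intro nn_integral_mono ennreal_leI) (auto simp: \<Lambda> intro!: integral_nonneg)
  also have "\<dots> < \<infinity>" using emeasure_space_1 by simp
  also have "(\<integral>\<^sup>+\<mu>. ennreal (exp (Lambda a b \<mu>\<^sub>0 \<mu> (\<lambda>s. - f s))) \<partial>\<Gamma>) =
      emeasure (density \<Gamma> (\<lambda>\<mu>. ennreal (exp (Lambda a b \<mu>\<^sub>0 \<mu> (\<lambda>s. - f s))))) (space \<Gamma>)"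
    using sets.top[of \<Gamma>] by (subst emeasure_density) (auto intro!: nn_integral_cong simp del: sets.top)
  finally show "finite_measure (density \<Gamma> (\<lambda>\<mu>. ennreal (exp (Lambda a b \<mu>\<^sub>0 \<mu> (\<lambda>s. - f s)))))"
    by (intro finite_measureI) simp
  fix h :: "'a \<Rightarrow> real" and c :: real
  assume h: "h \<in> bounded_measurable" and c: "0 < c" "\<And>s. c \<le> h s"
  have [measurable]: "(\<lambda>\<mu>. \<integral>s. h s \<partial>\<mu>) \<in> borel_measurable MS" by (intro measurable_integral_MS h)
  obtain B where B: "\<And>s. \<bar>f s\<bar> \<le> B" using bounded_measurableD[OF f] by auto
  have h1: "(\<lambda>s. exp (f s) * h s) \<in> bounded_measurable" using f h by auto
  have c1: "exp (- B) * c \<le> exp (f s) * h s" for s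
    using B[of s] c(1) c(2)[of s] by (intro mult_mono) (auto simp: abs_le_iff)
  have h2: "(\<lambda>s. h s + k s) \<in> bounded_measurable" using h k by auto
  have c2: "c \<le> h s + k s" for s using c(2)[of s] k0[of s] by linarith
  have pos: "0 < exp (- B) * c" using c(1) by simp
  have "(\<integral>\<mu>. exp (- (\<integral>s. h s \<partial>\<mu>)) \<partial>(distr \<Gamma> MS (tilt f))) = (\<integral>\<mu>. exp (- (\<integral>s. exp (f s) * h s \<partial>\<mu>)) \<partial>\<Gamma>)"
    by (subst integral_distr) (auto simp: integral_tilt f h intro!: Bochner_Integration.integral_cong)
  also have "\<dots> = exp (- (\<integral>s. ln (1 + a s / b s * (exp (f s) * h s)) / a s \<partial>\<mu>\<^sub>0))"
    by (rule laplace_gamma(1)[OF h1 pos c1])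
  also have "(\<integral>s. ln (1 + a s / b s * (exp (f s) * h s)) / a s \<partial>\<mu>\<^sub>0) =
      (\<integral>s. f s / a s + ln (1 + a s / b s * (h s + k s)) / a s \<partial>\<mu>\<^sub>0)"
  proof (intro Bochner_Integration.integral_cong refl)
    fix s
    have nn: "0 < 1 + a s / b s * (h s + k s)"
      using c(1) c2[of s] a_pos[of s] b_pos[of s] by (simp add: add_pos_nonneg)
    \<comment> \<open>This identity explains the form of \<open>Lambda\<close>: the arguments of the
      logarithm at \<open>exp f * h\<close> and at \<open>h + k\<close> differ by the factor
      \<open>exp f\<close>, whose logarithm contributes the constant \<open>A\<close>.\<close>
    have "1 + a s / b s * (exp (f s) * h s) = exp (f s) * (1 + a s / b s * (h s + k s))"
      by (simp add: k_def field_simps exp_minus)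
    then have "ln (1 + a s / b s * (exp (f s) * h s)) = f s + ln (1 + a s / b s * (h s + k s))"
      using nn by (simp add: ln_mult)
    then show "ln (1 + a s / b s * (exp (f s) * h s)) / a s = f s / a s + ln (1 + a s / b s * (h s + k s)) / a s"
      by (simp add: add_divide_distrib)
  qed
  also have "\<dots> = A + (\<integral>s. ln (1 + a s / b s * (h s + k s)) / a s \<partial>\<mu>\<^sub>0)"
    unfolding A_def using f laplace_gamma(2)[OF h2 c(1) c2]
    by (intro Bochner_Integration.integral_add integrable_bounded_measurable) auto
  also have "exp (- \<dots>) = exp (- A) * (\<integral>\<mu>. exp (- (\<integral>s. h s + k s \<partial>\<mu>)) \<partial>\<Gamma>)"
    using laplace_gamma(1)[OF h2 c(1) c2] by (simp add: exp_add[symmetric])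
  also have "\<dots> = (\<integral>\<mu>. exp (- A) * exp (- (\<integral>s. h s + k s \<partial>\<mu>)) \<partial>\<Gamma>)" by simp
  also have "\<dots> = (\<integral>\<mu>. exp (Lambda a b \<mu>\<^sub>0 \<mu> (\<lambda>s. - f s)) * exp (- (\<integral>s. h s \<partial>\<mu>)) \<partial>\<Gamma>)"
    using h k by (intro Bochner_Integration.integral_cong)
      (auto simp: \<Lambda> exp_add[symmetric] Bochner_Integration.integral_add integrable_bounded_measurable)
  also have "\<dots> = (\<integral>\<mu>. exp (- (\<integral>s. h s \<partial>\<mu>)) \<partial>(density \<Gamma> (\<lambda>\<mu>. ennreal (exp (Lambda a b \<mu>\<^sub>0 \<mu> (\<lambda>s. - f s))))))"
    by (subst integral_density) auto
  finally show "(\<integral>\<mu>. exp (- (\<integral>s. h s \<partial>\<mu>)) \<partial>(distr \<Gamma> MS (tilt f))) =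
    (\<integral>\<mu>. exp (- (\<integral>s. h s \<partial>\<mu>)) \<partial>(density \<Gamma> (\<lambda>\<mu>. ennreal (exp (Lambda a b \<mu>\<^sub>0 \<mu> (\<lambda>s. - f s))))))" .
qed (auto simp: sets_\<Gamma>)

section \<open>Change of variables under tilts\<close>

lemma nn_integral_tilt_nonpos:
  assumes f: "f \<in> bounded_measurable" and "\<And>s. f s \<le> 0"
    and \<Psi>: "\<Psi> \<in> borel_measurable MS"
  shows "(\<integral>\<^sup>+\<mu>. \<Psi> (tilt f \<mu>) \<partial>\<Gamma>) = (\<integral>\<^sup>+\<mu>. \<Psi> \<mu> * ennreal (exp (Lambda a b \<mu>\<^sub>0 \<mu> (\<lambda>s. - f s))) \<partial>\<Gamma>)"
proof -
  have [measurable]: "tilt f \<in> measurable MS MS" using measurable_tilt[OF compact_UNIV f] .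
  have [measurable]: "(\<lambda>\<mu>. Lambda a b \<mu>\<^sub>0 \<mu> (\<lambda>s. - f s)) \<in> borel_measurable MS"
    using f by (intro measurable_Lambda) auto
  note [measurable] = \<Psi>
  have "(\<integral>\<^sup>+\<mu>. \<Psi> (tilt f \<mu>) \<partial>\<Gamma>) = (\<integral>\<^sup>+\<mu>. \<Psi> \<mu> \<partial>(distr \<Gamma> MS (tilt f)))"
    by (subst nn_integral_distr) auto
  also have "\<dots> = (\<integral>\<^sup>+\<mu>. \<Psi> \<mu> * ennreal (exp (Lambda a b \<mu>\<^sub>0 \<mu> (\<lambda>s. - f s))) \<partial>\<Gamma>)"
    unfolding distr_tilt_nonpos[OF assms(1,2)]
    by (subst nn_integral_density) (auto simp: mult.commute)
  finally show ?thesis .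
qed

text \<open>The nonpositive case is applied to \<open>- f\<close> and to a functional with the extra
  factor \<open>exp (- Lambda)\<close> at \<open>f\<close>. On one side this factor cancels the
  density; on the other it is evaluated at the tilted measure, where \<open>Lambda_inverse\<close>
  turns it into the wanted density. Integrands are nonnegative because the exponent now increases
  with the measure and no exponential moment is known in advance.\<close>

lemma nn_integral_tilt_nonneg:
  assumes f: "f \<in> bounded_measurable" and f0: "\<And>s. 0 \<le> f s"
    and \<Psi>: "\<Psi> \<in> borel_measurable MS"
  shows "(\<integral>\<^sup>+\<mu>. \<Psi> (tilt f \<mu>) \<partial>\<Gamma>) = (\<integral>\<^sup>+\<mu>. \<Psi> \<mu> * ennreal (exp (Lambda a b \<mu>\<^sub>0 \<mu> (\<lambda>s. - f s))) \<partial>\<Gamma>)"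
proof -
  define \<Phi> where "\<Phi> \<mu> = \<Psi> (tilt f \<mu>) * ennreal (exp (- Lambda a b \<mu>\<^sub>0 \<mu> f))" for \<mu>
  have [measurable]: "tilt f \<in> measurable MS MS" using measurable_tilt[OF compact_UNIV f] .
  have [measurable]: "(\<lambda>\<mu>. Lambda a b \<mu>\<^sub>0 \<mu> f) \<in> borel_measurable MS"
    using f by (rule measurable_Lambda)
  note [measurable] = \<Psi>
  have "\<Phi> \<in> borel_measurable MS" unfolding \<Phi>_def by measurable
  then have "(\<integral>\<^sup>+\<mu>. \<Phi> (tilt (\<lambda>s. - f s) \<mu>) \<partial>\<Gamma>) = (\<integral>\<^sup>+\<mu>. \<Phi> \<mu> * ennreal (exp (Lambda a b \<mu>\<^sub>0 \<mu> (\<lambda>s. - (- f s)))) \<partial>\<Gamma>)"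
    using f f0 by (intro nn_integral_tilt_nonpos) auto
  also have "\<dots> = (\<integral>\<^sup>+\<mu>. \<Psi> (tilt f \<mu>) \<partial>\<Gamma>)"
    by (intro nn_integral_cong)
      (simp add: \<Phi>_def mult.assoc ennreal_mult[symmetric] exp_add[symmetric])
  also have "(\<integral>\<^sup>+\<mu>. \<Phi> (tilt (\<lambda>s. - f s) \<mu>) \<partial>\<Gamma>) = (\<integral>\<^sup>+\<mu>. \<Psi> \<mu> * ennreal (exp (Lambda a b \<mu>\<^sub>0 \<mu> (\<lambda>s. - f s))) \<partial>\<Gamma>)"
    using f by (intro nn_integral_cong)
      (simp add: \<Phi>_def Lambda_inverse tilt_tilt bounded_measurable_minus)
  finally show ?thesis by simp
qed

lemma nn_integral_tilt:
  assumes f: "f \<in> bounded_measurable" and \<Psi>: "\<Psi> \<in> borel_measurable MS"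
  shows "(\<integral>\<^sup>+\<mu>. \<Psi> (tilt f \<mu>) \<partial>\<Gamma>) = (\<integral>\<^sup>+\<mu>. \<Psi> \<mu> * ennreal (exp (Lambda a b \<mu>\<^sub>0 \<mu> (\<lambda>s. - f s))) \<partial>\<Gamma>)"
proof -
  define p where "p s = max 0 (f s)" for s
  define q where "q s = min 0 (f s)" for s
  obtain B where B: "\<And>s. \<bar>f s\<bar> \<le> B" using bounded_measurableD[OF f] by auto
  have [measurable]: "f \<in> borel_measurable borel" using bounded_measurableD(1)[OF f] .
  have p: "p \<in> bounded_measurable"
  proof (rule bounded_measurableI)
    show "p \<in> borel_measurable borel" unfolding p_def by measurable
    show "\<bar>p s\<bar> \<le> B" for s using B[of s] by (auto simp: p_def)
  qed
  have q: "q \<in> bounded_measurable"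
  proof (rule bounded_measurableI)
    show "q \<in> borel_measurable borel" unfolding q_def by measurable
    show "\<bar>q s\<bar> \<le> B" for s using B[of s] by (auto simp: q_def)
  qed
  have pq: "p s + q s = f s" for s by (auto simp: p_def q_def)
  note [measurable] = \<Psi> measurable_tilt[OF compact_UNIV p]
    measurable_tilt[OF compact_UNIV bounded_measurable_minus[OF p]]
    measurable_Lambda[OF bounded_measurable_minus[OF q]]
  \<comment> \<open>Once the tilt by \<open>q\<close> is removed, the integrand involves both
    \<open>tilt p \<mu>\<close> and \<open>\<mu>\<close>. Writing \<open>\<mu>\<close> as the tilt
    of \<open>tilt p \<mu>\<close> by \<open>- p\<close> makes it a functional of
    \<open>tilt p \<mu>\<close> alone, as the nonnegative case requires.\<close>
  define \<Phi> where "\<Phi> \<mu> = \<Psi> \<mu> * ennreal (exp (Lambda a b \<mu>\<^sub>0 (tilt (\<lambda>s. - p s) \<mu>) (\<lambda>s. - q s)))" for \<mu>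
  have \<Phi>: "\<Phi> \<in> borel_measurable MS"
    using measurable_compose[OF measurable_tilt[OF compact_UNIV bounded_measurable_minus[OF p]]
        measurable_Lambda[OF bounded_measurable_minus[OF q]]]
    unfolding \<Phi>_def by measurable
  have "(\<integral>\<^sup>+\<mu>. \<Psi> (tilt f \<mu>) \<partial>\<Gamma>) = (\<integral>\<^sup>+\<mu>. \<Psi> (tilt p (tilt q \<mu>)) \<partial>\<Gamma>)"
    by (intro nn_integral_cong) (simp add: tilt_tilt p q pq)
  also have "\<dots> = (\<integral>\<^sup>+\<mu>. \<Psi> (tilt p \<mu>) * ennreal (exp (Lambda a b \<mu>\<^sub>0 \<mu> (\<lambda>s. - q s))) \<partial>\<Gamma>)"
    by (rule nn_integral_tilt_nonpos[OF q]) (auto simp: q_def)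
  also have "\<dots> = (\<integral>\<^sup>+\<mu>. \<Phi> (tilt p \<mu>) \<partial>\<Gamma>)"
    using p by (intro nn_integral_cong) (simp add: \<Phi>_def tilt_tilt bounded_measurable_minus)
  also have "\<dots> = (\<integral>\<^sup>+\<mu>. \<Phi> \<mu> * ennreal (exp (Lambda a b \<mu>\<^sub>0 \<mu> (\<lambda>s. - p s))) \<partial>\<Gamma>)"
    by (rule nn_integral_tilt_nonneg[OF p]) (auto simp: p_def \<Phi>)
  also have "\<dots> = (\<integral>\<^sup>+\<mu>. \<Psi> \<mu> * ennreal (exp (Lambda a b \<mu>\<^sub>0 \<mu> (\<lambda>s. - f s))) \<partial>\<Gamma>)"
  proof (intro nn_integral_cong)
    fix \<mu> assume "\<mu> \<in> space \<Gamma>"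
    then have "Lambda a b \<mu>\<^sub>0 \<mu> (\<lambda>s. - q s + - p s) =
        Lambda a b \<mu>\<^sub>0 (tilt (\<lambda>s. - p s) \<mu>) (\<lambda>s. - q s) + Lambda a b \<mu>\<^sub>0 \<mu> (\<lambda>s. - p s)"
      using p q by (intro Lambda_cocycle) auto
    moreover have "- q s + - p s = - f s" for s using pq[of s] by simp
    ultimately show "\<Phi> \<mu> * ennreal (exp (Lambda a b \<mu>\<^sub>0 \<mu> (\<lambda>s. - p s))) =
        \<Psi> \<mu> * ennreal (exp (Lambda a b \<mu>\<^sub>0 \<mu> (\<lambda>s. - f s)))"
      by (simp add: \<Phi>_def mult.assoc ennreal_mult[symmetric] exp_add[symmetric])
  qed
  finally show ?thesis .
qed

lemma distr_tilt:
  assumes f: "f \<in> bounded_measurable"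
  shows "distr \<Gamma> MS (tilt f) = density \<Gamma> (\<lambda>\<mu>. ennreal (exp (Lambda a b \<mu>\<^sub>0 \<mu> (\<lambda>s. - f s))))"
proof (rule measure_eqI)
  fix X assume "X \<in> sets (distr \<Gamma> MS (tilt f))"
  then have [measurable]: "X \<in> sets MS" by simp
  note [measurable] = measurable_tilt[OF compact_UNIV f] measurable_Lambda[OF bounded_measurable_minus[OF f]]
  have "emeasure (distr \<Gamma> MS (tilt f)) X = (\<integral>\<^sup>+\<mu>. indicator X (tilt f \<mu>) \<partial>\<Gamma>)"
    by (subst nn_integral_indicator[symmetric], simp, subst nn_integral_distr) auto
  also have "\<dots> = (\<integral>\<^sup>+\<mu>. indicator X \<mu> * ennreal (exp (Lambda a b \<mu>\<^sub>0 \<mu> (\<lambda>s. - f s))) \<partial>\<Gamma>)"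
    by (rule nn_integral_tilt[OF f]) measurable
  finally show "emeasure (distr \<Gamma> MS (tilt f)) X =
      emeasure (density \<Gamma> (\<lambda>\<mu>. ennreal (exp (Lambda a b \<mu>\<^sub>0 \<mu> (\<lambda>s. - f s))))) X"
    by (subst emeasure_density) (auto simp: sets_\<Gamma> mult.commute)
qed (auto simp: sets_\<Gamma>)

lemma quasi_invariant: "Lambda_quasi_invariant a b \<mu>\<^sub>0 \<Gamma>"
  unfolding Lambda_quasi_invariant_def
proof (intro ballI conjI)
  fix f :: "'a \<Rightarrow> real" assume f: "f \<in> bounded_measurable"
  note m[measurable] = measurable_tilt[OF compact_UNIV f] measurable_Lambda[OF bounded_measurable_minus[OF f]]
  show "tilt f \<in> measurable \<Gamma> MS" by measurable
  show "(\<lambda>\<mu>. Lambda a b \<mu>\<^sub>0 \<mu> (\<lambda>s. - f s)) \<in> borel_measurable \<Gamma>" by measurable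
  show "absolutely_continuous \<Gamma> (distr \<Gamma> MS (tilt f))"
    unfolding distr_tilt[OF f] by (rule absolutely_continuousI_density) measurable
  \<comment> \<open>The density is an exponential and vanishes nowhere, so a null set of the tilted
    law is a null set of \<open>\<Gamma>\<close>.\<close>
  show "absolutely_continuous (distr \<Gamma> MS (tilt f)) \<Gamma>"
    unfolding distr_tilt[OF f] absolutely_continuous_def
    by (auto simp: null_sets_density_iff AE_iff_null_sets elim!: AE_I')
qed (rule distr_tilt)

end

section \<open>Cylinder functions and variational derivatives\<close>

lemma tendsto_coordinatewise:
  fixes f :: "'b \<Rightarrow> 'i \<Rightarrow> 'c::topological_space"
  assumes "\<And>i. ((\<lambda>x. f x i) \<longlongrightarrow> l i) F"
  shows "(f \<longlongrightarrow> l) F"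
proof -
  have "limitin (product_topology (\<lambda>i. euclidean) UNIV) f l F"
    using assms by (subst limitin_componentwise) auto
  then show ?thesis by (simp add: euclidean_product_topology)
qed

text \<open>Along a curve neither the order nor the distinctness of the two points is known; the
  bound on the distance of \<open>z\<close> from \<open>x\<close> is all that the later limit
  argument uses.\<close>

lemma MVT_unordered:
  fixes f :: "real \<Rightarrow> real"
  assumes "\<And>x. (f has_real_derivative f' x) (at x)"
  shows "\<exists>z. \<bar>z - x\<bar> \<le> \<bar>y - x\<bar> \<and> f y - f x = f' z * (y - x)"
proof (cases x y rule: linorder_cases)
  case less
  then obtain z where "x < z" "z < y" "f y - f x = (y - x) * f' z"
    using MVT2[of x y f f'] assms by auto
  then show ?thesis by (intro exI[of _ z]) (auto simp: mult.commute)
next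
  case greater
  then obtain z where "y < z" "z < x" "f x - f y = (x - y) * f' z"
    using MVT2[of y x f f'] assms by auto
  then show ?thesis by (intro exI[of _ z]) (auto simp: algebra_simps)
qed auto

text \<open>The increment is telescoped coordinate by coordinate; each summand is handled by the
  mean value theorem and continuity of the partial derivative.\<close>

lemma has_real_derivative_partials:
  fixes \<phi> :: "(nat \<Rightarrow> real) \<Rightarrow> real"
  assumes cont: "\<And>i. i < n \<Longrightarrow> continuous_on UNIV (D i)"
    and der: "\<And>i x. i < n \<Longrightarrow> ((\<lambda>t. \<phi> (x(i := t))) has_real_derivative D i x) (at (x i))"
    and curve: "\<And>i. i < n \<Longrightarrow> ((\<lambda>t. c t i) has_real_derivative c' i) (at t0 within T)"
    and const: "\<And>i t. n \<le> i \<Longrightarrow> c t i = c t0 i"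
  shows "((\<lambda>t. \<phi> (c t)) has_real_derivative (\<Sum>i<n. D i (c t0) * c' i)) (at t0 within T)"
proof -
  \<comment> \<open>\<open>mix k t\<close> has its first \<open>k\<close> coordinates at time
    \<open>t\<close> and the others still at time \<open>t0\<close>, so consecutive mixtures differ
    at most in coordinate \<open>k\<close>.\<close>
  define mix where "mix k t = (\<lambda>i. if i < k then c t i else c t0 i)" for k t
  have mix0: "mix 0 t = c t0" and mixn: "mix n t = c t" for t
    using const[of _ t] by (auto simp: mix_def fun_eq_iff not_less)
  have tele: "\<phi> (c t) = \<phi> (c t0) + (\<Sum>k<n. \<phi> (mix (Suc k) t) - \<phi> (mix k t))" for t
    using sum_lessThan_telescope[of "\<lambda>k. \<phi> (mix k t)" n] by (simp add: mix0 mixn)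
  have "((\<lambda>t. \<phi> (mix (Suc k) t) - \<phi> (mix k t)) has_real_derivative D k (c t0) * c' k) (at t0 within T)"
    if k: "k < n" for k
  proof -
    have tend_c: "((\<lambda>t. c t i) \<longlongrightarrow> c t0 i) (at t0 within T)" for i
    proof (cases "i < n")
      case True
      then show ?thesis using DERIV_continuous[OF curve[OF True]] by (simp add: continuous_within)
    next
      case False
      then have "(\<lambda>t. c t i) = (\<lambda>t. c t0 i)" by (intro ext const) simp
      then show ?thesis by simp
    qed
    have "\<exists>z. \<bar>z - c t0 k\<bar> \<le> \<bar>c t k - c t0 k\<bar> \<and>
        \<phi> (mix (Suc k) t) - \<phi> (mix k t) = D k ((mix k t)(k := z)) * (c t k - c t0 k)" for t
    proof -
      have "((\<lambda>u. \<phi> ((mix k t)(k := u))) has_real_derivative D k ((mix k t)(k := z))) (at z)" for z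
        using der[OF k, of "(mix k t)(k := z)"] by simp
      from MVT_unordered[OF this, of "c t0 k" "c t k"]
      obtain z where "\<bar>z - c t0 k\<bar> \<le> \<bar>c t k - c t0 k\<bar>"
        "\<phi> ((mix k t)(k := c t k)) - \<phi> ((mix k t)(k := c t0 k)) = D k ((mix k t)(k := z)) * (c t k - c t0 k)"
        by blast
      moreover have "(mix k t)(k := c t k) = mix (Suc k) t" "(mix k t)(k := c t0 k) = mix k t"
        by (auto simp: mix_def fun_eq_iff)
      ultimately show ?thesis by auto
    qed
    then obtain z where z: "\<And>t. \<bar>z t - c t0 k\<bar> \<le> \<bar>c t k - c t0 k\<bar>"
      "\<And>t. \<phi> (mix (Suc k) t) - \<phi> (mix k t) = D k ((mix k t)(k := z t)) * (c t k - c t0 k)"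
      by metis
    have "((\<lambda>t. \<bar>c t k - c t0 k\<bar>) \<longlongrightarrow> \<bar>c t0 k - c t0 k\<bar>) (at t0 within T)"
      by (intro tendsto_intros tend_c)
    then have "((\<lambda>t. z t - c t0 k) \<longlongrightarrow> 0) (at t0 within T)"
      by (intro Lim_null_comparison[of "\<lambda>t. z t - c t0 k" "\<lambda>t. \<bar>c t k - c t0 k\<bar>"]) (use z(1) in auto)
    then have tend_z: "(z \<longlongrightarrow> c t0 k) (at t0 within T)" by (simp add: LIM_zero_iff)
    have "((\<lambda>t. (mix k t)(k := z t)) \<longlongrightarrow> c t0) (at t0 within T)"
    proof (rule tendsto_coordinatewise)
      fix i
      show "((\<lambda>t. ((mix k t)(k := z t)) i) \<longlongrightarrow> c t0 i) (at t0 within T)"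
        using tend_z tend_c[of i] by (cases "i = k"; cases "i < k") (auto simp: mix_def)
    qed
    moreover have "isCont (D k) (c t0)" using cont[OF k] by (simp add: continuous_on_eq_continuous_at)
    ultimately have "((\<lambda>t. D k ((mix k t)(k := z t))) \<longlongrightarrow> D k (c t0)) (at t0 within T)"
      by (rule isCont_tendsto_compose[rotated])
    moreover have "((\<lambda>t. (c t k - c t0 k) / (t - t0)) \<longlongrightarrow> c' k) (at t0 within T)"
      using curve[OF k] by (simp add: has_field_derivative_iff)
    ultimately have "((\<lambda>t. D k ((mix k t)(k := z t)) * ((c t k - c t0 k) / (t - t0))) \<longlongrightarrow> D k (c t0) * c' k) (at t0 within T)"
      by (rule tendsto_mult)
    moreover have "mix (Suc k) t0 = mix k t0" by (auto simp: mix_def fun_eq_iff)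
    ultimately show ?thesis by (simp add: has_field_derivative_iff z(2))
  qed
  then have "((\<lambda>t. \<phi> (c t0) + (\<Sum>k<n. \<phi> (mix (Suc k) t) - \<phi> (mix k t))) has_real_derivative
      0 + (\<Sum>k<n. D k (c t0) * c' k)) (at t0 within T)"
    by (intro DERIV_add DERIV_const DERIV_sum) auto
  then show ?thesis by (simp add: tele[symmetric])
qed

definition evals :: "nat \<Rightarrow> (nat \<Rightarrow> 'a::metric_space \<Rightarrow> real) \<Rightarrow> 'a measure \<Rightarrow> nat \<Rightarrow> real" where
  "evals n f \<mu> = (\<lambda>i. if i < n then (\<integral>s. f i s \<partial>\<mu>) else 0)"

definition trunc :: "nat \<Rightarrow> (nat \<Rightarrow> real) \<Rightarrow> nat \<Rightarrow> real" where
  "trunc n x = (\<lambda>i. if i < n then x i else 0)"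

lemma trunc_evals [simp]: "trunc n (evals n f \<mu>) = evals n f \<mu>"
  by (auto simp: trunc_def evals_def)

lemma continuous_on_trunc:
  assumes "continuous_map (Euclidean_space n) euclideanreal \<phi>"
  shows "continuous_on UNIV (\<lambda>x. \<phi> (trunc n x))"
proof -
  have "continuous_on UNIV (\<lambda>x::nat \<Rightarrow> real. trunc n x i)" for i
    by (cases "i < n") (auto simp: trunc_def)
  then have "continuous_on UNIV (trunc n)"
    by (rule continuous_on_coordinatewise_then_product)
  then have "continuous_map euclidean (Euclidean_space n) (trunc n)"
    unfolding Euclidean_space_def continuous_map_in_subtopology euclidean_product_topology
    by (auto simp: trunc_def)
  from continuous_map_compose[OF this assms] show ?thesis
    by (simp add: o_def)
qed

text \<open>Every member of the domain is represented by a function of all coordinates, which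
  avoids working on the subspace of sequences vanishing from index n on.\<close>

lemma gen_domainE:
  assumes "F \<in> gen_domain"
  obtains n :: nat and f :: "nat \<Rightarrow> 'a::metric_space \<Rightarrow> real" and \<phi> D1 D2 where
    "\<And>i. i < n \<Longrightarrow> f i \<in> bounded_measurable"
    "\<And>\<mu>. \<mu> \<in> finite_measures \<Longrightarrow> F \<mu> = \<phi> (evals n f \<mu>)"
    "continuous_on UNIV \<phi>" "\<And>i. i < n \<Longrightarrow> continuous_on UNIV (D1 i)"
    "\<And>i j. i < n \<Longrightarrow> j < n \<Longrightarrow> continuous_on UNIV (D2 i j)"
    "\<And>i x. i < n \<Longrightarrow> ((\<lambda>t. \<phi> (x(i := t))) has_real_derivative D1 i x) (at (x i))"
    "\<And>i j x. i < n \<Longrightarrow> j < n \<Longrightarrow> ((\<lambda>t. D1 i (x(j := t))) has_real_derivative D2 i j x) (at (x j))"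
proof -
  obtain n f \<phi> where f: "\<forall>i<n. f i \<in> bounded_measurable" and C2: "C2 n \<phi>"
    and F: "\<forall>\<mu> \<in> finite_measures. F \<mu> = \<phi> (\<lambda>i. if i < n then (\<integral>s. f i s \<partial>\<mu>) else 0)"
    using assms unfolding gen_domain_def by blast
  obtain D1 D2 where D: "\<forall>i<n.
        continuous_map (Euclidean_space n) euclideanreal (D1 i) \<and>
        (\<forall>x \<in> topspace (Euclidean_space n).
           ((\<lambda>t. \<phi> (x(i := t))) has_real_derivative D1 i x) (at (x i))) \<and>
        (\<forall>j<n.
           continuous_map (Euclidean_space n) euclideanreal (D2 i j) \<and>
           (\<forall>x \<in> topspace (Euclidean_space n).
              ((\<lambda>t. D1 i (x(j := t))) has_real_derivative D2 i j x) (at (x j))))"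
    using C2 unfolding C2_def by blast
  have tr: "trunc n x \<in> topspace (Euclidean_space n)" for x
    by (simp add: topspace_Euclidean_space trunc_def)
  have upd: "trunc n (x(i := t)) = (trunc n x)(i := t)" "trunc n x i = x i" if "i < n" for x i t
    using that by (auto simp: trunc_def fun_eq_iff)
  have d1: "((\<lambda>t. \<phi> (y(i := t))) has_real_derivative D1 i y) (at (y i))"
    if "i < n" "y \<in> topspace (Euclidean_space n)" for i y using D that by blast
  have d2: "((\<lambda>t. D1 i (y(j := t))) has_real_derivative D2 i j y) (at (y j))"
    if "i < n" "j < n" "y \<in> topspace (Euclidean_space n)" for i j y using D that by blast
  show thesis
  proof (rule that[of n f "\<lambda>x. \<phi> (trunc n x)" "\<lambda>i x. D1 i (trunc n x)" "\<lambda>i j x. D2 i j (trunc n x)"])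
    show "f i \<in> bounded_measurable" if "i < n" for i using f that by simp
    show "F \<mu> = \<phi> (trunc n (evals n f \<mu>))" if "\<mu> \<in> finite_measures" for \<mu>
      using F that unfolding trunc_evals by (simp add: evals_def)
    show "continuous_on UNIV (\<lambda>x. \<phi> (trunc n x))"
      using C2 by (intro continuous_on_trunc) (simp add: C2_def)
    show "continuous_on UNIV (\<lambda>x. D1 i (trunc n x))" if "i < n" for i
      using D that by (intro continuous_on_trunc) simp
    show "continuous_on UNIV (\<lambda>x. D2 i j (trunc n x))" if "i < n" "j < n" for i j
      using D that by (intro continuous_on_trunc) simp
    show "((\<lambda>t. \<phi> (trunc n (x(i := t)))) has_real_derivative D1 i (trunc n x)) (at (x i))" if "i < n" for i x
      using d1[OF that tr[of x]] that by (simp add: upd)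
    show "((\<lambda>t. D1 i (trunc n (x(j := t)))) has_real_derivative D2 i j (trunc n x)) (at (x j))"
      if "i < n" "j < n" for i j x
      using d2[OF that tr[of x]] that by (simp add: upd)
  qed
qed

text \<open>\<open>measure_of\<close> returns the prescribed set function only once countable
  additivity is shown. The integral formula is proved for nonnegative functions by induction from
  indicators and passes to bounded ones by adding a constant.\<close>

lemma add_dirac:
  assumes \<mu>: "\<mu> \<in> finite_measures" and \<epsilon>: "0 \<le> \<epsilon>"
  shows "add_dirac \<mu> \<epsilon> s \<in> finite_measures"
    and "f \<in> bounded_measurable \<Longrightarrow> (\<integral>x. f x \<partial>(add_dirac \<mu> \<epsilon> s)) = (\<integral>x. f x \<partial>\<mu>) + \<epsilon> * f s"
proof -
  interpret finite_measure \<mu> using finite_measuresD[OF \<mu>] by auto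
  let ?\<nu> = "add_dirac \<mu> \<epsilon> s"
  have sets: "sets ?\<nu> = sets borel"
    unfolding add_dirac_def using sets.sets_measure_of_eq[of borel] by simp
  have em: "emeasure ?\<nu> A = emeasure \<mu> A + ennreal \<epsilon> * indicator A s" if "A \<in> sets borel" for A
    unfolding add_dirac_def
  proof (rule emeasure_measure_of_sigma)
    show "sigma_algebra UNIV (sets borel)" using sets.sigma_algebra_axioms[of borel] by simp
    show "positive (sets borel) (\<lambda>A. emeasure \<mu> A + ennreal \<epsilon> * indicator A s)"
      by (simp add: positive_def)
    show "countably_additive (sets borel) (\<lambda>A. emeasure \<mu> A + ennreal \<epsilon> * indicator A s)"
    proof (rule countably_additiveI)
      fix A :: "nat \<Rightarrow> 'a set"
      assume A: "range A \<subseteq> sets borel" "disjoint_family A" "(\<Union>i. A i) \<in> sets borel"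
      have "(\<Sum>i. emeasure \<mu> (A i) + ennreal \<epsilon> * indicator (A i) s) =
          (\<Sum>i. emeasure \<mu> (A i)) + ennreal \<epsilon> * (\<Sum>i. indicator (A i) s)"
        by (simp add: suminf_add[symmetric])
      then show "(\<Sum>i. emeasure \<mu> (A i) + ennreal \<epsilon> * indicator (A i) s) =
          emeasure \<mu> (\<Union> (range A)) + ennreal \<epsilon> * indicator (\<Union> (range A)) s"
        using A finite_measuresD(1)[OF \<mu>] by (simp add: suminf_emeasure suminf_indicator)
    qed
  qed (use that in auto)
  have "emeasure ?\<nu> (space ?\<nu>) \<noteq> \<infinity>"
    using sets_eq_imp_space_eq[OF sets] em[of UNIV] emeasure_finite[of UNIV] by (simp del: emeasure_finite)
  then show \<nu>: "?\<nu> \<in> finite_measures" by (simp add: finite_measures_def sets finite_measureI)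
  have nn: "(\<integral>\<^sup>+x. g x \<partial>?\<nu>) = (\<integral>\<^sup>+x. g x \<partial>\<mu>) + ennreal \<epsilon> * g s"
    if "g \<in> borel_measurable borel" for g :: "'a \<Rightarrow> ennreal"
    using that
  proof (induction rule: borel_measurable_induct)
    case (cong f g)
    then have "f = g" by auto
    then show ?case using cong by simp
  next
    case (set A)
    then show ?case using em finite_measuresD(1)[OF \<mu>] sets by simp
  next
    case (mult u c)
    then show ?case
      using \<mu> \<nu> by (simp add: nn_integral_cmult measurable_finite_measures distrib_left mult_ac)
  next
    case (add u v)
    then show ?case
      using \<mu> \<nu> by (simp add: nn_integral_add measurable_finite_measures distrib_left add_ac)
  next
    case (seq U)
    have "(\<integral>\<^sup>+x. (SUP i. U i x) \<partial>?\<nu>) = (SUP i. \<integral>\<^sup>+x. U i x \<partial>?\<nu>)"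
      using seq \<nu> by (intro nn_integral_monotone_convergence_SUP) (auto simp: measurable_finite_measures)
    also have "\<dots> = (SUP i. (\<integral>\<^sup>+x. U i x \<partial>\<mu>) + ennreal \<epsilon> * U i s)" using seq by simp
    also have "\<dots> = (SUP i. \<integral>\<^sup>+x. U i x \<partial>\<mu>) + (SUP i. ennreal \<epsilon> * U i s)"
      using seq(3) by (intro ennreal_SUP_add)
        (auto simp: incseq_def le_fun_def intro!: nn_integral_mono mult_left_mono)
    also have "\<dots> = (\<integral>\<^sup>+x. (SUP i. U i x) \<partial>\<mu>) + ennreal \<epsilon> * (SUP i. U i s)"
      using seq \<mu> by (simp add: nn_integral_monotone_convergence_SUP measurable_finite_measures SUP_mult_left_ennreal)
    finally show ?case by (simp add: image_image)
  qed
  show "(\<integral>x. f x \<partial>?\<nu>) = (\<integral>x. f x \<partial>\<mu>) + \<epsilon> * f s" if f: "f \<in> bounded_measurable"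
  proof -
    obtain B where B: "\<And>x. \<bar>f x\<bar> \<le> B" using bounded_measurableD[OF f] by auto
    have eq: "(\<integral>x. g x \<partial>?\<nu>) = (\<integral>x. g x \<partial>\<mu>) + \<epsilon> * g s"
      if g: "g \<in> bounded_measurable" "\<And>x. 0 \<le> g x" for g
    proof -
      have "ennreal (\<integral>x. g x \<partial>?\<nu>) = (\<integral>\<^sup>+x. ennreal (g x) \<partial>?\<nu>)"
        using g \<nu> by (intro nn_integral_eq_integral[symmetric] integrable_bounded_measurable) auto
      also have "\<dots> = (\<integral>\<^sup>+x. ennreal (g x) \<partial>\<mu>) + ennreal \<epsilon> * ennreal (g s)"
        using bounded_measurableD(1)[OF g(1)] by (intro nn) measurable
      also have "(\<integral>\<^sup>+x. ennreal (g x) \<partial>\<mu>) = ennreal (\<integral>x. g x \<partial>\<mu>)"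
        using g \<mu> by (intro nn_integral_eq_integral integrable_bounded_measurable) auto
      also have "\<dots> + ennreal \<epsilon> * ennreal (g s) = ennreal ((\<integral>x. g x \<partial>\<mu>) + \<epsilon> * g s)"
        using g(2) \<epsilon> Bochner_Integration.integral_nonneg[of \<mu> g] by (simp add: ennreal_mult)
      finally show ?thesis using g(2) \<epsilon> by (simp del: ennreal_plus add: Bochner_Integration.integral_nonneg)
    qed
    have "0 \<le> f x + B" for x using B[of x] by linarith
    then have "(\<integral>x. f x + B \<partial>?\<nu>) - (\<integral>x. B \<partial>?\<nu>) = (\<integral>x. f x + B \<partial>\<mu>) - (\<integral>x. B \<partial>\<mu>) + \<epsilon> * f s"
      using eq[OF bounded_measurable_add[OF f bounded_measurable_const], of B]
        eq[OF bounded_measurable_const, of B] B[of s] by (simp add: distrib_left)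
    then show ?thesis using f \<mu> \<nu>
      by (simp add: Bochner_Integration.integral_add integrable_bounded_measurable)
  qed
qed

text \<open>Adding a point mass at \<open>s\<close> moves the evaluations along a straight line with
  velocity \<open>f i s\<close>, so the limit is a chain rule. The increments stay in
  \<open>finite_measures\<close>, where the representation of \<open>F\<close> is valid. The lemma
  serves both orders of differentiation: for the second one, \<open>F\<close> is a first variational
  derivative at a fixed point.\<close>

lemma vderiv_evals:
  assumes f: "\<And>i. i < n \<Longrightarrow> f i \<in> bounded_measurable"
    and F: "\<And>\<mu>. \<mu> \<in> finite_measures \<Longrightarrow> F \<mu> = \<phi> (evals n f \<mu>)"
    and cont: "\<And>i. i < n \<Longrightarrow> continuous_on UNIV (D i)"
    and der: "\<And>i x. i < n \<Longrightarrow> ((\<lambda>t. \<phi> (x(i := t))) has_real_derivative D i x) (at (x i))"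
    and \<mu>: "\<mu> \<in> finite_measures"
  shows "vderiv F \<mu> s = (\<Sum>i<n. D i (evals n f \<mu>) * f i s)"
proof -
  define c where "c t = (\<lambda>i. if i < n then (\<integral>x. f i x \<partial>\<mu>) + t * f i s else 0)" for t
  have c0: "c 0 = evals n f \<mu>" by (auto simp: c_def evals_def fun_eq_iff)
  have c: "F (add_dirac \<mu> t s) = \<phi> (c t)" if "0 \<le> t" for t
  proof -
    have "evals n f (add_dirac \<mu> t s) = c t"
      using f \<mu> that by (auto simp: evals_def c_def add_dirac(2))
    then show ?thesis using F[OF add_dirac(1)[OF \<mu> that]] by simp
  qed
  have "((\<lambda>t. \<phi> (c t)) has_real_derivative (\<Sum>i<n. D i (c 0) * f i s)) (at 0 within {0<..})"
    by (rule has_real_derivative_partials[OF cont der])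
      (auto simp: c_def intro!: derivative_eq_intros)
  then have "((\<lambda>t. (\<phi> (c t) - \<phi> (c 0)) / t) \<longlongrightarrow> (\<Sum>i<n. D i (c 0) * f i s)) (at_right 0)"
    by (simp add: has_field_derivative_iff)
  then have "((\<lambda>t. (F (add_dirac \<mu> t s) - F \<mu>) / t) \<longlongrightarrow> (\<Sum>i<n. D i (c 0) * f i s)) (at_right 0)"
  proof (rule Lim_transform_eventually)
    show "\<forall>\<^sub>F t in at_right 0. (\<phi> (c t) - \<phi> (c 0)) / t = (F (add_dirac \<mu> t s) - F \<mu>) / t"
      unfolding eventually_at_filter using c c0 F[OF \<mu>] by (auto intro!: always_eventually)
  qed
  then show ?thesis unfolding vderiv_def c0 by (rule tendsto_Lim[rotated]) simp
qed

section \<open>Differentiation along the flow of tilts\<close>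

lemmas bounded_measurable_intros = bounded_measurable_const bounded_measurable_add
  bounded_measurable_diff bounded_measurable_minus bounded_measurable_mult bounded_measurable_exp

text \<open>By the mean value theorem the difference quotients inherit the bound on the derivative,
  and dominated convergence applies. The bound is asked for within distance 1 of \<open>t0\<close>
  only, because the integrands in use grow exponentially in \<open>t\<close>.\<close>

lemma DERIV_integral:
  fixes u u' :: "real \<Rightarrow> 'b \<Rightarrow> real"
  assumes M: "finite_measure M"
    and int: "\<And>t. integrable M (u t)" and meas: "u' t0 \<in> borel_measurable M"
    and der: "\<And>x t. x \<in> space M \<Longrightarrow> ((\<lambda>t. u t x) has_real_derivative u' t x) (at t)"
    and bound: "\<And>x t. x \<in> space M \<Longrightarrow> \<bar>t - t0\<bar> < 1 \<Longrightarrow> \<bar>u' t x\<bar> \<le> C"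
  shows "((\<lambda>t. \<integral>x. u t x \<partial>M) has_real_derivative (\<integral>x. u' t0 x \<partial>M)) (at t0)"
  unfolding has_field_derivative_iff tendsto_at_iff_sequentially
proof (intro allI impI)
  fix X :: "nat \<Rightarrow> real"
  assume X: "\<forall>i. X i \<in> UNIV - {t0}" "X \<longlonglongrightarrow> t0"
  define q where "q i x = (u (X i) x - u t0 x) / (X i - t0)" for i x
  have "\<forall>\<^sub>F i in sequentially. dist (X i) t0 < 1" using X(2) by (rule tendstoD) simp
  then obtain N where N: "\<And>i. i \<ge> N \<Longrightarrow> \<bar>X i - t0\<bar> < 1"
    by (auto simp: eventually_sequentially dist_real_def)
  have "(\<lambda>i. \<integral>x. q (i + N) x \<partial>M) \<longlonglongrightarrow> (\<integral>x. u' t0 x \<partial>M)"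
  proof (rule integral_dominated_convergence[where w = "\<lambda>_. C"])
    show "u' t0 \<in> borel_measurable M" by fact
    show "q (i + N) \<in> borel_measurable M" for i
      unfolding q_def using borel_measurable_integrable[OF int] by measurable
    show "integrable M (\<lambda>_. C)" using M by (rule finite_measure.integrable_const)
    show "AE x in M. (\<lambda>i. q (i + N) x) \<longlonglongrightarrow> u' t0 x"
    proof (rule AE_I2)
      fix x assume "x \<in> space M"
      from der[OF this, of t0] X have "((\<lambda>t. (u t x - u t0 x) / (t - t0)) \<circ> X) \<longlonglongrightarrow> u' t0 x"
        unfolding has_field_derivative_iff tendsto_at_iff_sequentially by blast
      then have "(\<lambda>i. q i x) \<longlonglongrightarrow> u' t0 x" by (simp add: q_def o_def)
      then show "(\<lambda>i. q (i + N) x) \<longlonglongrightarrow> u' t0 x" by (rule LIMSEQ_ignore_initial_segment)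
    qed
    show "AE x in M. norm (q (i + N) x) \<le> C" for i
    proof (rule AE_I2)
      fix x assume x: "x \<in> space M"
      from MVT_unordered[OF der[OF x], of t0 "X (i + N)"]
      obtain z where z: "\<bar>z - t0\<bar> \<le> \<bar>X (i + N) - t0\<bar>" "u (X (i + N)) x - u t0 x = u' z x * (X (i + N) - t0)"
        by blast
      have "\<bar>z - t0\<bar> < 1" using z(1) N[of "i + N"] by simp
      then show "norm (q (i + N) x) \<le> C" using X(1) bound[OF x] z(2) by (simp add: q_def)
    qed
  qed
  then have "(\<lambda>i. \<integral>x. q i x \<partial>M) \<longlonglongrightarrow> (\<integral>x. u' t0 x \<partial>M)" by (rule LIMSEQ_offset)
  moreover have "(\<integral>x. q i x \<partial>M) = ((\<integral>x. u (X i) x \<partial>M) - (\<integral>x. u t0 x \<partial>M)) / (X i - t0)" for i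
    using int by (simp add: q_def)
  ultimately show "((\<lambda>t. ((\<integral>x. u t x \<partial>M) - (\<integral>x. u t0 x \<partial>M)) / (t - t0)) \<circ> X) \<longlonglongrightarrow> (\<integral>x. u' t0 x \<partial>M)"
    by (simp add: o_def)
qed

text \<open>Since the derivative is again an evaluation of the tilted measure, differentiation along
  the flow acts as a first order operator on functionals; \<open>flow_C1\<close> records exactly
  this.\<close>

lemma DERIV_integral_tilt:
  assumes g: "g \<in> bounded_measurable" and h: "h \<in> bounded_measurable" and \<mu>: "\<mu> \<in> finite_measures"
  shows "((\<lambda>t. \<integral>s. h s \<partial>(tilt (\<lambda>s. t * g s) \<mu>)) has_real_derivative
    (\<integral>s. g s * h s \<partial>(tilt (\<lambda>s. t * g s) \<mu>))) (at t)"
proof -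
  have tg: "(\<lambda>s. t * g s) \<in> bounded_measurable" for t by (intro bounded_measurable_intros g)
  have gh: "(\<lambda>s. g s * h s) \<in> bounded_measurable" by (intro bounded_measurable_intros g h)
  obtain A where A: "A > 0" "\<And>s. \<bar>g s\<bar> \<le> A" using bounded_measurableD[OF g] by auto
  obtain B where B: "B > 0" "\<And>s. \<bar>g s * h s\<bar> \<le> B" using bounded_measurableD(2)[OF gh] by blast
  have "((\<lambda>t. \<integral>s. exp (t * g s) * h s \<partial>\<mu>) has_real_derivative
      (\<integral>s. exp (t * g s) * (g s * h s) \<partial>\<mu>)) (at t)"
  proof (rule DERIV_integral[where C = "exp ((\<bar>t\<bar> + 1) * A) * B"])
    show "finite_measure \<mu>" using finite_measuresD[OF \<mu>] by simp
    show "integrable \<mu> (\<lambda>s. exp (t * g s) * h s)" for t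
      by (intro integrable_bounded_measurable[OF _ \<mu>] bounded_measurable_intros g h)
    show "(\<lambda>s. exp (t * g s) * (g s * h s)) \<in> borel_measurable \<mu>"
      using bounded_measurableD(1)[OF g] bounded_measurableD(1)[OF h] \<mu> by (simp add: measurable_finite_measures)
    show "((\<lambda>t. exp (t * g s) * h s) has_real_derivative exp (t * g s) * (g s * h s)) (at t)" for s t
      by (auto intro!: derivative_eq_intros)
    show "\<bar>exp (r * g s) * (g s * h s)\<bar> \<le> exp ((\<bar>t\<bar> + 1) * A) * B" if "\<bar>r - t\<bar> < 1" for s r
    proof -
      have "r * g s \<le> \<bar>r\<bar> * \<bar>g s\<bar>" by (metis abs_ge_self abs_mult)
      also have "\<dots> \<le> (\<bar>t\<bar> + 1) * A" using that A(2)[of s] by (intro mult_mono) auto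
      finally show ?thesis using B by (simp add: abs_mult mult_mono)
    qed
  qed
  then show ?thesis using g h gh tg \<mu> by (simp add: integral_tilt)
qed

text \<open>Functionals built from an arbitrary continuous function of evaluations admit no global
  bound. Continuity provides bounds on sets of bounded mass, and these become integrability after
  multiplication by a locally bounded functional that vanishes for large masses.\<close>

definition locally_bounded :: "('a::metric_space measure \<Rightarrow> real) \<Rightarrow> bool" where
  "locally_bounded F \<longleftrightarrow> F \<in> borel_measurable MS \<and>
     (\<forall>R. \<exists>C. \<forall>\<mu>\<in>finite_measures. measure \<mu> UNIV \<le> R \<longrightarrow> \<bar>F \<mu>\<bar> \<le> C)"

lemma locally_boundedD:
  assumes "locally_bounded F"
  shows "F \<in> borel_measurable MS"
    "\<exists>C\<ge>0. \<forall>\<mu>\<in>finite_measures. measure \<mu> UNIV \<le> R \<longrightarrow> \<bar>F \<mu>\<bar> \<le> C"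
proof -
  show "F \<in> borel_measurable MS" using assms by (simp add: locally_bounded_def)
  obtain C where "\<forall>\<mu>\<in>finite_measures. measure \<mu> UNIV \<le> R \<longrightarrow> \<bar>F \<mu>\<bar> \<le> C"
    using assms by (auto simp: locally_bounded_def)
  then show "\<exists>C\<ge>0. \<forall>\<mu>\<in>finite_measures. measure \<mu> UNIV \<le> R \<longrightarrow> \<bar>F \<mu>\<bar> \<le> C"
    by (intro exI[of _ "\<bar>C\<bar>"]) auto
qed

lemma locally_bounded_cong:
  assumes "\<And>\<mu>. \<mu> \<in> finite_measures \<Longrightarrow> F \<mu> = G \<mu>"
  shows "locally_bounded F \<longleftrightarrow> locally_bounded G"
  unfolding locally_bounded_def
  using assms measurable_cong[of MS F G borel] by auto

lemma locally_bounded_const [intro]: "locally_bounded (\<lambda>\<mu>. c)"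
  by (auto simp: locally_bounded_def)

lemma locally_bounded_add [intro]:
  assumes "locally_bounded F" "locally_bounded G"
  shows "locally_bounded (\<lambda>\<mu>. F \<mu> + G \<mu>)"
  unfolding locally_bounded_def
proof (intro conjI allI)
  show "(\<lambda>\<mu>. F \<mu> + G \<mu>) \<in> borel_measurable MS"
    using locally_boundedD(1)[OF assms(1)] locally_boundedD(1)[OF assms(2)] by measurable
  fix R
  obtain C where C: "\<forall>\<mu>\<in>finite_measures. measure \<mu> UNIV \<le> R \<longrightarrow> \<bar>F \<mu>\<bar> \<le> C"
    using locally_boundedD[OF assms(1)] by blast
  obtain D where D: "\<forall>\<mu>\<in>finite_measures. measure \<mu> UNIV \<le> R \<longrightarrow> \<bar>G \<mu>\<bar> \<le> D"
    using locally_boundedD[OF assms(2)] by blast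
  show "\<exists>C. \<forall>\<mu>\<in>finite_measures. measure \<mu> UNIV \<le> R \<longrightarrow> \<bar>F \<mu> + G \<mu>\<bar> \<le> C"
    using C D by (intro exI[of _ "C + D"]) (meson abs_triangle_ineq add_mono order_trans)
qed

lemma locally_bounded_mult [intro]:
  assumes "locally_bounded F" "locally_bounded G"
  shows "locally_bounded (\<lambda>\<mu>. F \<mu> * G \<mu>)"
  unfolding locally_bounded_def
proof (intro conjI allI)
  show "(\<lambda>\<mu>. F \<mu> * G \<mu>) \<in> borel_measurable MS"
    using locally_boundedD(1)[OF assms(1)] locally_boundedD(1)[OF assms(2)] by measurable
  fix R
  obtain C where C: "C \<ge> 0" "\<forall>\<mu>\<in>finite_measures. measure \<mu> UNIV \<le> R \<longrightarrow> \<bar>F \<mu>\<bar> \<le> C"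
    using locally_boundedD[OF assms(1)] by blast
  obtain D where D: "D \<ge> 0" "\<forall>\<mu>\<in>finite_measures. measure \<mu> UNIV \<le> R \<longrightarrow> \<bar>G \<mu>\<bar> \<le> D"
    using locally_boundedD[OF assms(2)] by blast
  show "\<exists>C. \<forall>\<mu>\<in>finite_measures. measure \<mu> UNIV \<le> R \<longrightarrow> \<bar>F \<mu> * G \<mu>\<bar> \<le> C"
    using C D by (intro exI[of _ "C * D"]) (auto simp: abs_mult intro!: mult_mono)
qed

lemma locally_bounded_sum [intro]:
  "(\<And>i. i \<in> I \<Longrightarrow> locally_bounded (F i)) \<Longrightarrow> locally_bounded (\<lambda>\<mu>. \<Sum>i\<in>I. F i \<mu>)"
  by (induction I rule: infinite_finite_induct) auto

lemma locally_bounded_integral [intro]: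
  assumes "h \<in> bounded_measurable"
  shows "locally_bounded (\<lambda>\<mu>. \<integral>s. h s \<partial>\<mu>)"
  unfolding locally_bounded_def
proof (intro conjI allI)
  show "(\<lambda>\<mu>. \<integral>s. h s \<partial>\<mu>) \<in> borel_measurable MS" by (rule measurable_integral_MS[OF assms])
  fix R
  obtain B where B: "B > 0" "\<And>s. \<bar>h s\<bar> \<le> B" using bounded_measurableD(2)[OF assms] by blast
  show "\<exists>C. \<forall>\<mu>\<in>finite_measures. measure \<mu> UNIV \<le> R \<longrightarrow> \<bar>\<integral>s. h s \<partial>\<mu>\<bar> \<le> C"
  proof (intro exI[of _ "B * R"] ballI impI)
    fix \<mu> :: "'a measure" assume \<mu>: "\<mu> \<in> finite_measures" "measure \<mu> UNIV \<le> R"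
    have "\<bar>\<integral>s. h s \<partial>\<mu>\<bar> \<le> B * measure \<mu> UNIV" by (rule integral_abs_le[OF assms \<mu>(1) B(2)])
    also have "\<dots> \<le> B * R" using \<mu>(2) B(1) by simp
    finally show "\<bar>\<integral>s. h s \<partial>\<mu>\<bar> \<le> B * R" .
  qed
qed

lemma locally_bounded_mass [intro]: "locally_bounded (\<lambda>\<mu> :: 'a::metric_space measure. measure \<mu> UNIV)"
proof -
  have "locally_bounded (\<lambda>\<mu> :: 'a measure. \<integral>s. 1 \<partial>\<mu>)" by (rule locally_bounded_integral) simp
  also have "?this \<longleftrightarrow> ?thesis" by (rule locally_bounded_cong) (simp add: finite_measuresD)
  finally show ?thesis .
qed

lemma locally_bounded_continuous:
  assumes F: "locally_bounded F" and \<rho>: "continuous_on UNIV (\<rho> :: real \<Rightarrow> real)"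
  shows "locally_bounded (\<lambda>\<mu>. \<rho> (F \<mu>))"
  unfolding locally_bounded_def
proof (intro conjI allI)
  show "(\<lambda>\<mu>. \<rho> (F \<mu>)) \<in> borel_measurable MS"
    using locally_boundedD(1)[OF F] borel_measurable_continuous_onI[OF \<rho>] by measurable
  fix R
  obtain C where C: "\<forall>\<mu>\<in>finite_measures. measure \<mu> UNIV \<le> R \<longrightarrow> \<bar>F \<mu>\<bar> \<le> C"
    using locally_boundedD[OF F] by blast
  have "bounded (\<rho> ` {-C..C})"
    by (intro compact_imp_bounded compact_continuous_image continuous_on_subset[OF \<rho>]) auto
  then obtain B where "\<forall>x\<in>{-C..C}. \<bar>\<rho> x\<bar> \<le> B" by (auto simp: bounded_iff)
  then show "\<exists>C. \<forall>\<mu>\<in>finite_measures. measure \<mu> UNIV \<le> R \<longrightarrow> \<bar>\<rho> (F \<mu>)\<bar> \<le> C"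
    using C by (intro exI[of _ B] ballI impI) (smt (verit) atLeastAtMost_iff)
qed

text \<open>On measures of mass at most \<open>R\<close> each evaluation stays in a compact
  interval. The product of these intervals over all coordinates is compact by Tychonoff, so a
  continuous function is bounded on it.\<close>

lemma locally_bounded_evals:
  assumes f: "\<And>i. i < n \<Longrightarrow> f i \<in> bounded_measurable" and \<phi>: "continuous_on UNIV \<phi>"
  shows "locally_bounded (\<lambda>\<mu>. \<phi> (evals n f \<mu>) :: real)"
  unfolding locally_bounded_def
proof (intro conjI allI)
  have lb: "locally_bounded (\<lambda>\<mu>. evals n f \<mu> i)" for i
    using f by (cases "i < n") (auto simp: evals_def)
  have "evals n f \<in> borel_measurable MS"
    using locally_boundedD(1)[OF lb] by (rule measurable_coordinatewise_then_product)
  then show "(\<lambda>\<mu>. \<phi> (evals n f \<mu>)) \<in> borel_measurable MS"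
    using borel_measurable_continuous_onI[OF \<phi>] by measurable
  fix R
  obtain C where C: "\<And>i. \<forall>\<mu>\<in>finite_measures. measure \<mu> UNIV \<le> R \<longrightarrow> \<bar>evals n f \<mu> i\<bar> \<le> C i"
    using locally_boundedD(2)[OF lb, where R = R] by metis
  have "compactin (product_topology (\<lambda>_. euclideanreal) UNIV) (PiE UNIV (\<lambda>i. {- C i..C i}))"
    by (subst compactin_PiE) auto
  then have "compact (PiE UNIV (\<lambda>i. {- C i..C i}))" by (simp add: euclidean_product_topology)
  then have "bounded (\<phi> ` PiE UNIV (\<lambda>i. {- C i..C i}))"
    by (intro compact_imp_bounded compact_continuous_image continuous_on_subset[OF \<phi>]) auto
  then obtain B where B: "\<forall>x\<in>PiE UNIV (\<lambda>i. {- C i..C i}). \<bar>\<phi> x\<bar> \<le> B" by (auto simp: bounded_iff)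
  have "evals n f \<mu> \<in> PiE UNIV (\<lambda>i. {- C i..C i})" if "\<mu> \<in> finite_measures" "measure \<mu> UNIV \<le> R" for \<mu>
    using C that by (intro PiE_I) (smt (verit) atLeastAtMost_iff UNIV_I)+
  then show "\<exists>C. \<forall>\<mu>\<in>finite_measures. measure \<mu> UNIV \<le> R \<longrightarrow> \<bar>\<phi> (evals n f \<mu>)\<bar> \<le> C"
    using B by blast
qed

text \<open>\<open>F'\<close> is the derivative of \<open>F\<close> along the vector field that
  multiplies a measure by \<open>g\<close> and generates the tilts. It is evaluated at the moving
  point, so a single functional describes the derivative at all times.\<close>

definition flow_C1 ::
  "('a::metric_space \<Rightarrow> real) \<Rightarrow> ('a measure \<Rightarrow> real) \<Rightarrow> ('a measure \<Rightarrow> real) \<Rightarrow> bool" where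
  "flow_C1 g F F' \<longleftrightarrow> locally_bounded F \<and> locally_bounded F' \<and>
     (\<forall>\<mu>\<in>finite_measures. \<forall>t. ((\<lambda>t. F (tilt (\<lambda>s. t * g s) \<mu>)) has_real_derivative
        F' (tilt (\<lambda>s. t * g s) \<mu>)) (at t))"

lemma flow_C1_cong:
  assumes g: "g \<in> bounded_measurable"
    and F: "\<And>\<mu>. \<mu> \<in> finite_measures \<Longrightarrow> F \<mu> = G \<mu>" and F': "\<And>\<mu>. \<mu> \<in> finite_measures \<Longrightarrow> F' \<mu> = G' \<mu>"
  shows "flow_C1 g F F' \<longleftrightarrow> flow_C1 g G G'"
proof -
  have "tilt (\<lambda>s. t * g s) \<mu> \<in> finite_measures" if "\<mu> \<in> finite_measures" for t \<mu>
    by (intro tilt_finite_measures bounded_measurable_intros g that)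
  then show ?thesis unfolding flow_C1_def
    using locally_bounded_cong[of F G, OF F] locally_bounded_cong[of F' G', OF F'] F F' by simp
qed

lemma flow_C1_mult:
  assumes F: "flow_C1 g F F'" and G: "flow_C1 g G G'"
  shows "flow_C1 g (\<lambda>\<mu>. F \<mu> * G \<mu>) (\<lambda>\<mu>. F' \<mu> * G \<mu> + F \<mu> * G' \<mu>)"
  unfolding flow_C1_def
proof (intro conjI ballI allI)
  show "locally_bounded (\<lambda>\<mu>. F \<mu> * G \<mu>)" "locally_bounded (\<lambda>\<mu>. F' \<mu> * G \<mu> + F \<mu> * G' \<mu>)"
    using F G by (auto simp: flow_C1_def)
  fix \<mu> :: "'a measure" and t assume \<mu>: "\<mu> \<in> finite_measures"
  let ?\<nu> = "\<lambda>t. tilt (\<lambda>s. t * g s) \<mu>"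
  have "((\<lambda>t. F (?\<nu> t) * G (?\<nu> t)) has_real_derivative F' (?\<nu> t) * G (?\<nu> t) + G' (?\<nu> t) * F (?\<nu> t)) (at t)"
    using F G \<mu> by (intro DERIV_mult) (auto simp: flow_C1_def)
  then show "((\<lambda>t. F (?\<nu> t) * G (?\<nu> t)) has_real_derivative F' (?\<nu> t) * G (?\<nu> t) + F (?\<nu> t) * G' (?\<nu> t)) (at t)"
    by (simp add: mult.commute)
qed

text \<open>The mass is continuous along the flow, so a measure of mass above \<open>R\<close> keeps
  such a mass for small times, during which the functional is zero. Derivatives thus inherit
  vanishing for large masses.\<close>

lemma flow_C1_vanish:
  assumes g: "g \<in> bounded_measurable" and H: "flow_C1 g H H'"
    and supp: "\<And>\<mu>. \<mu> \<in> finite_measures \<Longrightarrow> R \<le> measure \<mu> UNIV \<Longrightarrow> H \<mu> = 0"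
    and \<mu>: "\<mu> \<in> finite_measures" "R < measure \<mu> UNIV"
  shows "H' \<mu> = 0"
proof -
  let ?\<nu> = "\<lambda>t. tilt (\<lambda>s. t * g s) \<mu>"
  have \<nu>: "?\<nu> t \<in> finite_measures" for t by (intro tilt_finite_measures bounded_measurable_intros g \<mu>)
  have mass: "(\<integral>s. 1 \<partial>(?\<nu> t)) = measure (?\<nu> t) UNIV" for t using finite_measuresD(3)[OF \<nu>] by simp
  have "isCont (\<lambda>t. \<integral>s. (1 :: real) \<partial>(?\<nu> t)) 0"
    using DERIV_isCont[OF DERIV_integral_tilt[OF g bounded_measurable_const[of 1] \<mu>(1), of 0]] .
  then have "isCont (\<lambda>t. measure (?\<nu> t) UNIV) 0" unfolding mass .
  then have "((\<lambda>t. measure (?\<nu> t) UNIV) \<longlongrightarrow> measure (?\<nu> 0) UNIV) (nhds 0)"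
    unfolding isCont_def by (rule tendsto_at_iff_tendsto_nhds[of "\<lambda>t. measure (?\<nu> t) UNIV", THEN iffD1])
  then have "\<forall>\<^sub>F t in nhds 0. R < measure (?\<nu> t) UNIV"
    using \<mu>(2) by (intro order_tendstoD) auto
  then have ev: "\<forall>\<^sub>F t in nhds 0. H (?\<nu> t) = 0"
    by eventually_elim (use supp[OF \<nu>] in auto)
  have "((\<lambda>t. H (?\<nu> t)) has_real_derivative H' (?\<nu> 0)) (at 0)"
    using H \<mu>(1) unfolding flow_C1_def by blast
  then have "((\<lambda>t. 0) has_real_derivative H' (?\<nu> 0)) (at 0)"
    using DERIV_cong_ev[OF refl ev refl] by blast
  then show ?thesis using DERIV_unique[OF DERIV_const] by force
qed

definition gradient :: "('a::metric_space measure \<Rightarrow> real) \<Rightarrow> ('a measure \<Rightarrow> 'a \<Rightarrow> real) \<Rightarrow> bool" where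
  "gradient F DF \<longleftrightarrow> (\<forall>\<mu>\<in>finite_measures. DF \<mu> \<in> bounded_measurable) \<and>
     (\<forall>g\<in>bounded_measurable. flow_C1 g F (\<lambda>\<mu>. \<integral>s. g s * DF \<mu> s \<partial>\<mu>))"

lemma gradient_mult:
  assumes F: "gradient F DF" and G: "gradient G DG"
  shows "gradient (\<lambda>\<mu>. F \<mu> * G \<mu>) (\<lambda>\<mu> s. G \<mu> * DF \<mu> s + F \<mu> * DG \<mu> s)"
  unfolding gradient_def
proof (intro conjI ballI)
  show "(\<lambda>s. G \<mu> * DF \<mu> s + F \<mu> * DG \<mu> s) \<in> bounded_measurable" if "\<mu> \<in> finite_measures" for \<mu>
    using F G that by (intro bounded_measurable_intros) (auto simp: gradient_def)
  fix g :: "'a \<Rightarrow> real" assume g: "g \<in> bounded_measurable"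
  have "flow_C1 g (\<lambda>\<mu>. F \<mu> * G \<mu>) (\<lambda>\<mu>. (\<integral>s. g s * DF \<mu> s \<partial>\<mu>) * G \<mu> + F \<mu> * (\<integral>s. g s * DG \<mu> s \<partial>\<mu>))"
    using F G g by (intro flow_C1_mult) (auto simp: gradient_def)
  also have "?this \<longleftrightarrow> flow_C1 g (\<lambda>\<mu>. F \<mu> * G \<mu>) (\<lambda>\<mu>. \<integral>s. g s * (G \<mu> * DF \<mu> s + F \<mu> * DG \<mu> s) \<partial>\<mu>)"
  proof (rule flow_C1_cong[OF g refl])
    fix \<mu> :: "'a measure" assume \<mu>: "\<mu> \<in> finite_measures"
    then have "DF \<mu> \<in> bounded_measurable" "DG \<mu> \<in> bounded_measurable"
      using F G by (auto simp: gradient_def)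
    then have "integrable \<mu> (\<lambda>s. g s * DF \<mu> s)" "integrable \<mu> (\<lambda>s. g s * DG \<mu> s)"
      by (auto intro!: integrable_bounded_measurable[OF bounded_measurable_mult[OF g] \<mu>])
    then have "(\<integral>s. G \<mu> * (g s * DF \<mu> s) + F \<mu> * (g s * DG \<mu> s) \<partial>\<mu>) =
        (\<integral>s. g s * DF \<mu> s \<partial>\<mu>) * G \<mu> + F \<mu> * (\<integral>s. g s * DG \<mu> s \<partial>\<mu>)"
      by simp
    then show "(\<integral>s. g s * DF \<mu> s \<partial>\<mu>) * G \<mu> + F \<mu> * (\<integral>s. g s * DG \<mu> s \<partial>\<mu>) =
        (\<integral>s. g s * (G \<mu> * DF \<mu> s + F \<mu> * DG \<mu> s) \<partial>\<mu>)"
      by (simp add: algebra_simps)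
  qed
  finally show "flow_C1 g (\<lambda>\<mu>. F \<mu> * G \<mu>) (\<lambda>\<mu>. \<integral>s. g s * (G \<mu> * DF \<mu> s + F \<mu> * DG \<mu> s) \<partial>\<mu>)" .
qed

text \<open>Source of the gradients of the cutoffs: along the flow of \<open>g\<close> the mass has
  derivative \<open><mu, g>\<close>, so the chain rule gives a gradient that is constant in
  space.\<close>

lemma gradient_mass:
  assumes \<rho>: "\<And>x. (\<rho> has_real_derivative \<rho>' x) (at x)" and \<rho>': "continuous_on UNIV \<rho>'"
  shows "gradient (\<lambda>\<mu>. \<rho> (measure \<mu> UNIV)) (\<lambda>\<mu> s. \<rho>' (measure \<mu> UNIV))"
  unfolding gradient_def flow_C1_def
proof (intro conjI ballI allI)
  have "continuous_on UNIV \<rho>" by (intro continuous_at_imp_continuous_on ballI DERIV_isCont[OF \<rho>])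
  then show "locally_bounded (\<lambda>\<mu>. \<rho> (measure \<mu> UNIV))" by (rule locally_bounded_continuous[OF locally_bounded_mass])
  fix g :: "'a \<Rightarrow> real" assume g: "g \<in> bounded_measurable"
  have "locally_bounded (\<lambda>\<mu>. \<rho>' (measure \<mu> UNIV) * (\<integral>s. g s \<partial>\<mu>))"
    by (rule locally_bounded_mult[OF locally_bounded_continuous[OF locally_bounded_mass \<rho>']
        locally_bounded_integral[OF g]])
  then show "locally_bounded (\<lambda>\<mu>. \<integral>s. g s * \<rho>' (measure \<mu> UNIV) \<partial>\<mu>)" by (simp add: mult.commute)
  fix \<mu> :: "'a measure" and t assume \<mu>: "\<mu> \<in> finite_measures"
  let ?\<nu> = "\<lambda>t. tilt (\<lambda>s. t * g s) \<mu>"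
  have \<nu>: "?\<nu> t \<in> finite_measures" for t by (intro tilt_finite_measures bounded_measurable_intros g \<mu>)
  have mass: "measure (?\<nu> t) UNIV = (\<integral>s. 1 \<partial>(?\<nu> t))" for t using finite_measuresD(3)[OF \<nu>] by simp
  have "((\<lambda>t. \<rho> (\<integral>s. 1 \<partial>(?\<nu> t))) has_real_derivative \<rho>' (\<integral>s. 1 \<partial>(?\<nu> t)) * (\<integral>s. g s * 1 \<partial>(?\<nu> t))) (at t)"
    by (rule DERIV_chain2[OF \<rho> DERIV_integral_tilt[OF g _ \<mu>]]) simp
  then show "((\<lambda>t. \<rho> (measure (?\<nu> t) UNIV)) has_real_derivative (\<integral>s. g s * \<rho>' (measure (?\<nu> t) UNIV) \<partial>(?\<nu> t))) (at t)"
    unfolding mass by (simp add: mult.commute)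
qed simp

lemma flow_C1_evals:
  assumes f: "\<And>i. i < n \<Longrightarrow> f i \<in> bounded_measurable"
    and F: "\<And>\<mu>. \<mu> \<in> finite_measures \<Longrightarrow> F \<mu> = \<phi> (evals n f \<mu>)"
    and \<phi>: "continuous_on UNIV \<phi>" and cont: "\<And>i. i < n \<Longrightarrow> continuous_on UNIV (D i)"
    and der: "\<And>i x. i < n \<Longrightarrow> ((\<lambda>t. \<phi> (x(i := t))) has_real_derivative D i x) (at (x i))"
    and g: "g \<in> bounded_measurable"
  shows "flow_C1 g F (\<lambda>\<mu>. \<Sum>i<n. D i (evals n f \<mu>) * (\<integral>s. g s * f i s \<partial>\<mu>))"
proof -
  have "flow_C1 g (\<lambda>\<mu>. \<phi> (evals n f \<mu>)) (\<lambda>\<mu>. \<Sum>i<n. D i (evals n f \<mu>) * (\<integral>s. g s * f i s \<partial>\<mu>))"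
    unfolding flow_C1_def
  proof (intro conjI ballI allI)
    show "locally_bounded (\<lambda>\<mu>. \<phi> (evals n f \<mu>))" using f \<phi> by (rule locally_bounded_evals)
    show "locally_bounded (\<lambda>\<mu>. \<Sum>i<n. D i (evals n f \<mu>) * (\<integral>s. g s * f i s \<partial>\<mu>))"
      using f g cont
      by (intro locally_bounded_sum locally_bounded_mult locally_bounded_evals locally_bounded_integral) auto
    fix \<mu> :: "'a measure" and t assume \<mu>: "\<mu> \<in> finite_measures"
    show "((\<lambda>t. \<phi> (evals n f (tilt (\<lambda>s. t * g s) \<mu>))) has_real_derivative
      (\<Sum>i<n. D i (evals n f (tilt (\<lambda>s. t * g s) \<mu>)) * (\<integral>s. g s * f i s \<partial>(tilt (\<lambda>s. t * g s) \<mu>)))) (at t)"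
      by (rule has_real_derivative_partials[OF cont der])
        (use f g \<mu> in \<open>auto simp: evals_def intro!: DERIV_integral_tilt\<close>)
  qed
  then show ?thesis by (subst flow_C1_cong[OF g F refl])
qed

section \<open>Integration by parts for the Gamma law\<close>

context gamma_law
begin

lemma integrable_locally_bounded:
  assumes K: "locally_bounded K"
    and supp: "\<And>\<mu>. \<mu> \<in> finite_measures \<Longrightarrow> R < measure \<mu> UNIV \<Longrightarrow> K \<mu> = 0"
  shows "integrable \<Gamma> K"
proof -
  obtain C where C: "C \<ge> 0" "\<forall>\<mu>\<in>finite_measures. measure \<mu> UNIV \<le> R \<longrightarrow> \<bar>K \<mu>\<bar> \<le> C"
    using locally_boundedD(2)[OF K] by blast
  have "\<bar>K \<mu>\<bar> \<le> C" if "\<mu> \<in> finite_measures" for \<mu>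
    using C supp[OF that] that by (cases "measure \<mu> UNIV \<le> R") auto
  then show ?thesis
    using locally_boundedD(1)[OF K] by (intro integrable_const_bound[of _ C]) (auto cong: measurable_cong_sets)
qed

lemma integral_tilt_law:
  assumes f: "f \<in> bounded_measurable" and H: "H \<in> borel_measurable MS"
  shows "(\<integral>\<mu>. H (tilt f \<mu>) \<partial>\<Gamma>) = (\<integral>\<mu>. H \<mu> * exp (Lambda a b \<mu>\<^sub>0 \<mu> (\<lambda>s. - f s)) \<partial>\<Gamma>)"
proof -
  note [measurable] = measurable_tilt[OF compact_UNIV f] measurable_Lambda[OF bounded_measurable_minus[OF f]] H
  have "(\<integral>\<mu>. H (tilt f \<mu>) \<partial>\<Gamma>) = (\<integral>\<mu>. H \<mu> \<partial>(distr \<Gamma> MS (tilt f)))"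
    by (subst integral_distr) auto
  also have "\<dots> = (\<integral>\<mu>. H \<mu> * exp (Lambda a b \<mu>\<^sub>0 \<mu> (\<lambda>s. - f s)) \<partial>\<Gamma>)"
    unfolding distr_tilt[OF f] by (subst integral_density) (auto simp: mult.commute)
  finally show ?thesis .
qed

text \<open>Both sides of the quasi-invariance identity for \<open>t a g\<close> are differentiated at \<open>t = 0\<close>.\<close>

lemma integration_by_parts:
  assumes g: "g \<in> bounded_measurable" and H: "flow_C1 (\<lambda>s. a s * g s) H H'"
    and supp: "\<And>\<mu>. \<mu> \<in> finite_measures \<Longrightarrow> R \<le> measure \<mu> UNIV \<Longrightarrow> H \<mu> = 0" and R: "0 \<le> R"
  shows "(\<integral>\<mu>. H' \<mu> \<partial>\<Gamma>) = (\<integral>\<mu>. H \<mu> * ((\<integral>s. b s * g s \<partial>\<mu>) - (\<integral>s. g s \<partial>\<mu>\<^sub>0)) \<partial>\<Gamma>)"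
proof -
  let ?k = "\<lambda>s. a s * g s"
  define f where "f t = (\<lambda>s. t * ?k s)" for t
  have k: "?k \<in> bounded_measurable" using g by auto
  have f: "f t \<in> bounded_measurable" for t unfolding f_def using k by auto
  have nk: "(\<lambda>s. - ?k s) \<in> bounded_measurable" using k by auto
  have bg: "(\<lambda>s. b s * g s) \<in> bounded_measurable" using g by auto
  note [measurable] = measurable_tilt[OF compact_UNIV f]
  have lb: "locally_bounded H" "locally_bounded H'" using H by (auto simp: flow_C1_def)
  have [measurable]: "H \<in> borel_measurable MS" "H' \<in> borel_measurable MS" using lb locally_boundedD(1) by auto
  have supp': "H' \<mu> = 0" if "\<mu> \<in> finite_measures" "R < measure \<mu> UNIV" for \<mu>
    by (rule flow_C1_vanish[OF k H supp that])
  obtain C where C: "C \<ge> 0" "\<forall>\<mu>\<in>finite_measures. measure \<mu> UNIV \<le> R \<longrightarrow> \<bar>H \<mu>\<bar> \<le> C"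
    using locally_boundedD(2)[OF lb(1)] by blast
  obtain C' where C': "C' \<ge> 0" "\<forall>\<mu>\<in>finite_measures. measure \<mu> UNIV \<le> R \<longrightarrow> \<bar>H' \<mu>\<bar> \<le> C'"
    using locally_boundedD(2)[OF lb(2)] by blast
  have HC: "\<bar>H \<mu>\<bar> \<le> C" if "\<mu> \<in> finite_measures" for \<mu>
    using C supp[OF that] that by (cases "measure \<mu> UNIV \<le> R") auto
  have HC': "\<bar>H' \<mu>\<bar> \<le> C'" if "\<mu> \<in> finite_measures" for \<mu>
    using C' supp'[OF that] that by (cases "measure \<mu> UNIV \<le> R") auto
  define E where "E t \<mu> = exp (Lambda a b \<mu>\<^sub>0 \<mu> (\<lambda>s. - f t s))" for t \<mu>
  define e where "e t \<mu> = (\<integral>s. b s * g s \<partial>(tilt (\<lambda>s. - f t s) \<mu>)) - (\<integral>s. g s \<partial>\<mu>\<^sub>0)" for t \<mu>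
  \<comment> \<open>In this form \<open>t\<close> enters through a linear term and through an
    evaluation of a tilted measure, to which \<open>DERIV_integral_tilt\<close> applies.\<close>
  have \<Lambda>: "Lambda a b \<mu>\<^sub>0 \<mu> (\<lambda>s. - f t s) =
      - t * (\<integral>s. g s \<partial>\<mu>\<^sub>0) - (\<integral>s. b s / a s \<partial>(tilt (\<lambda>s. t * - ?k s) \<mu>)) + (\<integral>s. b s / a s \<partial>\<mu>)"
    if \<mu>: "\<mu> \<in> finite_measures" for t \<mu>
  proof -
    have 1: "(\<integral>s. - f t s / a s \<partial>\<mu>\<^sub>0) = - t * (\<integral>s. g s \<partial>\<mu>\<^sub>0)"
      by (simp add: f_def)
    have "(\<integral>s. (exp (- f t s) - 1) * (b s / a s) \<partial>\<mu>) = (\<integral>s. exp (- f t s) * (b s / a s) - b s / a s \<partial>\<mu>)"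
      by (intro Bochner_Integration.integral_cong) (auto simp: algebra_simps)
    also have "\<dots> = (\<integral>s. exp (- f t s) * (b s / a s) \<partial>\<mu>) - (\<integral>s. b s / a s \<partial>\<mu>)"
      using f \<mu> by (intro Bochner_Integration.integral_diff integrable_bounded_measurable
        bounded_measurable_mult bounded_measurable_exp bounded_measurable_minus bounded_measurable_coefficients)
    also have "(\<integral>s. exp (- f t s) * (b s / a s) \<partial>\<mu>) = (\<integral>s. b s / a s \<partial>(tilt (\<lambda>s. - f t s) \<mu>))"
      using f \<mu> by (subst integral_tilt) auto
    finally have 2: "(\<integral>s. (exp (- f t s) - 1) * (b s / a s) \<partial>\<mu>) =
      (\<integral>s. b s / a s \<partial>(tilt (\<lambda>s. - f t s) \<mu>)) - (\<integral>s. b s / a s \<partial>\<mu>)" .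
    have "(\<lambda>s. - f t s) = (\<lambda>s. t * - ?k s)" by (simp add: f_def)
    then show ?thesis unfolding Lambda_eq 1 2 by simp
  qed
  have E': "((\<lambda>t. E t \<mu>) has_real_derivative E t \<mu> * e t \<mu>) (at t)" if \<mu>: "\<mu> \<in> finite_measures" for t \<mu>
  proof -
    have "((\<lambda>t. - t * (\<integral>s. g s \<partial>\<mu>\<^sub>0) - (\<integral>s. b s / a s \<partial>(tilt (\<lambda>s. t * - ?k s) \<mu>)) + (\<integral>s. b s / a s \<partial>\<mu>))
      has_real_derivative - 1 * (\<integral>s. g s \<partial>\<mu>\<^sub>0) - (\<integral>s. - ?k s * (b s / a s) \<partial>(tilt (\<lambda>s. t * - ?k s) \<mu>)) + 0) (at t)"
      by (intro DERIV_add DERIV_diff DERIV_const DERIV_cmult_right DERIV_minus DERIV_ident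
        DERIV_integral_tilt[OF nk] \<mu> bounded_measurable_coefficients)
    \<comment> \<open>The factor \<open>a\<close> in the direction cancels against the weight
      \<open>b / a\<close> and leaves \<open>b * g\<close>.\<close>
    moreover have "- 1 * (\<integral>s. g s \<partial>\<mu>\<^sub>0) - (\<integral>s. - ?k s * (b s / a s) \<partial>(tilt (\<lambda>s. t * - ?k s) \<mu>)) + 0 = e t \<mu>"
      by (simp add: e_def f_def mult.commute)
    ultimately have "((\<lambda>t. Lambda a b \<mu>\<^sub>0 \<mu> (\<lambda>s. - f t s)) has_real_derivative e t \<mu>) (at t)"
      using \<mu> by (simp add: \<Lambda>)
    then show ?thesis unfolding E_def by (rule DERIV_fun_exp)
  qed
  obtain A where A: "A > 0" "\<And>s. \<bar>a s * g s\<bar> \<le> A" using bounded_measurableD(2)[OF k] by blast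
  obtain B1 where B1: "B1 > 0" "\<And>s. \<bar>b s / a s\<bar> \<le> B1"
    using bounded_measurableD(2)[OF bounded_measurable_coefficients(4)] by blast
  obtain B2 where B2: "B2 > 0" "\<And>s. \<bar>b s * g s\<bar> \<le> B2" using bounded_measurableD(2)[OF bg] by blast
  define m where "m = \<bar>\<integral>s. g s \<partial>\<mu>\<^sub>0\<bar>"
  \<comment> \<open>For masses at most \<open>R\<close> and times in (-1, 1) the first factor bounds
    \<open>E t \<mu>\<close> and the second its logarithmic derivative \<open>e t \<mu>\<close>;
    \<open>exp A\<close> bounds the density of the tilt at these times.\<close>
  define Q where "Q = exp (m + exp A * B1 * R + B1 * R) * (exp A * B2 * R + m)"
  have tilt_bound: "\<bar>\<integral>s. h s \<partial>(tilt (\<lambda>s. - f t s) \<mu>)\<bar> \<le> exp A * B * R"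
    if h: "h \<in> bounded_measurable" "\<And>s. \<bar>h s\<bar> \<le> B" and \<mu>: "\<mu> \<in> finite_measures" "measure \<mu> UNIV \<le> R"
      and t: "\<bar>t\<bar> < 1" for h B t \<mu>
  proof -
    have B0: "B \<ge> 0" using h(2)[of undefined] by linarith
    have "\<bar>\<integral>s. exp (- f t s) * h s \<partial>\<mu>\<bar> \<le> exp A * B * measure \<mu> UNIV"
    proof (rule integral_abs_le)
      show "(\<lambda>s. exp (- f t s) * h s) \<in> bounded_measurable"
        by (intro bounded_measurable_intros f h)
      fix s
      have "\<bar>f t s\<bar> \<le> 1 * A" unfolding f_def abs_mult[of t] using t A by (intro mult_mono) auto
      then have "exp (- f t s) \<le> exp A" by (simp add: abs_le_iff)
      then show "\<bar>exp (- f t s) * h s\<bar> \<le> exp A * B" using h(2)[of s] by (simp add: abs_mult mult_mono)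
    qed fact
    also have "\<dots> \<le> exp A * B * R" using \<mu>(2) B0 by (intro mult_left_mono) auto
    also have "(\<integral>s. exp (- f t s) * h s \<partial>\<mu>) = (\<integral>s. h s \<partial>(tilt (\<lambda>s. - f t s) \<mu>))"
      using f h \<mu> by (subst integral_tilt) auto
    finally show ?thesis .
  qed
  have D1: "((\<lambda>t. \<integral>\<mu>. H (tilt (f t) \<mu>) \<partial>\<Gamma>) has_real_derivative (\<integral>\<mu>. H' (tilt (f 0) \<mu>) \<partial>\<Gamma>)) (at 0)"
  proof (rule DERIV_integral[where C = C' and u' = "\<lambda>t \<mu>. H' (tilt (f t) \<mu>)"])
    show "finite_measure \<Gamma>" by unfold_locales
    show "integrable \<Gamma> (\<lambda>\<mu>. H (tilt (f t) \<mu>))" for t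
      using HC f by (intro integrable_const_bound[of _ C]) auto
    show "(\<lambda>\<mu>. H' (tilt (f 0) \<mu>)) \<in> borel_measurable \<Gamma>" by measurable
    show "((\<lambda>t. H (tilt (f t) \<mu>)) has_real_derivative H' (tilt (f t) \<mu>)) (at t)" if "\<mu> \<in> space \<Gamma>" for \<mu> t
      using H that unfolding flow_C1_def f_def by auto
    show "\<bar>H' (tilt (f t) \<mu>)\<bar> \<le> C'" if "\<mu> \<in> space \<Gamma>" for \<mu> t
      using HC' f that by auto
  qed
  have D2: "((\<lambda>t. \<integral>\<mu>. H \<mu> * E t \<mu> \<partial>\<Gamma>) has_real_derivative (\<integral>\<mu>. H \<mu> * (E 0 \<mu> * e 0 \<mu>) \<partial>\<Gamma>)) (at 0)"
  proof (rule DERIV_integral[where C = "C * Q" and u' = "\<lambda>t \<mu>. H \<mu> * (E t \<mu> * e t \<mu>)"])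
    show "finite_measure \<Gamma>" by unfold_locales
    have lbE: "locally_bounded (E t)" for t
    proof -
      have "locally_bounded (\<lambda>\<mu>. exp ((\<integral>s. - f t s / a s \<partial>\<mu>\<^sub>0) + (-1) * (\<integral>s. (exp (- f t s) - 1) * (b s / a s) \<partial>\<mu>)))"
        using f by (intro locally_bounded_continuous[where \<rho> = exp] locally_bounded_add locally_bounded_mult
          locally_bounded_integral locally_bounded_const bounded_measurable_Lambda bounded_measurable_minus
          continuous_intros)
      then show ?thesis unfolding E_def Lambda_eq by simp
    qed
    show "integrable \<Gamma> (\<lambda>\<mu>. H \<mu> * E t \<mu>)" for t
      by (rule integrable_locally_bounded[of _ R]) (auto intro: lb lbE simp: supp)
    have [measurable]: "E 0 \<in> borel_measurable MS" using lbE locally_boundedD(1) by auto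
    have [measurable]: "(\<lambda>\<mu>. \<integral>s. b s * g s \<partial>\<mu>) \<in> borel_measurable MS" by (rule measurable_integral_MS[OF bg])
    show "(\<lambda>\<mu>. H \<mu> * (E 0 \<mu> * e 0 \<mu>)) \<in> borel_measurable \<Gamma>"
      by (simp add: e_def f_def)
    show "((\<lambda>t. H \<mu> * E t \<mu>) has_real_derivative H \<mu> * (E t \<mu> * e t \<mu>)) (at t)" if "\<mu> \<in> space \<Gamma>" for \<mu> t
      using that by (intro DERIV_cmult E') simp
    show "\<bar>H \<mu> * (E t \<mu> * e t \<mu>)\<bar> \<le> C * Q" if "\<mu> \<in> space \<Gamma>" "\<bar>t - 0\<bar> < 1" for \<mu> t
    \<comment> \<open>The bound \<open>Q\<close> is confined to bounded masses; from mass
      \<open>R\<close> on, the factor \<open>H\<close> is zero.\<close>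
    proof (cases "measure \<mu> UNIV < R")
      case True
      have \<mu>: "\<mu> \<in> finite_measures" "measure \<mu> UNIV \<le> R" and t: "\<bar>t\<bar> < 1" using that True by auto
      have R0: "R \<ge> 0" using \<mu>(2) measure_nonneg[of \<mu> UNIV] by linarith
      have ft: "(\<lambda>s. - f t s) = (\<lambda>s. t * - ?k s)" by (simp add: f_def)
      have i1: "\<bar>\<integral>s. b s / a s \<partial>\<mu>\<bar> \<le> B1 * R"
        using integral_abs_le[OF bounded_measurable_coefficients(4) \<mu>(1) B1(2)] mult_left_mono[OF \<mu>(2), of B1] B1(1)
        by linarith
      have i2: "\<bar>- t * (\<integral>s. g s \<partial>\<mu>\<^sub>0)\<bar> \<le> m"
        unfolding m_def abs_mult using t by (intro mult_left_le_one_le) auto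
      have "Lambda a b \<mu>\<^sub>0 \<mu> (\<lambda>s. - f t s) \<le> m + exp A * B1 * R + B1 * R"
        using tilt_bound[OF bounded_measurable_coefficients(4) B1(2) \<mu> t, unfolded ft] i1 i2 \<Lambda>[OF \<mu>(1), of t]
        by linarith
      moreover have "\<bar>e t \<mu>\<bar> \<le> exp A * B2 * R + m"
        using tilt_bound[OF bg B2(2) \<mu> t] unfolding e_def m_def by linarith
      ultimately have "\<bar>E t \<mu> * e t \<mu>\<bar> \<le> Q"
        unfolding Q_def abs_mult E_def by (intro mult_mono) auto
      then show ?thesis using HC[OF \<mu>(1)] C(1) unfolding abs_mult[of "H \<mu>"] by (intro mult_mono) auto
    next
      case False
      have "m \<ge> 0" by (simp add: m_def)
      then have "Q \<ge> 0" using R B2(1) by (simp add: Q_def)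
      then show ?thesis using supp[of \<mu>] that False C(1) by simp
    qed
  qed
  have "(\<integral>\<mu>. H (tilt (f t) \<mu>) \<partial>\<Gamma>) = (\<integral>\<mu>. H \<mu> * E t \<mu> \<partial>\<Gamma>)" for t
    unfolding E_def by (rule integral_tilt_law[OF f]) measurable
  from DERIV_unique[OF D1[unfolded this] D2]
  have "(\<integral>\<mu>. H' (tilt (f 0) \<mu>) \<partial>\<Gamma>) = (\<integral>\<mu>. H \<mu> * (E 0 \<mu> * e 0 \<mu>) \<partial>\<Gamma>)" .
  then show ?thesis by (simp add: E_def e_def f_def Lambda_zero)
qed

end

section \<open>Reversibility\<close>

text \<open>Squaring removes the corner of the positive part, since at 0 the difference quotient is
  at most \<open>\<bar>h\<bar>\<close> in absolute value. The cutoff is a square for this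
  reason.\<close>

lemma DERIV_max_squared: "((\<lambda>y::real. (max 0 y)\<^sup>2) has_real_derivative 2 * max 0 y) (at y)"
proof (cases y "0::real" rule: linorder_cases)
  case less
  have "((\<lambda>y. 0) has_real_derivative 0) (at y)" by simp
  then have "((\<lambda>y. (max 0 y)\<^sup>2) has_real_derivative 0) (at y)"
    by (rule has_field_derivative_transform_within_open[where S = "{..<0}"]) (use less in auto)
  then show ?thesis using less by simp
next
  case greater
  have "((\<lambda>y. y\<^sup>2) has_real_derivative 2 * y) (at y)" by (auto intro!: derivative_eq_intros)
  then have "((\<lambda>y. (max 0 y)\<^sup>2) has_real_derivative 2 * y) (at y)"
    by (rule has_field_derivative_transform_within_open[where S = "{0<..}"]) (use greater in auto)
  then show ?thesis using greater by simp
next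
  case equal
  have "((\<lambda>h::real. (max 0 h)\<^sup>2 / h) \<longlongrightarrow> 0) (at 0)"
  proof (rule Lim_null_comparison[where g = "\<lambda>h. \<bar>h\<bar>"])
    show "\<forall>\<^sub>F h::real in at 0. norm ((max 0 h)\<^sup>2 / h) \<le> \<bar>h\<bar>"
      by (intro always_eventually allI) (auto simp: max_def power2_eq_square)
    show "((\<lambda>h::real. \<bar>h\<bar>) \<longlongrightarrow> 0) (at 0)"
      using tendsto_rabs[OF tendsto_ident_at[of "0::real" UNIV]] by simp
  qed
  then show ?thesis using equal by (simp add: has_field_derivative_iff)
qed

lemma square_integrable_mult:
  assumes "square_integrable M F" "square_integrable M G"
  shows "integrable M (\<lambda>x. F x * G x)"
proof (rule Bochner_Integration.integrable_bound)
  show "integrable M (\<lambda>x. (F x)\<^sup>2 + (G x)\<^sup>2)" using assms by (auto simp: square_integrable_def)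
  show "(\<lambda>x. F x * G x) \<in> borel_measurable M" using assms by (auto simp: square_integrable_def)
  have "\<bar>x * y\<bar> \<le> x\<^sup>2 + y\<^sup>2" for x y :: real
  proof -
    have "2 * \<bar>x * y\<bar> \<le> x\<^sup>2 + y\<^sup>2"
      using sum_squares_bound[of "\<bar>x\<bar>" "\<bar>y\<bar>"] by (simp add: abs_mult)
    then show ?thesis using abs_ge_zero[of "x * y"] by linarith
  qed
  then show "AE x in M. norm (F x * G x) \<le> norm ((F x)\<^sup>2 + (G x)\<^sup>2)" by (intro AE_I2) simp
qed

context gamma_law
begin

text \<open>Integration by parts is available only in directions that do not depend on the measure.
  So \<open>DG\<close> is expanded into the functions \<open>f j\<close> with coefficients
  \<open>D1 j (e \<mu>)\<close>, and the formula is applied in direction \<open>f j\<close> to the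
  product of \<open>H\<close> with that coefficient. Differentiating the coefficient gives the
  second order term, differentiating \<open>H\<close> gives the energy, and the density supplies the
  drift. The local bound on the energy of \<open>G\<close> makes its truncations integrable later
  on.\<close>

lemma generator_integration_by_parts:
  assumes "G \<in> gen_domain"
  obtains DG where "gradient G DG"
    and "locally_bounded (\<lambda>\<mu>. \<integral>s. a s * (DG \<mu> s)\<^sup>2 \<partial>\<mu>)"
    and "\<And>H DH R. gradient H DH \<Longrightarrow> 0 \<le> R \<Longrightarrow>
      (\<And>\<mu>. \<mu> \<in> finite_measures \<Longrightarrow> R \<le> measure \<mu> UNIV \<Longrightarrow> H \<mu> = 0) \<Longrightarrow>
      integrable \<Gamma> (\<lambda>\<mu>. \<integral>s. a s * DH \<mu> s * DG \<mu> s \<partial>\<mu>) \<and>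
      (\<integral>\<mu>. H \<mu> * generator a b \<mu>\<^sub>0 G \<mu> \<partial>\<Gamma>) = - (\<integral>\<mu>. (\<integral>s. a s * DH \<mu> s * DG \<mu> s \<partial>\<mu>) \<partial>\<Gamma>)"
proof -
  obtain n :: nat and f and \<phi> and D1 and D2 where f: "\<And>i. i < n \<Longrightarrow> f i \<in> bounded_measurable"
    and G: "\<And>\<mu>. \<mu> \<in> finite_measures \<Longrightarrow> G \<mu> = \<phi> (evals n f \<mu>)"
    and cont: "continuous_on UNIV \<phi>" "\<And>i. i < n \<Longrightarrow> continuous_on UNIV (D1 i)"
      "\<And>i j. i < n \<Longrightarrow> j < n \<Longrightarrow> continuous_on UNIV (D2 i j)"
    and der1: "\<And>i x. i < n \<Longrightarrow> ((\<lambda>t. \<phi> (x(i := t))) has_real_derivative D1 i x) (at (x i))"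
    and der2: "\<And>i j x. i < n \<Longrightarrow> j < n \<Longrightarrow> ((\<lambda>t. D1 i (x(j := t))) has_real_derivative D2 i j x) (at (x j))"
    using gen_domainE[OF assms] by blast
  define e where "e = evals n f"
  define DG where "DG \<mu> s = (\<Sum>j<n. D1 j (e \<mu>) * f j s)" for \<mu> s
  have af: "(\<lambda>s. a s * f j s) \<in> bounded_measurable" if "j < n" for j
    by (intro bounded_measurable_intros f that bounded_measurable_coefficients)
  have DG: "DG \<mu> \<in> bounded_measurable" for \<mu>
    unfolding DG_def by (intro bounded_measurable_sum bounded_measurable_intros f) simp
  have pair: "(\<integral>s. h s * DG \<mu> s \<partial>\<mu>) = (\<Sum>j<n. D1 j (e \<mu>) * (\<integral>s. h s * f j s \<partial>\<mu>))"
    if h: "h \<in> bounded_measurable" and \<mu>: "\<mu> \<in> finite_measures" for h \<mu>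
  proof -
    have i: "integrable \<mu> (\<lambda>s. h s * f j s)" if "j < n" for j
      by (intro integrable_bounded_measurable[OF _ \<mu>] bounded_measurable_intros f that h)
    have "(\<integral>s. h s * DG \<mu> s \<partial>\<mu>) = (\<integral>s. (\<Sum>j<n. D1 j (e \<mu>) * (h s * f j s)) \<partial>\<mu>)"
      by (intro Bochner_Integration.integral_cong) (auto simp: DG_def sum_distrib_left mult_ac)
    also have "\<dots> = (\<Sum>j<n. (\<integral>s. D1 j (e \<mu>) * (h s * f j s) \<partial>\<mu>))"
      using i by (intro Bochner_Integration.integral_sum) auto
    finally show ?thesis by simp
  qed
  have flowG: "flow_C1 g G (\<lambda>\<mu>. \<integral>s. g s * DG \<mu> s \<partial>\<mu>)" if g: "g \<in> bounded_measurable" for g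
    by (subst flow_C1_cong[OF g refl pair[OF g]])
      (use flow_C1_evals[OF f G cont(1,2) der1 g] in \<open>auto simp: e_def\<close>)
  have grad: "gradient G DG" unfolding gradient_def using flowG DG by auto
  have lb1: "locally_bounded (\<lambda>\<mu>. D1 j (e \<mu>))" if "j < n" for j
    unfolding e_def using f cont(2)[OF that] by (rule locally_bounded_evals)
  have lb2: "locally_bounded (\<lambda>\<mu>. \<integral>s. a s * (DG \<mu> s)\<^sup>2 \<partial>\<mu>)"
  proof -
    have "(\<integral>s. a s * (DG \<mu> s)\<^sup>2 \<partial>\<mu>) = (\<Sum>j<n. D1 j (e \<mu>) * (\<Sum>k<n. D1 k (e \<mu>) * (\<integral>s. (a s * f j s) * f k s \<partial>\<mu>)))"
      if \<mu>: "\<mu> \<in> finite_measures" for \<mu>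
    proof -
      have "(\<integral>s. a s * (DG \<mu> s)\<^sup>2 \<partial>\<mu>) = (\<integral>s. (a s * DG \<mu> s) * DG \<mu> s \<partial>\<mu>)"
        by (simp add: power2_eq_square mult_ac)
      also have "\<dots> = (\<Sum>j<n. D1 j (e \<mu>) * (\<integral>s. (a s * DG \<mu> s) * f j s \<partial>\<mu>))"
        by (intro pair[OF _ \<mu>] bounded_measurable_intros bounded_measurable_coefficients DG)
      also have "\<dots> = (\<Sum>j<n. D1 j (e \<mu>) * (\<integral>s. (a s * f j s) * DG \<mu> s \<partial>\<mu>))"
        by (simp add: mult_ac)
      also have "\<dots> = (\<Sum>j<n. D1 j (e \<mu>) * (\<Sum>k<n. D1 k (e \<mu>) * (\<integral>s. (a s * f j s) * f k s \<partial>\<mu>)))"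
        by (intro sum.cong refl arg_cong2[where f = "(*)"] pair[OF af \<mu>]) simp
      finally show ?thesis .
    qed
    moreover have "locally_bounded (\<lambda>\<mu>. \<Sum>j<n. D1 j (e \<mu>) * (\<Sum>k<n. D1 k (e \<mu>) * (\<integral>s. (a s * f j s) * f k s \<partial>\<mu>)))"
      by (intro locally_bounded_sum locally_bounded_mult locally_bounded_integral lb1
        bounded_measurable_intros f bounded_measurable_coefficients) simp_all
    ultimately show ?thesis using locally_bounded_cong by (metis (mono_tags, lifting))
  qed
  have v1: "vderiv G \<mu> s = DG \<mu> s" if "\<mu> \<in> finite_measures" for \<mu> s
    unfolding DG_def e_def using that by (intro vderiv_evals[OF f G cont(2) der1])
  have v2: "vderiv2 G \<mu> s = (\<Sum>k<n. (\<Sum>j<n. D2 j k (e \<mu>) * f j s) * f k s)" if \<mu>: "\<mu> \<in> finite_measures" for \<mu> s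
    unfolding vderiv2_def e_def
  \<comment> \<open>For fixed \<open>s\<close> the first variational derivative is itself a function
    of the evaluations, in which the numbers \<open>f j s\<close> are constants.\<close>
  proof (rule vderiv_evals[OF f _ _ _ \<mu>, where \<phi> = "\<lambda>x. \<Sum>j<n. D1 j x * f j s" and D = "\<lambda>k x. \<Sum>j<n. D2 j k x * f j s"])
    show "vderiv G \<nu> s = (\<Sum>j<n. D1 j (evals n f \<nu>) * f j s)" if "\<nu> \<in> finite_measures" for \<nu>
      using v1[OF that] by (simp add: DG_def e_def)
    show "continuous_on UNIV (\<lambda>x. \<Sum>j<n. D2 j k x * f j s)" if "k < n" for k
      using cont(3) that by (intro continuous_intros) auto
    show "((\<lambda>t. \<Sum>j<n. D1 j (x(k := t)) * f j s) has_real_derivative (\<Sum>j<n. D2 j k x * f j s)) (at (x k))"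
      if "k < n" for k x
      using der2 that by (intro DERIV_sum DERIV_cmult_right) auto
  qed
  \<comment> \<open>\<open>S2 j\<close> is the derivative of \<open>D1 j (e \<mu>)\<close> along the
    direction \<open>a * f j\<close>; \<open>B j\<close>, defined next, is the negative of the drift
    paired with \<open>f j\<close>.\<close>
  define S2 where "S2 j \<mu> = (\<Sum>k<n. D2 j k (e \<mu>) * (\<integral>s. (a s * f j s) * f k s \<partial>\<mu>))" for j \<mu>
  define B where "B j \<mu> = (\<integral>s. b s * f j s \<partial>\<mu>) - (\<integral>s. f j s \<partial>\<mu>\<^sub>0)" for j \<mu>
  have gen: "generator a b \<mu>\<^sub>0 G \<mu> = (\<Sum>j<n. S2 j \<mu>) - (\<Sum>j<n. D1 j (e \<mu>) * B j \<mu>)"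
    if \<mu>: "\<mu> \<in> finite_measures" for \<mu>
  proof -
    have "(\<integral>s. a s * vderiv2 G \<mu> s \<partial>\<mu>) = (\<integral>s. (\<Sum>j<n. \<Sum>k<n. D2 j k (e \<mu>) * ((a s * f j s) * f k s)) \<partial>\<mu>)"
      unfolding v2[OF \<mu>] sum_distrib_left sum_distrib_right
      by (intro Bochner_Integration.integral_cong refl, subst sum.swap) (auto intro!: sum.cong)
    also have "\<dots> = (\<Sum>j<n. \<integral>s. (\<Sum>k<n. D2 j k (e \<mu>) * ((a s * f j s) * f k s)) \<partial>\<mu>)"
      by (intro Bochner_Integration.integral_sum integrable_bounded_measurable[OF _ \<mu>] bounded_measurable_sum
        bounded_measurable_intros f bounded_measurable_coefficients) auto
    also have "\<dots> = (\<Sum>j<n. \<Sum>k<n. \<integral>s. D2 j k (e \<mu>) * ((a s * f j s) * f k s) \<partial>\<mu>)"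
      by (intro sum.cong refl Bochner_Integration.integral_sum integrable_bounded_measurable[OF _ \<mu>]
        bounded_measurable_intros f bounded_measurable_coefficients) auto
    also have "\<dots> = (\<Sum>j<n. S2 j \<mu>)" by (simp add: S2_def)
    finally have 1: "(\<integral>s. a s * vderiv2 G \<mu> s \<partial>\<mu>) = (\<Sum>j<n. S2 j \<mu>)" .
    have "(\<integral>s. DG \<mu> s \<partial>\<mu>\<^sub>0) = (\<integral>s. (\<Sum>j<n. D1 j (e \<mu>) * f j s) \<partial>\<mu>\<^sub>0)"
      by (simp add: DG_def)
    also have "\<dots> = (\<Sum>j<n. \<integral>s. D1 j (e \<mu>) * f j s \<partial>\<mu>\<^sub>0)"
      by (intro Bochner_Integration.integral_sum integrable_bounded_measurable[OF _ \<mu>\<^sub>0] bounded_measurable_intros f) auto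
    finally have 2: "(\<integral>s. DG \<mu> s \<partial>\<mu>\<^sub>0) = (\<Sum>j<n. D1 j (e \<mu>) * (\<integral>s. f j s \<partial>\<mu>\<^sub>0))" by simp
    show ?thesis
      unfolding generator_def 1 v1[OF \<mu>] 2 pair[OF bounded_measurable_coefficients(2) \<mu>] B_def
      by (simp add: right_diff_distrib sum_subtractf)
  qed
  have flow1: "flow_C1 g (\<lambda>\<mu>. D1 j (e \<mu>)) (\<lambda>\<mu>. \<Sum>k<n. D2 j k (e \<mu>) * (\<integral>s. g s * f k s \<partial>\<mu>))"
    if "g \<in> bounded_measurable" "j < n" for g j
    unfolding e_def
    by (rule flow_C1_evals) (use that in \<open>auto intro: f cont(2,3) der2 simp del: fun_upd_apply\<close>)
  have ibp: "integrable \<Gamma> (\<lambda>\<mu>. \<integral>s. a s * DH \<mu> s * DG \<mu> s \<partial>\<mu>) \<and>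
      (\<integral>\<mu>. H \<mu> * generator a b \<mu>\<^sub>0 G \<mu> \<partial>\<Gamma>) = - (\<integral>\<mu>. (\<integral>s. a s * DH \<mu> s * DG \<mu> s \<partial>\<mu>) \<partial>\<Gamma>)"
    if H: "gradient H DH" and R: "0 \<le> R"
      and supp: "\<And>\<mu>. \<mu> \<in> finite_measures \<Longrightarrow> R \<le> measure \<mu> UNIV \<Longrightarrow> H \<mu> = 0" for H DH R
  proof -
    have DH: "DH \<mu> \<in> bounded_measurable" if "\<mu> \<in> finite_measures" for \<mu>
      using H that by (auto simp: gradient_def)
    \<comment> \<open>\<open>X j\<close> is the derivative of \<open>H\<close> times the coefficient
      along \<open>a * f j\<close>. Its part \<open>Z j\<close>, where the derivative falls on
      \<open>H\<close>, is the energy, and the rest is of second order. \<open>Y j\<close> is the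
      right-hand side of the integration by parts formula.\<close>
    define Z where "Z j \<mu> = (\<integral>s. (a s * f j s) * DH \<mu> s \<partial>\<mu>) * D1 j (e \<mu>)" for j \<mu>
    define X where "X j \<mu> = Z j \<mu> + H \<mu> * S2 j \<mu>" for j \<mu>
    define Y where "Y j \<mu> = H \<mu> * D1 j (e \<mu>) * B j \<mu>" for j \<mu>
    have flowH: "flow_C1 (\<lambda>s. a s * f j s) H (\<lambda>\<mu>. \<integral>s. (a s * f j s) * DH \<mu> s \<partial>\<mu>)" if "j < n" for j
      using H af[OF that] unfolding gradient_def by auto
    have intZ: "integrable \<Gamma> (Z j)" if j: "j < n" for j
    proof (rule integrable_locally_bounded[of _ R])
      show "locally_bounded (Z j)"
        unfolding Z_def using flowH[OF j] lb1[OF j] by (intro locally_bounded_mult) (auto simp: flow_C1_def)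
      show "Z j \<mu> = 0" if "\<mu> \<in> finite_measures" "R < measure \<mu> UNIV" for \<mu>
        using flow_C1_vanish[OF af[OF j] flowH[OF j] supp that] by (simp add: Z_def)
    qed
    have flowX: "flow_C1 (\<lambda>s. a s * f j s) (\<lambda>\<mu>. H \<mu> * D1 j (e \<mu>)) (X j)" if j: "j < n" for j
      unfolding X_def Z_def S2_def by (rule flow_C1_mult[OF flowH[OF j] flow1[OF af[OF j] j]])
    have suppX: "H \<mu> * D1 j (e \<mu>) = 0" if "\<mu> \<in> finite_measures" "R \<le> measure \<mu> UNIV" for \<mu> j
      using supp[OF that] by simp
    have intX: "integrable \<Gamma> (X j)" if j: "j < n" for j
      using flowX[OF j] flow_C1_vanish[OF af[OF j] flowX[OF j] suppX]
      by (intro integrable_locally_bounded[of _ R]) (auto simp: flow_C1_def)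
    have intY: "integrable \<Gamma> (Y j)" if j: "j < n" for j
    proof (rule integrable_locally_bounded[of _ R])
      have "locally_bounded (\<lambda>\<mu>. (\<integral>s. b s * f j s \<partial>\<mu>) + - (\<integral>s. f j s \<partial>\<mu>\<^sub>0))"
        by (intro locally_bounded_add locally_bounded_integral locally_bounded_const
          bounded_measurable_intros f j bounded_measurable_coefficients)
      then have "locally_bounded (B j)" unfolding B_def by simp
      then show "locally_bounded (Y j)"
        unfolding Y_def using flowH[OF j] lb1[OF j] by (intro locally_bounded_mult) (auto simp: flow_C1_def)
      show "Y j \<mu> = 0" if "\<mu> \<in> finite_measures" "R < measure \<mu> UNIV" for \<mu>
        using supp that by (simp add: Y_def)
    qed
    have XY: "(\<integral>\<mu>. X j \<mu> \<partial>\<Gamma>) = (\<integral>\<mu>. Y j \<mu> \<partial>\<Gamma>)" if j: "j < n" for j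
      unfolding Y_def B_def by (rule integration_by_parts[OF f[OF j] flowX[OF j] suppX R])
    have Zsum: "(\<integral>s. a s * DH \<mu> s * DG \<mu> s \<partial>\<mu>) = (\<Sum>j<n. Z j \<mu>)" if \<mu>: "\<mu> \<in> finite_measures" for \<mu>
    proof -
      have "(\<integral>s. a s * DH \<mu> s * DG \<mu> s \<partial>\<mu>) = (\<Sum>j<n. D1 j (e \<mu>) * (\<integral>s. a s * DH \<mu> s * f j s \<partial>\<mu>))"
        by (intro pair[OF _ \<mu>] bounded_measurable_intros bounded_measurable_coefficients DH \<mu>)
      then show ?thesis by (simp add: Z_def mult_ac)
    qed
    \<comment> \<open>In this form the integrals of \<open>X j\<close> and \<open>Y j\<close> cancel
      and only the energy remains. Splitting the integral is possible because all three functionals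
      vanish for large masses and are integrable separately.\<close>
    have "H \<mu> * generator a b \<mu>\<^sub>0 G \<mu> = (\<Sum>j<n. X j \<mu> - Y j \<mu> - Z j \<mu>)" if "\<mu> \<in> finite_measures" for \<mu>
      unfolding gen[OF that] X_def Y_def
      by (simp add: right_diff_distrib sum_distrib_left sum_subtractf mult_ac)
    then have "(\<integral>\<mu>. H \<mu> * generator a b \<mu>\<^sub>0 G \<mu> \<partial>\<Gamma>) = (\<integral>\<mu>. (\<Sum>j<n. X j \<mu> - Y j \<mu> - Z j \<mu>) \<partial>\<Gamma>)"
      by (intro Bochner_Integration.integral_cong) auto
    also have "\<dots> = (\<Sum>j<n. (\<integral>\<mu>. X j \<mu> - Y j \<mu> - Z j \<mu> \<partial>\<Gamma>))"
      using intX intY intZ by (intro Bochner_Integration.integral_sum) auto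
    also have "\<dots> = (\<Sum>j<n. - (\<integral>\<mu>. Z j \<mu> \<partial>\<Gamma>))"
      using intX intY intZ XY by (intro sum.cong) auto
    also have "\<dots> = - (\<integral>\<mu>. (\<Sum>j<n. Z j \<mu>) \<partial>\<Gamma>)"
      using intZ by (subst Bochner_Integration.integral_sum) (auto simp: sum_negf)
    also have "(\<integral>\<mu>. (\<Sum>j<n. Z j \<mu>) \<partial>\<Gamma>) = (\<integral>\<mu>. (\<integral>s. a s * DH \<mu> s * DG \<mu> s \<partial>\<mu>) \<partial>\<Gamma>)"
      by (intro Bochner_Integration.integral_cong) (auto simp: Zsum)
    finally have eq: "(\<integral>\<mu>. H \<mu> * generator a b \<mu>\<^sub>0 G \<mu> \<partial>\<Gamma>) = - (\<integral>\<mu>. (\<integral>s. a s * DH \<mu> s * DG \<mu> s \<partial>\<mu>) \<partial>\<Gamma>)" .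
    have "integrable \<Gamma> (\<lambda>\<mu>. \<Sum>j<n. Z j \<mu>)" using intZ by auto
    also have "?this \<longleftrightarrow> integrable \<Gamma> (\<lambda>\<mu>. \<integral>s. a s * DH \<mu> s * DG \<mu> s \<partial>\<mu>)"
      by (intro Bochner_Integration.integrable_cong) (auto simp: Zsum)
    finally show ?thesis using eq by blast
  qed
  show thesis by (rule that[OF grad lb2 ibp])
qed

end

section \<open>Cutoffs of the total mass\<close>

definition cutoff :: "real \<Rightarrow> real \<Rightarrow> real" where
  "cutoff R x = (max 0 (1 - x / R))\<^sup>2"

definition cutoff_deriv :: "real \<Rightarrow> real \<Rightarrow> real" where
  "cutoff_deriv R x = - 2 / R * max 0 (1 - x / R)"

lemma DERIV_cutoff: "(cutoff R has_real_derivative cutoff_deriv R x) (at x)"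
proof -
  have "((\<lambda>x. 1 - x / R) has_real_derivative 0 - 1 / R) (at x)"
    by (intro DERIV_diff DERIV_const DERIV_cdivide DERIV_ident)
  from DERIV_chain2[OF DERIV_max_squared this]
  have "((\<lambda>x. (max 0 (1 - x / R))\<^sup>2) has_real_derivative 2 * max 0 (1 - x / R) * (0 - 1 / R)) (at x)" .
  then show ?thesis by (simp add: cutoff_def[abs_def] cutoff_deriv_def)
qed

text \<open>In the last bound the slope is at most \<open>2 / R\<close> in absolute value and
  vanishes beyond \<open>R\<close>, so its square times \<open>x\<close> is at most
  \<open>4 / R^2 * R\<close>. The factor \<open>x\<close> is the mass against which a spatially
  constant squared gradient is integrated.\<close>

lemma cutoff_bounds:
  assumes "0 < R" "0 \<le> x"
  shows "0 \<le> cutoff R x" "cutoff R x \<le> 1" "R \<le> x \<Longrightarrow> cutoff R x = 0"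
    "(cutoff_deriv R x)\<^sup>2 * x \<le> 4 / R"
proof -
  show "0 \<le> cutoff R x" by (simp add: cutoff_def)
  have m: "0 \<le> max 0 (1 - x / R)" "max 0 (1 - x / R) \<le> 1" using assms by auto
  then have m2: "(max 0 (1 - x / R))\<^sup>2 \<le> 1" by (rule power_le_one)
  then show "cutoff R x \<le> 1" by (simp add: cutoff_def)
  show "R \<le> x \<Longrightarrow> cutoff R x = 0" using assms by (simp add: cutoff_def field_simps)
  show "(cutoff_deriv R x)\<^sup>2 * x \<le> 4 / R"
  proof (cases "x \<le> R")
    case True
    have "(cutoff_deriv R x)\<^sup>2 * x = 4 / R\<^sup>2 * ((max 0 (1 - x / R))\<^sup>2 * x)"
      by (simp add: cutoff_deriv_def power_mult_distrib power_divide)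
    also have "\<dots> \<le> 4 / R\<^sup>2 * (1 * R)" using m2 True assms by (intro mult_left_mono mult_mono) auto
    also have "\<dots> = 4 / R" using assms by (simp add: power2_eq_square)
    finally show ?thesis .
  next
    case False
    then have "cutoff_deriv R x = 0" using assms by (simp add: cutoff_deriv_def field_simps)
    then show ?thesis using assms by simp
  qed
qed

lemma cutoff_tendsto: "(\<lambda>n. cutoff (real (Suc n)) x) \<longlonglongrightarrow> 1"
proof -
  have "(\<lambda>n. (max 0 (1 - x * (1 / real (Suc n))))\<^sup>2) \<longlonglongrightarrow> (max 0 (1 - x * 0))\<^sup>2"
    by (intro tendsto_intros LIMSEQ_Suc lim_1_over_n)
  then show ?thesis by (simp add: cutoff_def)
qed

section \<open>Symmetry of the generator by truncation\<close>

context gamma_law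
begin

text \<open>The cutoffs \<open>cutoff R\<close> of the total mass have vanishing energy as R tends to infinity. Testing
  with the squared cutoff times F bounds the truncated energy of F uniformly in R, so the error
  terms in the truncated symmetry relation vanish in the limit.\<close>

lemma reversible: "reversible a b \<mu>\<^sub>0 \<Gamma>"
  unfolding reversible_def
proof (intro ballI impI)
  fix F G :: "'a measure \<Rightarrow> real"
  let ?L = "generator a b \<mu>\<^sub>0"
  assume F: "F \<in> gen_domain" "square_integrable \<Gamma> F" "square_integrable \<Gamma> (?L F)"
    and G: "G \<in> gen_domain" "square_integrable \<Gamma> G" "square_integrable \<Gamma> (?L G)"
  obtain DF where DF: "gradient F DF" "locally_bounded (\<lambda>\<mu>. \<integral>s. a s * (DF \<mu> s)\<^sup>2 \<partial>\<mu>)"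
    and ibpF: "\<And>H DH R. gradient H DH \<Longrightarrow> 0 \<le> R \<Longrightarrow>
      (\<And>\<mu>. \<mu> \<in> finite_measures \<Longrightarrow> R \<le> measure \<mu> UNIV \<Longrightarrow> H \<mu> = 0) \<Longrightarrow>
      integrable \<Gamma> (\<lambda>\<mu>. \<integral>s. a s * DH \<mu> s * DF \<mu> s \<partial>\<mu>) \<and>
      (\<integral>\<mu>. H \<mu> * ?L F \<mu> \<partial>\<Gamma>) = - (\<integral>\<mu>. (\<integral>s. a s * DH \<mu> s * DF \<mu> s \<partial>\<mu>) \<partial>\<Gamma>)"
    using generator_integration_by_parts[OF F(1)] by blast
  obtain DG where DG: "gradient G DG" "locally_bounded (\<lambda>\<mu>. \<integral>s. a s * (DG \<mu> s)\<^sup>2 \<partial>\<mu>)"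
    and ibpG: "\<And>H DH R. gradient H DH \<Longrightarrow> 0 \<le> R \<Longrightarrow>
      (\<And>\<mu>. \<mu> \<in> finite_measures \<Longrightarrow> R \<le> measure \<mu> UNIV \<Longrightarrow> H \<mu> = 0) \<Longrightarrow>
      integrable \<Gamma> (\<lambda>\<mu>. \<integral>s. a s * DH \<mu> s * DG \<mu> s \<partial>\<mu>) \<and>
      (\<integral>\<mu>. H \<mu> * ?L G \<mu> \<partial>\<Gamma>) = - (\<integral>\<mu>. (\<integral>s. a s * DH \<mu> s * DG \<mu> s \<partial>\<mu>) \<partial>\<Gamma>)"
    using generator_integration_by_parts[OF G(1)] by blast
  obtain A where A: "A > 0" "\<And>s. \<bar>a s\<bar> \<le> A"
    using bounded_measurableD(2)[OF bounded_measurable_coefficients(1)] by blast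
  define c where "c n \<mu> = cutoff (real (Suc n)) (measure \<mu> UNIV)" for n and \<mu> :: "'a measure"
  define d where "d n \<mu> = cutoff_deriv (real (Suc n)) (measure \<mu> UNIV)" for n and \<mu> :: "'a measure"
  \<comment> \<open>Bound for the energy density of \<open>c n\<close>: the supremum
    \<open>A\<close> of the diffusion coefficient times the bound \<open>4 / R\<close> for the
    cutoff at scale \<open>R = Suc n\<close>, which is positive for every \<open>n\<close>.\<close>
  define \<delta> where "\<delta> n = 4 * A / real (Suc n)" for n
  have \<delta>: "0 < \<delta> n" "\<delta> n \<le> 4 * A" for n using A(1) by (auto simp: \<delta>_def field_simps)
  have c01: "0 \<le> c n \<mu>" "c n \<mu> \<le> 1" for n \<mu> unfolding c_def by (auto intro: cutoff_bounds)
  have c_supp: "c n \<mu> = 0" if "real (Suc n) \<le> measure \<mu> UNIV" for n \<mu>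
    unfolding c_def using that by (intro cutoff_bounds(3)) auto
  have c2_01: "0 \<le> (c n \<mu>)\<^sup>2" "(c n \<mu>)\<^sup>2 \<le> 1" for n \<mu> using c01[of n \<mu>] by (auto intro: power_le_one)
  have d_bound: "(d n \<mu>)\<^sup>2 * (\<integral>s. a s \<partial>\<mu>) \<le> \<delta> n" if \<mu>: "\<mu> \<in> finite_measures" for n \<mu>
  proof -
    have "(\<integral>s. a s \<partial>\<mu>) \<le> A * measure \<mu> UNIV"
      using integral_abs_le[OF bounded_measurable_coefficients(1) \<mu> A(2)] by simp
    then have "(d n \<mu>)\<^sup>2 * (\<integral>s. a s \<partial>\<mu>) \<le> (d n \<mu>)\<^sup>2 * (A * measure \<mu> UNIV)" by (intro mult_left_mono) auto
    also have "\<dots> = A * ((d n \<mu>)\<^sup>2 * measure \<mu> UNIV)" by simp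
    also have "\<dots> \<le> A * (4 / real (Suc n))"
      unfolding d_def using A(1) by (intro mult_left_mono cutoff_bounds) auto
    finally show ?thesis by (simp add: \<delta>_def mult.commute)
  qed
  have gc: "gradient (c n) (\<lambda>\<mu> s. d n \<mu>)" for n
  proof -
    have "continuous_on UNIV (cutoff_deriv (real (Suc n)))"
      unfolding cutoff_deriv_def[abs_def] by (intro continuous_intros) auto
    then show ?thesis unfolding c_def d_def by (intro gradient_mass DERIV_cutoff)
  qed
  have lbc: "locally_bounded (\<lambda>\<mu>. (c n \<mu>)\<^sup>2)" for n
    using gc[of n] unfolding gradient_def flow_C1_def power2_eq_square
    by (intro locally_bounded_mult) (auto intro: bounded_measurable_const)
  have [measurable]: "(\<lambda>\<mu>. (c n \<mu>)\<^sup>2) \<in> borel_measurable MS" for n using locally_boundedD(1)[OF lbc] .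
  \<comment> \<open>Leibniz rule for \<open>(c n * c n) * P\<close>. Squaring the cutoff leaves one
    factor \<open>c n\<close> in the cross terms, which is what allows them to be absorbed by the
    truncated energy \<open>W\<close> with its weight \<open>(c n)^2\<close>.\<close>
  define T where "T n P DP \<mu> s = P \<mu> * (c n \<mu> * d n \<mu> + c n \<mu> * d n \<mu>) + (c n \<mu> * c n \<mu>) * DP \<mu> s"
    for n and P :: "'a measure \<Rightarrow> real" and DP :: "'a measure \<Rightarrow> 'a \<Rightarrow> real" and \<mu> s
  have gT: "gradient (\<lambda>\<mu>. (c n \<mu>)\<^sup>2 * P \<mu>) (T n P DP)" if "gradient P DP" for n P DP
    using gradient_mult[OF gradient_mult[OF gc[of n] gc[of n]] that] unfolding T_def[abs_def] power2_eq_square .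
  have supp: "(c n \<mu>)\<^sup>2 * P \<mu> = 0" if "\<mu> \<in> finite_measures" "real (Suc n) \<le> measure \<mu> UNIV" for n \<mu> P
    using c_supp[OF that(2)] by simp
  define J where "J n P DP DQ = (\<lambda>\<mu>. \<integral>s. a s * T n P DP \<mu> s * DQ \<mu> s \<partial>\<mu>)"
    for n and P :: "'a measure \<Rightarrow> real" and DP DQ :: "'a measure \<Rightarrow> 'a \<Rightarrow> real"
  have ibp_F: "integrable \<Gamma> (J n P DP DF)" "(\<integral>\<mu>. (c n \<mu>)\<^sup>2 * P \<mu> * ?L F \<mu> \<partial>\<Gamma>) = - (\<integral>\<mu>. J n P DP DF \<mu> \<partial>\<Gamma>)"
    if "gradient P DP" for n P DP
    using ibpF[OF gT[OF that], of "real (Suc n)" n, OF _ supp[of _ n P]] unfolding J_def by auto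
  have ibp_G: "integrable \<Gamma> (J n P DP DG)" "(\<integral>\<mu>. (c n \<mu>)\<^sup>2 * P \<mu> * ?L G \<mu> \<partial>\<Gamma>) = - (\<integral>\<mu>. J n P DP DG \<mu> \<partial>\<Gamma>)"
    if "gradient P DP" for n P DP
    using ibpG[OF gT[OF that], of "real (Suc n)" n, OF _ supp[of _ n P]] unfolding J_def by auto
  define W where "W n DP \<mu> = (c n \<mu>)\<^sup>2 * (\<integral>s. a s * (DP \<mu> s)\<^sup>2 \<partial>\<mu>)"
    for n and DP :: "'a measure \<Rightarrow> 'a \<Rightarrow> real" and \<mu>
  have intW: "integrable \<Gamma> (W n DP)" if "locally_bounded (\<lambda>\<mu>. \<integral>s. a s * (DP \<mu> s)\<^sup>2 \<partial>\<mu>)" for n DP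
    unfolding W_def by (rule integrable_locally_bounded[of _ "real (Suc n)"])
      (use that lbc in \<open>auto simp: c_supp\<close>)
  have bmT: "T n P DP \<mu> \<in> bounded_measurable" "DP \<mu> \<in> bounded_measurable"
    if "gradient P DP" "\<mu> \<in> finite_measures" for n P DP \<mu>
    using gT[OF that(1)] that unfolding gradient_def by auto
  have sq: "integrable \<mu> (\<lambda>s. a s * (DP \<mu> s)\<^sup>2)" if "gradient P DP" "\<mu> \<in> finite_measures" for P DP \<mu>
    unfolding power2_eq_square
    by (intro integrable_bounded_measurable[OF _ that(2)] bounded_measurable_intros
      bounded_measurable_coefficients bmT(2)[OF that])
  \<comment> \<open>Completing the square: the two integrands differ by
    \<open>a * (c * DP + 2 * d * P)^2 / 2\<close>. The cross term costs at most half of the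
    truncated energy and a multiple of \<open>\<delta> n * P^2\<close>.\<close>
  have energy: "W n DP \<mu> / 2 - 2 * \<delta> n * (P \<mu>)\<^sup>2 \<le> J n P DP DP \<mu>"
    if P: "gradient P DP" and \<mu>: "\<mu> \<in> finite_measures" for n P DP \<mu>
  proof -
    let ?lower = "\<lambda>s. ((c n \<mu>)\<^sup>2 / 2) * (a s * (DP \<mu> s)\<^sup>2) - 2 * (P \<mu>)\<^sup>2 * (d n \<mu>)\<^sup>2 * a s"
    have int: "integrable \<mu> (\<lambda>s. a s)" by (intro integrable_bounded_measurable \<mu> bounded_measurable_coefficients)
    have "(\<integral>s. ?lower s \<partial>\<mu>) \<le> J n P DP DP \<mu>"
      unfolding J_def
    proof (rule integral_mono)
      show "integrable \<mu> ?lower" using int sq[OF P \<mu>] by auto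
      show "integrable \<mu> (\<lambda>s. a s * T n P DP \<mu> s * DP \<mu> s)"
        by (intro integrable_bounded_measurable[OF _ \<mu>] bounded_measurable_intros
          bounded_measurable_coefficients bmT[OF P \<mu>])
      fix s
      have "0 \<le> a s * ((c n \<mu> * DP \<mu> s) + 2 * (d n \<mu> * P \<mu>))\<^sup>2 / 2"
        using a_pos[of s] by simp
      also have "\<dots> = a s * T n P DP \<mu> s * DP \<mu> s - ?lower s"
        by (simp add: T_def power2_eq_square field_simps)
      finally show "?lower s \<le> a s * T n P DP \<mu> s * DP \<mu> s" by simp
    qed
    moreover have "(\<integral>s. ?lower s \<partial>\<mu>) = W n DP \<mu> / 2 - 2 * (P \<mu>)\<^sup>2 * ((d n \<mu>)\<^sup>2 * (\<integral>s. a s \<partial>\<mu>))"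
      using int sq[OF P \<mu>] by (simp add: W_def)
    moreover have "2 * (P \<mu>)\<^sup>2 * ((d n \<mu>)\<^sup>2 * (\<integral>s. a s \<partial>\<mu>)) \<le> 2 * (P \<mu>)\<^sup>2 * \<delta> n"
      using d_bound[OF \<mu>] by (intro mult_left_mono) auto
    ultimately show ?thesis by (simp add: mult_ac)
  qed
  \<comment> \<open>Doubling the previous estimate turns the error into
    \<open>4 * \<delta> n\<close>, and \<open>\<delta> n \<le> 4 * A\<close> makes the resulting
    constant \<open>16 * A\<close> independent of \<open>n\<close>.\<close>
  have energy_bound: "(\<integral>\<mu>. W n DP \<mu> \<partial>\<Gamma>) \<le> 2 * (\<integral>\<mu>. \<bar>P \<mu> * ?L P \<mu>\<bar> \<partial>\<Gamma>) + 16 * A * (\<integral>\<mu>. (P \<mu>)\<^sup>2 \<partial>\<Gamma>)"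
    if P: "gradient P DP" "square_integrable \<Gamma> P" "square_integrable \<Gamma> (?L P)"
      and W: "integrable \<Gamma> (W n DP)"
      and ibp: "integrable \<Gamma> (J n P DP DP)" "(\<integral>\<mu>. (c n \<mu>)\<^sup>2 * P \<mu> * ?L P \<mu> \<partial>\<Gamma>) = - (\<integral>\<mu>. J n P DP DP \<mu> \<partial>\<Gamma>)"
    for n P DP
  proof -
    have P2: "integrable \<Gamma> (\<lambda>\<mu>. (P \<mu>)\<^sup>2)" using P by (simp add: square_integrable_def)
    have PL: "integrable \<Gamma> (\<lambda>\<mu>. P \<mu> * ?L P \<mu>)" using P by (intro square_integrable_mult)
    have [measurable]: "(\<lambda>\<mu>. P \<mu> * ?L P \<mu>) \<in> borel_measurable \<Gamma>" using borel_measurable_integrable[OF PL] .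
    have cPL: "\<bar>(c n \<mu>)\<^sup>2 * (P \<mu> * ?L P \<mu>)\<bar> \<le> \<bar>P \<mu> * ?L P \<mu>\<bar>" for \<mu>
      unfolding abs_mult[of "(c n \<mu>)\<^sup>2"] using c2_01 by (intro mult_left_le_one_le) auto
    have intc: "integrable \<Gamma> (\<lambda>\<mu>. (c n \<mu>)\<^sup>2 * (P \<mu> * ?L P \<mu>))"
      by (rule Bochner_Integration.integrable_bound[OF PL]) (use cPL in auto)
    have "(\<integral>\<mu>. W n DP \<mu> / 2 - 2 * \<delta> n * (P \<mu>)\<^sup>2 \<partial>\<Gamma>) \<le> (\<integral>\<mu>. J n P DP DP \<mu> \<partial>\<Gamma>)"
    proof (rule integral_mono)
      show "integrable \<Gamma> (\<lambda>\<mu>. W n DP \<mu> / 2 - 2 * \<delta> n * (P \<mu>)\<^sup>2)" using W P2 by auto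
    qed (use ibp(1) energy[OF P(1)] in auto)
    also have "\<dots> = - (\<integral>\<mu>. (c n \<mu>)\<^sup>2 * (P \<mu> * ?L P \<mu>) \<partial>\<Gamma>)"
      using ibp(2) by (simp add: mult.assoc)
    also have "\<dots> \<le> \<bar>\<integral>\<mu>. (c n \<mu>)\<^sup>2 * (P \<mu> * ?L P \<mu>) \<partial>\<Gamma>\<bar>" by simp
    also have "\<dots> \<le> (\<integral>\<mu>. \<bar>(c n \<mu>)\<^sup>2 * (P \<mu> * ?L P \<mu>)\<bar> \<partial>\<Gamma>)"
      using integral_norm_bound[of \<Gamma> "\<lambda>\<mu>. (c n \<mu>)\<^sup>2 * (P \<mu> * ?L P \<mu>)"] by simp
    also have "\<dots> \<le> (\<integral>\<mu>. \<bar>P \<mu> * ?L P \<mu>\<bar> \<partial>\<Gamma>)"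
      using cPL by (intro integral_mono integrable_abs intc PL)
    finally have "(\<integral>\<mu>. W n DP \<mu> \<partial>\<Gamma>) \<le> 2 * (\<integral>\<mu>. \<bar>P \<mu> * ?L P \<mu>\<bar> \<partial>\<Gamma>) + 4 * (\<delta> n * (\<integral>\<mu>. (P \<mu>)\<^sup>2 \<partial>\<Gamma>))"
      using W P2 by simp
    moreover have "\<delta> n * (\<integral>\<mu>. (P \<mu>)\<^sup>2 \<partial>\<Gamma>) \<le> 4 * A * (\<integral>\<mu>. (P \<mu>)\<^sup>2 \<partial>\<Gamma>)"
      using \<delta> by (intro mult_right_mono) auto
    ultimately show ?thesis by simp
  qed
  have F2: "integrable \<Gamma> (\<lambda>\<mu>. (F \<mu>)\<^sup>2)" and G2: "integrable \<Gamma> (\<lambda>\<mu>. (G \<mu>)\<^sup>2)"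
    using F(2) G(2) by (simp_all add: square_integrable_def)
  define KF where "KF = 2 * (\<integral>\<mu>. \<bar>F \<mu> * ?L F \<mu>\<bar> \<partial>\<Gamma>) + 16 * A * (\<integral>\<mu>. (F \<mu>)\<^sup>2 \<partial>\<Gamma>)"
  define KG where "KG = 2 * (\<integral>\<mu>. \<bar>G \<mu> * ?L G \<mu>\<bar> \<partial>\<Gamma>) + 16 * A * (\<integral>\<mu>. (G \<mu>)\<^sup>2 \<partial>\<Gamma>)"
  define K where "K = KF + KG + (\<integral>\<mu>. (F \<mu>)\<^sup>2 \<partial>\<Gamma>) + (\<integral>\<mu>. (G \<mu>)\<^sup>2 \<partial>\<Gamma>)"
  have WF: "(\<integral>\<mu>. W n DF \<mu> \<partial>\<Gamma>) \<le> KF" for n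
    unfolding KF_def by (intro energy_bound DF F intW ibp_F)
  have WG: "(\<integral>\<mu>. W n DG \<mu> \<partial>\<Gamma>) \<le> KG" for n
    unfolding KG_def by (intro energy_bound DG G intW ibp_G)
  \<comment> \<open>The symmetric terms \<open>c^2 * a * DF * DG\<close> cancel in the difference.
    What remains, \<open>2 * a * c * d * (F * DG - G * DF)\<close>, contains the derivative of the
    cutoff.\<close>
  have cross: "\<bar>J n F DF DG \<mu> - J n G DG DF \<mu>\<bar> \<le>
      sqrt (\<delta> n) * (W n DF \<mu> + W n DG \<mu> + (F \<mu>)\<^sup>2 + (G \<mu>)\<^sup>2)" if \<mu>: "\<mu> \<in> finite_measures" for n \<mu>
  proof -
    \<comment> \<open>This weight balances the inequality of arithmetic and geometric means: the
      energies receive \<open>\<theta>\<close>, the squares of \<open>F\<close> and \<open>G\<close>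
      receive \<open>\<delta> n / \<theta> = \<theta>\<close>, and both tend to 0.\<close>
    define \<theta> where "\<theta> = sqrt (\<delta> n)"
    have \<theta>: "\<theta> > 0" "\<delta> n / \<theta> = \<theta>" using \<delta>(1)[of n] by (auto simp: \<theta>_def real_div_sqrt)
    have am_gm: "\<bar>2 * x * y\<bar> \<le> \<theta> * x\<^sup>2 + y\<^sup>2 / \<theta>" for x y
    proof -
      have "0 \<le> (\<theta> * \<bar>x\<bar> - \<bar>y\<bar>)\<^sup>2 / \<theta>" using \<theta> by simp
      also have "\<dots> = \<theta> * x\<^sup>2 + y\<^sup>2 / \<theta> - \<bar>2 * x * y\<bar>"
        using \<theta>(1) by (simp add: power2_diff power_mult_distrib abs_mult field_simps power2_eq_square)
      finally show ?thesis by simp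
    qed
    let ?u = "\<lambda>s. a s * T n F DF \<mu> s * DG \<mu> s - a s * T n G DG \<mu> s * DF \<mu> s"
    let ?U = "\<lambda>s. \<theta> * (c n \<mu>)\<^sup>2 * (a s * (DF \<mu> s)\<^sup>2) + \<theta> * (c n \<mu>)\<^sup>2 * (a s * (DG \<mu> s)\<^sup>2) +
      ((F \<mu>)\<^sup>2 + (G \<mu>)\<^sup>2) / \<theta> * (d n \<mu>)\<^sup>2 * a s"
    have int: "integrable \<mu> (\<lambda>s. a s)" by (intro integrable_bounded_measurable \<mu> bounded_measurable_coefficients)
    have i1: "integrable \<mu> (\<lambda>s. a s * T n F DF \<mu> s * DG \<mu> s)"
      by (intro integrable_bounded_measurable[OF _ \<mu>] bounded_measurable_intros
        bounded_measurable_coefficients bmT(1)[OF DF(1) \<mu>] bmT(2)[OF DG(1) \<mu>])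
    have i2: "integrable \<mu> (\<lambda>s. a s * T n G DG \<mu> s * DF \<mu> s)"
      by (intro integrable_bounded_measurable[OF _ \<mu>] bounded_measurable_intros
        bounded_measurable_coefficients bmT(1)[OF DG(1) \<mu>] bmT(2)[OF DF(1) \<mu>])
    note i3 = sq[OF DF(1) \<mu>] sq[OF DG(1) \<mu>]
    have "\<bar>J n F DF DG \<mu> - J n G DG DF \<mu>\<bar> = \<bar>\<integral>s. ?u s \<partial>\<mu>\<bar>"
      unfolding J_def using i1 i2 by simp
    also have "\<dots> \<le> (\<integral>s. \<bar>?u s\<bar> \<partial>\<mu>)" using integral_norm_bound[of \<mu> ?u] by simp
    also have "\<dots> \<le> (\<integral>s. ?U s \<partial>\<mu>)"
    proof (rule integral_mono)
      show "integrable \<mu> (\<lambda>s. \<bar>?u s\<bar>)" using i1 i2 by auto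
      show "integrable \<mu> ?U" using int i3 by auto
      fix s
      have "?u s = a s * (2 * (c n \<mu> * DG \<mu> s) * (d n \<mu> * F \<mu>) - 2 * (c n \<mu> * DF \<mu> s) * (d n \<mu> * G \<mu>))"
        by (simp add: T_def algebra_simps)
      then have "\<bar>?u s\<bar> = a s * \<bar>2 * (c n \<mu> * DG \<mu> s) * (d n \<mu> * F \<mu>) - 2 * (c n \<mu> * DF \<mu> s) * (d n \<mu> * G \<mu>)\<bar>"
        using a_pos[of s] by (simp only: abs_mult[of "a s"] abs_of_pos)
      also have "\<dots> \<le> a s * ((\<theta> * (c n \<mu> * DG \<mu> s)\<^sup>2 + (d n \<mu> * F \<mu>)\<^sup>2 / \<theta>) + (\<theta> * (c n \<mu> * DF \<mu> s)\<^sup>2 + (d n \<mu> * G \<mu>)\<^sup>2 / \<theta>))"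
        using a_pos[of s] am_gm[of "c n \<mu> * DG \<mu> s" "d n \<mu> * F \<mu>"] am_gm[of "c n \<mu> * DF \<mu> s" "d n \<mu> * G \<mu>"]
        by (intro mult_left_mono) linarith+
      also have "\<dots> = ?U s"
        by (simp add: power_mult_distrib algebra_simps add_divide_distrib)
      finally show "\<bar>?u s\<bar> \<le> ?U s" .
    qed
    also have "\<dots> = \<theta> * W n DF \<mu> + \<theta> * W n DG \<mu> + ((F \<mu>)\<^sup>2 + (G \<mu>)\<^sup>2) / \<theta> * ((d n \<mu>)\<^sup>2 * (\<integral>s. a s \<partial>\<mu>))"
      using int i3 by (simp add: W_def)
    also have "\<dots> \<le> \<theta> * W n DF \<mu> + \<theta> * W n DG \<mu> + ((F \<mu>)\<^sup>2 + (G \<mu>)\<^sup>2) / \<theta> * \<delta> n"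
      using d_bound[OF \<mu>] \<theta>(1) by (intro add_left_mono mult_left_mono) auto
    also have "((F \<mu>)\<^sup>2 + (G \<mu>)\<^sup>2) / \<theta> * \<delta> n = ((F \<mu>)\<^sup>2 + (G \<mu>)\<^sup>2) * (\<delta> n / \<theta>)" by simp
    finally show ?thesis unfolding \<theta>(2) by (simp add: \<theta>_def algebra_simps)
  qed
  have diff: "\<bar>(\<integral>\<mu>. (c n \<mu>)\<^sup>2 * F \<mu> * ?L G \<mu> \<partial>\<Gamma>) - (\<integral>\<mu>. (c n \<mu>)\<^sup>2 * G \<mu> * ?L F \<mu> \<partial>\<Gamma>)\<bar> \<le> sqrt (\<delta> n) * K" for n
  proof -
    let ?u = "\<lambda>\<mu>. J n F DF DG \<mu> - J n G DG DF \<mu>"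
    have iu: "integrable \<Gamma> ?u" using ibp_G(1)[OF DF(1)] ibp_F(1)[OF DG(1)] by auto
    have "\<bar>(\<integral>\<mu>. (c n \<mu>)\<^sup>2 * F \<mu> * ?L G \<mu> \<partial>\<Gamma>) - (\<integral>\<mu>. (c n \<mu>)\<^sup>2 * G \<mu> * ?L F \<mu> \<partial>\<Gamma>)\<bar> = \<bar>\<integral>\<mu>. ?u \<mu> \<partial>\<Gamma>\<bar>"
      unfolding ibp_G(2)[OF DF(1)] ibp_F(2)[OF DG(1)]
      using ibp_G(1)[OF DF(1)] ibp_F(1)[OF DG(1)] by simp
    also have "\<dots> \<le> (\<integral>\<mu>. \<bar>?u \<mu>\<bar> \<partial>\<Gamma>)" using integral_norm_bound[of \<Gamma> ?u] by simp
    also have "\<dots> \<le> (\<integral>\<mu>. sqrt (\<delta> n) * (W n DF \<mu> + W n DG \<mu> + (F \<mu>)\<^sup>2 + (G \<mu>)\<^sup>2) \<partial>\<Gamma>)"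
      using cross intW[OF DF(2)] intW[OF DG(2)] F2 G2 iu by (intro integral_mono) auto
    also have "\<dots> = sqrt (\<delta> n) * ((\<integral>\<mu>. W n DF \<mu> \<partial>\<Gamma>) + (\<integral>\<mu>. W n DG \<mu> \<partial>\<Gamma>) + (\<integral>\<mu>. (F \<mu>)\<^sup>2 \<partial>\<Gamma>) + (\<integral>\<mu>. (G \<mu>)\<^sup>2 \<partial>\<Gamma>))"
      using intW[OF DF(2)] intW[OF DG(2)] F2 G2 by simp
    also have "\<dots> \<le> sqrt (\<delta> n) * K"
      unfolding K_def using \<delta>(1)[of n] WF[of n] WG[of n] by (intro mult_left_mono) auto
    finally show ?thesis .
  qed
  \<comment> \<open>The product of two square integrable functions is integrable and dominates its
    truncations. The limit is used for \<open>F\<close> with the image of \<open>G\<close>, and for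
    \<open>G\<close> with the image of \<open>F\<close>.\<close>
  have lim: "(\<lambda>n. \<integral>\<mu>. (c n \<mu>)\<^sup>2 * P \<mu> * Q \<mu> \<partial>\<Gamma>) \<longlonglongrightarrow> (\<integral>\<mu>. P \<mu> * Q \<mu> \<partial>\<Gamma>)"
    if PQ: "square_integrable \<Gamma> P" "square_integrable \<Gamma> Q" for P Q
  proof (rule integral_dominated_convergence[where w = "\<lambda>\<mu>. \<bar>P \<mu> * Q \<mu>\<bar>"])
    have [measurable]: "P \<in> borel_measurable \<Gamma>" "Q \<in> borel_measurable \<Gamma>"
      using PQ by (auto simp: square_integrable_def)
    show "(\<lambda>\<mu>. P \<mu> * Q \<mu>) \<in> borel_measurable \<Gamma>" "(\<lambda>\<mu>. (c n \<mu>)\<^sup>2 * P \<mu> * Q \<mu>) \<in> borel_measurable \<Gamma>" for n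
      by measurable
    show "integrable \<Gamma> (\<lambda>\<mu>. \<bar>P \<mu> * Q \<mu>\<bar>)" using square_integrable_mult[OF PQ] by simp
    show "AE \<mu> in \<Gamma>. (\<lambda>n. (c n \<mu>)\<^sup>2 * P \<mu> * Q \<mu>) \<longlonglongrightarrow> P \<mu> * Q \<mu>"
    proof (rule AE_I2)
      fix \<mu>
      have "(\<lambda>n. (c n \<mu>)\<^sup>2 * P \<mu> * Q \<mu>) \<longlonglongrightarrow> 1\<^sup>2 * P \<mu> * Q \<mu>"
        unfolding c_def by (intro tendsto_intros cutoff_tendsto)
      then show "(\<lambda>n. (c n \<mu>)\<^sup>2 * P \<mu> * Q \<mu>) \<longlonglongrightarrow> P \<mu> * Q \<mu>" by simp
    qed
    show "AE \<mu> in \<Gamma>. norm ((c n \<mu>)\<^sup>2 * P \<mu> * Q \<mu>) \<le> \<bar>P \<mu> * Q \<mu>\<bar>" for n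
      unfolding mult.assoc real_norm_def abs_mult[of "(c n _)\<^sup>2"]
      using c2_01 by (intro AE_I2 mult_left_le_one_le) auto
  qed
  have "\<delta> \<longlonglongrightarrow> 0"
    unfolding \<delta>_def using tendsto_mult_left[OF LIMSEQ_Suc[OF lim_1_over_n], of "4 * A"] by simp
  then have "(\<lambda>n. sqrt (\<delta> n) * K) \<longlonglongrightarrow> sqrt 0 * K"
    by (intro tendsto_mult_right tendsto_real_sqrt)
  then have "(\<lambda>n. sqrt (\<delta> n) * K) \<longlonglongrightarrow> 0" by simp
  then have "(\<lambda>n. (\<integral>\<mu>. (c n \<mu>)\<^sup>2 * F \<mu> * ?L G \<mu> \<partial>\<Gamma>) - (\<integral>\<mu>. (c n \<mu>)\<^sup>2 * G \<mu> * ?L F \<mu> \<partial>\<Gamma>)) \<longlonglongrightarrow> 0"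
    by (rule Lim_null_comparison[rotated]) (use diff in auto)
  moreover have "(\<lambda>n. (\<integral>\<mu>. (c n \<mu>)\<^sup>2 * F \<mu> * ?L G \<mu> \<partial>\<Gamma>) - (\<integral>\<mu>. (c n \<mu>)\<^sup>2 * G \<mu> * ?L F \<mu> \<partial>\<Gamma>)) \<longlonglongrightarrow>
      (\<integral>\<mu>. F \<mu> * ?L G \<mu> \<partial>\<Gamma>) - (\<integral>\<mu>. G \<mu> * ?L F \<mu> \<partial>\<Gamma>)"
    by (intro tendsto_diff lim F G)
  ultimately have "0 = (\<integral>\<mu>. F \<mu> * ?L G \<mu> \<partial>\<Gamma>) - (\<integral>\<mu>. G \<mu> * ?L F \<mu> \<partial>\<Gamma>)"
    by (rule LIMSEQ_unique)
  then show "(\<integral>\<mu>. F \<mu> * ?L G \<mu> \<partial>\<Gamma>) = (\<integral>\<mu>. G \<mu> * ?L F \<mu> \<partial>\<Gamma>)" by simp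
qed

end

theorem theorem5p5:
  fixes a b :: "'a::metric_space \<Rightarrow> real"
    and \<mu>\<^sub>0 :: "'a measure"
    and \<Gamma> :: "'a measure measure"
  assumes "compact (UNIV :: 'a set)"
    and "sets \<mu>\<^sub>0 = sets borel" and "finite_measure \<mu>\<^sub>0"
    and "continuous_on UNIV a" and "\<forall>s. a s > 0"
    and "continuous_on UNIV b" and "\<forall>s. b s > 0"
    and "is_Gamma_law a b \<mu>\<^sub>0 \<Gamma>"
  shows "Lambda_quasi_invariant a b \<mu>\<^sub>0 \<Gamma> \<and> reversible a b \<mu>\<^sub>0 \<Gamma>"
proof -
  interpret gamma_law a b \<mu>\<^sub>0 \<Gamma>
    by unfold_locales (use assms in \<open>auto simp: finite_measures_def\<close>)
  show ?thesis using quasi_invariant reversible by blast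
qed

end
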